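(* Let $\Delta$ be a non-thick spherical building of irreducible type $(W,S)$ with thick frame $\Delta'$ of type $(W',S')$. Let $\theta$ be an automorphism of $\Delta$ and let $\theta'$ be the induced automorphism of $\Delta'$. Then $\theta$ is uniclass if and only if $\theta'$ is uniclass.
   Context: For an automorphism $\theta$ of a building with Weyl distance $\delta$, the companion automorphism $\sigma$ is the automorphism of the Coxeter graph given by $\delta(C,D)=s\iff\delta(C^\theta,D^\theta)=s^\sigma$; $\mathrm{disp}(\theta)=\{\delta(C,C^\theta)\mid C\text{ a chamber}\}$; $\theta$ is uniclass if $\mathrm{disp}(\theta)$ is contained in a single $\sigma$-conjugacy class $\{v^{-1}wv^\sigma\mid v\in W\}$. A building is thick if every panel lies in at least three chambers. Thick frame (Scharlau). Adjacent chambers $C,D$ of $\Delta$ are thin-adjacent if the panel common to them lies in exactly two chambers. A thin class is an equivalence class of chambers under being joined by a gallery involving only thin adjacencies. $\mathrm{Ch}(\Delta')$ is the set of thin classes; thin classes $C',D'$ are adjacent if there are adjacent chambers $C\in C'$, $D\in D'$. Fix an apartment $A_0$ of $\Delta$ and a chamber $C_0$ of $A_0$, and let $C_0'$ be the thin class of $C_0$ (it is contained in $A_0$). Let $W'\leq W$ be the reflection subgroup generated by the reflections in the thick walls of $A_0$ (walls whose panels lie in at least three chambers of $\Delta$), and $S'$ the set of reflections in the (necessarily thick) walls bounding $C_0'$; $(W',S')$ is a Coxeter system. Identify the chambers of $A_0$ with $W$ such that $C_0\leftrightarrow 1$ and the $s$-adjacent chamber of $C_0$ in $A_0$ corresponds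 to $s$, and let $U\subseteq W$ be the set of elements corresponding to chambers of $C_0'$. For a thin class $C'$ choose an apartment $A$ containing $C_0'$ and $C'$; $W'$ acts simply transitively on the thin classes in $A$ (with $S'$ the reflections in the walls bounding $C_0'$), and for $u\in U$ let $C'[u]$ be the unique chamber of $C'$ in the $W'$-orbit of the chamber $u$ of $C_0'$ (this is independent of $A$). The $W'$-distance on $\Delta'$ is $\delta'(C',D')=\delta(C'[1],D'[1])\in W'$; this makes $\Delta'$ a thick spherical building of type $(W',S')$. The induced automorphism is $C'^{\theta'}=\{C^\theta\mid C\in C'\}$. *)

theory Defs
  imports "HOL-Algebra.Multiplicative_Group"
begin

section \<open>Coxeter systems\<close>

definition word_prod :: "('w, 'm) monoid_scheme \<Rightarrow> 'w list \<Rightarrow> 'w" where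
  "word_prod W ws = foldr (\<otimes>\<^bsub>W\<^esub>) ws \<one>\<^bsub>W\<^esub>"

definition coxeter_m :: "('w, 'm) monoid_scheme \<Rightarrow> 'w \<Rightarrow> 'w \<Rightarrow> nat" where
  "coxeter_m W s t = group.ord W (s \<otimes>\<^bsub>W\<^esub> t)"

text \<open>The congruence on words over \<open>S\<close> generated by the Coxeter relators
  \<open>(s t)\<^sup>m\<close>. The case \<open>s = t\<close> (where \<open>m = 1\<close>) gives \<open>s s = 1\<close>; since the library's
  \<open>ord\<close> is \<open>0\<close> for elements of infinite order, \<open>m(s,t) = \<infinity>\<close> imposes no relation.\<close>

inductive coxeter_equiv :: "('w, 'm) monoid_scheme \<Rightarrow> 'w set \<Rightarrow> 'w list \<Rightarrow> 'w list \<Rightarrow> bool"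
  for W S where
  relator: "\<lbrakk>s \<in> S; t \<in> S; xs \<in> lists S; ys \<in> lists S\<rbrakk> \<Longrightarrow>
     coxeter_equiv W S (xs @ concat (replicate (coxeter_m W s t) [s, t]) @ ys) (xs @ ys)"
| refl: "xs \<in> lists S \<Longrightarrow> coxeter_equiv W S xs xs"
| sym: "coxeter_equiv W S xs ys \<Longrightarrow> coxeter_equiv W S ys xs"
| trans: "\<lbrakk>coxeter_equiv W S xs ys; coxeter_equiv W S ys zs\<rbrakk> \<Longrightarrow> coxeter_equiv W S xs zs"

text \<open>\<open>presentation\<close> says that every relation between the generators follows from the
  Coxeter relations, i.e. \<open>W = \<langle>S | (s t)\<^sup>m = 1\<rangle>\<close> with \<open>m = m(s,t)\<close>.\<close>

locale coxeter_system = group W for W (structure) +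
  fixes S
  assumes gens_closed: "S \<subseteq> carrier W"
    and gens_nontriv: "\<one> \<notin> S"
    and gens_invol: "s \<in> S \<Longrightarrow> s \<otimes> s = \<one>"
    and gens_generate: "generate W S = carrier W"
    and presentation: "\<lbrakk>xs \<in> lists S; ys \<in> lists S; word_prod W xs = word_prod W ys\<rbrakk>
      \<Longrightarrow> coxeter_equiv W S xs ys"

definition word_length :: "('w, 'm) monoid_scheme \<Rightarrow> 'w set \<Rightarrow> 'w \<Rightarrow> nat" where
  "word_length W S w = (LEAST n. \<exists>ws \<in> lists S. length ws = n \<and> word_prod W ws = w)"

definition coxeter_graph :: "('w, 'm) monoid_scheme \<Rightarrow> 'w set \<Rightarrow> ('w \<times> 'w) set" where
  "coxeter_graph W S = {(s, t). s \<in> S \<and> t \<in> S \<and> s \<noteq> t \<and> coxeter_m W s t \<noteq> 2}"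

definition irreducible_type :: "('w, 'm) monoid_scheme \<Rightarrow> 'w set \<Rightarrow> bool" where
  "irreducible_type W S \<longleftrightarrow> S \<noteq> {} \<and> (\<forall>s \<in> S. \<forall>t \<in> S. (s, t) \<in> (coxeter_graph W S)\<^sup>*)"

definition coxeter_graph_aut :: "('w, 'm) monoid_scheme \<Rightarrow> 'w set \<Rightarrow> ('w \<Rightarrow> 'w) \<Rightarrow> bool" where
  "coxeter_graph_aut W S \<sigma> \<longleftrightarrow> bij_betw \<sigma> S S \<and>
     (\<forall>s \<in> S. \<forall>t \<in> S. coxeter_m W (\<sigma> s) (\<sigma> t) = coxeter_m W s t)"


section \<open>Automorphisms, displacement, uniclass\<close>

text \<open>An automorphism of the Coxeter graph extends uniquely to an automorphism of \<open>W\<close>;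
  the companion \<open>\<sigma>\<close> stands for this extension.\<close>

definition companion ::
  "('w, 'm) monoid_scheme \<Rightarrow> 'w set \<Rightarrow> 'c set \<Rightarrow> ('c \<Rightarrow> 'c \<Rightarrow> 'w) \<Rightarrow> ('c \<Rightarrow> 'c) \<Rightarrow> ('w \<Rightarrow> 'w) \<Rightarrow> bool" where
  "companion W S Ch \<delta> \<theta> \<sigma> \<longleftrightarrow> \<sigma> \<in> iso W W \<and> coxeter_graph_aut W S \<sigma> \<and>
     (\<forall>C \<in> Ch. \<forall>D \<in> Ch. \<forall>s \<in> S. \<delta> C D = s \<longleftrightarrow> \<delta> (\<theta> C) (\<theta> D) = \<sigma> s)"

text \<open>Automorphisms need not preserve types.\<close>

definition building_automorphism ::
  "('w, 'm) monoid_scheme \<Rightarrow> 'w set \<Rightarrow> 'c set \<Rightarrow> ('c \<Rightarrow> 'c \<Rightarrow> 'w) \<Rightarrow> ('c \<Rightarrow> 'c) \<Rightarrow> bool" where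
  "building_automorphism W S Ch \<delta> \<theta> \<longleftrightarrow> bij_betw \<theta> Ch Ch \<and> (\<exists>\<sigma>. companion W S Ch \<delta> \<theta> \<sigma>)"

definition disp :: "'c set \<Rightarrow> ('c \<Rightarrow> 'c \<Rightarrow> 'w) \<Rightarrow> ('c \<Rightarrow> 'c) \<Rightarrow> 'w set" where
  "disp Ch \<delta> \<theta> = {\<delta> C (\<theta> C) | C. C \<in> Ch}"

definition twisted_class :: "('w, 'm) monoid_scheme \<Rightarrow> ('w \<Rightarrow> 'w) \<Rightarrow> 'w \<Rightarrow> 'w set" where
  "twisted_class W \<sigma> w = {inv\<^bsub>W\<^esub> v \<otimes>\<^bsub>W\<^esub> w \<otimes>\<^bsub>W\<^esub> \<sigma> v | v. v \<in> carrier W}"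

text \<open>In a building every \<open>s \<in> S\<close> is a distance, so the companion is unique on
  \<open>carrier W\<close> and the quantifier over \<open>\<sigma>\<close> merely names it.\<close>

definition uniclass ::
  "('w, 'm) monoid_scheme \<Rightarrow> 'w set \<Rightarrow> 'c set \<Rightarrow> ('c \<Rightarrow> 'c \<Rightarrow> 'w) \<Rightarrow> ('c \<Rightarrow> 'c) \<Rightarrow> bool" where
  "uniclass W S Ch \<delta> \<theta> \<longleftrightarrow>
     (\<exists>\<sigma>. companion W S Ch \<delta> \<theta> \<sigma> \<and> (\<exists>w \<in> carrier W. disp Ch \<delta> \<theta> \<subseteq> twisted_class W \<sigma> w))"


section \<open>Buildings as sets with a Weyl distance\<close>

locale building = coxeter_system W S
  for W :: "('w, 'm) monoid_scheme" (structure) and S :: "'w set" +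
  fixes Ch :: "'c set" and \<delta> :: "'c \<Rightarrow> 'c \<Rightarrow> 'w"
  assumes chambers_nonempty: "Ch \<noteq> {}"
    and dist_closed: "\<lbrakk>C \<in> Ch; D \<in> Ch\<rbrakk> \<Longrightarrow> \<delta> C D \<in> carrier W"
    and WD1: "\<lbrakk>C \<in> Ch; D \<in> Ch\<rbrakk> \<Longrightarrow> \<delta> C D = \<one> \<longleftrightarrow> C = D"
    and WD2: "\<lbrakk>B \<in> Ch; C \<in> Ch; D \<in> Ch; s \<in> S; \<delta> B C = s\<rbrakk>
      \<Longrightarrow> \<delta> B D \<in> {s \<otimes> \<delta> C D, \<delta> C D}"
    and WD2_length: "\<lbrakk>B \<in> Ch; C \<in> Ch; D \<in> Ch; s \<in> S; \<delta> B C = s;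
        word_length W S (s \<otimes> \<delta> C D) = word_length W S (\<delta> C D) + 1\<rbrakk>
      \<Longrightarrow> \<delta> B D = s \<otimes> \<delta> C D"
    and WD3: "\<lbrakk>C \<in> Ch; D \<in> Ch; s \<in> S\<rbrakk> \<Longrightarrow> \<exists>B \<in> Ch. \<delta> B C = s \<and> \<delta> B D = s \<otimes> \<delta> C D"
begin

text \<open>A panel is identified with the set of chambers containing it.\<close>

definition panel :: "'w \<Rightarrow> 'c \<Rightarrow> 'c set" where
  "panel s C = {D \<in> Ch. \<delta> C D \<in> {\<one>, s}}"

definition panels :: "'c set set" where
  "panels = {panel s C | s C. s \<in> S \<and> C \<in> Ch}"

text \<open>Panels may be infinite, in which case their \<open>card\<close> is \<open>0\<close>.\<close>

definition thick_panel :: "'c set \<Rightarrow> bool" where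
  "thick_panel P \<longleftrightarrow> (\<exists>T \<subseteq> P. card T = 3)"

definition thick :: bool where
  "thick \<longleftrightarrow> (\<forall>P \<in> panels. thick_panel P)"

text \<open>Apartments are the isometric copies of the thin building \<open>W\<close>. For finite \<open>W\<close>
  this is the unique apartment system.\<close>

definition apartment :: "'c set \<Rightarrow> bool" where
  "apartment A \<longleftrightarrow> (\<exists>\<alpha>. \<alpha> \<in> carrier W \<rightarrow> Ch \<and> A = \<alpha> ` carrier W \<and>
     (\<forall>v \<in> carrier W. \<forall>w \<in> carrier W. \<delta> (\<alpha> v) (\<alpha> w) = inv v \<otimes> w))"

definition thin_adj :: "('c \<times> 'c) set" where
  "thin_adj = {(C, D). C \<in> Ch \<and> D \<in> Ch \<and> \<delta> C D \<in> S \<and> card (panel (\<delta> C D) C) = 2}"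

definition thin_equiv :: "('c \<times> 'c) set" where
  "thin_equiv = {(C, D). C \<in> Ch \<and> D \<in> Ch \<and> (C, D) \<in> thin_adj\<^sup>*}"

definition thin_classes :: "'c set set" where
  "thin_classes = Ch // thin_equiv"

definition reflections :: "'w set" where
  "reflections = {w \<otimes> s \<otimes> inv w | w s. w \<in> carrier W \<and> s \<in> S}"

end

locale spherical_building = building W S Ch \<delta>
  for W :: "('w, 'm) monoid_scheme" (structure) and S :: "'w set"
    and Ch :: "'c set" and \<delta> :: "'c \<Rightarrow> 'c \<Rightarrow> 'w" +
  assumes spherical: "finite (carrier W)"


section \<open>The thick frame\<close>

locale thick_frame = spherical_building W S Ch \<delta>
  for W :: "('w, 'm) monoid_scheme" (structure) and S :: "'w set"
    and Ch :: "'c set" and \<delta> :: "'c \<Rightarrow> 'c \<Rightarrow> 'w" +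
  fixes A\<^sub>0 :: "'c set" and C\<^sub>0 :: 'c
  assumes base_apartment: "apartment A\<^sub>0"
    and base_chamber: "C\<^sub>0 \<in> A\<^sub>0"
begin

text \<open>The identification of \<open>W\<close> with an apartment \<open>A\<close> containing \<open>C\<^sub>0\<close> that matches
  \<open>1\<close> with \<open>C\<^sub>0\<close>.\<close>

definition chamber_at :: "'c set \<Rightarrow> 'w \<Rightarrow> 'c" where
  "chamber_at A w = (THE D. D \<in> A \<and> \<delta> C\<^sub>0 D = w)"

text \<open>Under this identification \<open>W\<close> acts on \<open>A\<close> by left multiplication; this is the
  action under which the elements of \<open>reflections\<close> are the reflections of \<open>A\<close>.\<close>

definition act :: "'c set \<Rightarrow> 'w \<Rightarrow> 'c \<Rightarrow> 'c" where
  "act A w D = chamber_at A (w \<otimes> \<delta> C\<^sub>0 D)"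

text \<open>The wall of a reflection \<open>r\<close>, as the set of panels of \<open>A\<close> that \<open>r\<close> fixes.\<close>

definition wall :: "'c set \<Rightarrow> 'w \<Rightarrow> 'c set set" where
  "wall A r = {P \<in> panels. P \<inter> A \<noteq> {} \<and> act A r ` (P \<inter> A) = P \<inter> A}"

definition thick_reflections :: "'w set" where
  "thick_reflections = {r \<in> reflections. \<forall>P \<in> wall A\<^sub>0 r. thick_panel P}"

definition base_class :: "'c set" where
  "base_class = thin_equiv `` {C\<^sub>0}"

definition frame_group :: "('w, 'm) monoid_scheme" where
  "frame_group = W\<lparr>carrier := generate W thick_reflections\<rparr>"

text \<open>A wall bounds the thin class of \<open>C\<^sub>0\<close> if one of its panels lies between a chamber
  of that class and a chamber of \<open>A\<^sub>0\<close> outside it.\<close>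

definition frame_gens :: "'w set" where
  "frame_gens = {r \<in> reflections. \<exists>P \<in> wall A\<^sub>0 r. P \<inter> base_class \<noteq> {} \<and> \<not> P \<inter> A\<^sub>0 \<subseteq> base_class}"

text \<open>The chamber \<open>C'[u]\<close>, for a thin class \<open>C'\<close> and for \<open>u\<close> in the set \<open>U\<close> of the
  elements corresponding to chambers of the thin class of \<open>C\<^sub>0\<close>.\<close>

definition frame_chamber :: "'c set \<Rightarrow> 'w \<Rightarrow> 'c" where
  "frame_chamber C' u = (THE D. D \<in> C' \<and>
     (\<exists>A. apartment A \<and> base_class \<subseteq> A \<and> C' \<subseteq> A \<and>
       (\<exists>w \<in> carrier frame_group. D = act A w (chamber_at A\<^sub>0 u))))"

definition frame_dist :: "'c set \<Rightarrow> 'c set \<Rightarrow> 'w" where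
  "frame_dist C' D' = \<delta> (frame_chamber C' \<one>) (frame_chamber D' \<one>)"

end

end

theory Submission
  imports Defs
begin

text \<open>Write \<open>T'\<close> for the reflections in thick walls, \<open>W' = \<langle>T'\<rangle>\<close>, and \<open>U\<close> for the elements of \<open>W\<close>
  separated from \<open>1\<close> by no thick wall. Every \<open>w\<close> is uniquely \<open>g u\<close> with \<open>g \<in> W'\<close> and \<open>u \<in> U\<close>, and
  two chambers are thin-equivalent iff no thick wall separates them. The automorphism maps
  \<open>C'[u]\<close> to \<open>(\<theta>' C')[a \<sigma>(u)]\<close> with \<open>a \<in> U\<close> independent of \<open>C'\<close>, because two such elements differ by
  an element of \<open>W' \<inter> U = {1}\<close>. Hence \<open>\<theta>'\<close> has companion \<open>\<sigma>' = a \<sigma>(\<cdot>) a\<inverse>\<close> and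
  \<open>\<delta>(C'[u], \<theta> C'[u]) = u\<inverse> \<delta>'(C', \<theta>' C') a \<sigma>(u)\<close>, so if \<open>disp \<theta>'\<close> lies in one \<open>\<sigma>'\<close>-class then
  \<open>disp \<theta>\<close> lies in one \<open>\<sigma>\<close>-class. For the converse the conjugating elements must be found in \<open>W'\<close>.
  If \<open>\<theta>\<close> is uniclass then all displacements have the same sign, so crossing a panel of type \<open>s\<close> either
  keeps the displacement \<open>f\<close> or replaces it by \<open>s f \<sigma>(s)\<close>; following a gallery that starts at \<open>C\<^sub>0\<close>
  yields a conjugating element in the right coset of \<open>W'\<close>.\<close>


section \<open>Inversions and length in Coxeter systems\<close>


text \<open>The conjugating elements that uniclass provides for \<open>\<theta>\<close> lie only in
  \<open>W\<close>, and nothing moves them into \<open>W'\<close>. They are therefore discarded: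
  only the constancy of the sign is kept, and new conjugators are built along galleries. A chamber
  \<open>C'[1]\<close> has its distance from \<open>C\<^sub>0\<close> in \<open>W'\<close>, so a
  conjugator in the right coset of that distance is an element of \<open>W'\<close>. No root system
  is used. A wall is represented by its reflection, and the set of walls separating \<open>1\<close>
  from \<open>w\<close> by the parity of crossings along any word for \<open>w\<close>; the cocycle
  identity for these sets drives both the exchange condition and \<open>W' \<inter> U = {1}\<close>.
  Three chambers need not lie in one apartment, so distances from \<open>C\<^sub>0\<close> do not
  multiply along a gallery; they do so up to a left factor in \<open>W'\<close>. Sphericity supplies
  a longest element, from which come the apartments through two chambers and the fact that thickness
  belongs to a wall and not to a single panel.\<close>

lemma (in group) inv_cancel_left [simp]:
  "\<lbrakk>x \<in> carrier G; y \<in> carrier G\<rbrakk> \<Longrightarrow> inv x \<otimes> (x \<otimes> y) = y"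
  "\<lbrakk>x \<in> carrier G; y \<in> carrier G\<rbrakk> \<Longrightarrow> x \<otimes> (inv x \<otimes> y) = y"
  by (simp_all flip: m_assoc)

definition (in group) conj_by :: "'a \<Rightarrow> 'a \<Rightarrow> 'a" where
  "conj_by x t = x \<otimes> t \<otimes> inv x"

context group
begin

lemma conj_closed [simp]: "\<lbrakk>x \<in> carrier G; t \<in> carrier G\<rbrakk> \<Longrightarrow> conj_by x t \<in> carrier G"
  by (simp add: conj_by_def)

lemma conj_conj: "\<lbrakk>x \<in> carrier G; y \<in> carrier G; t \<in> carrier G\<rbrakk> \<Longrightarrow>
    conj_by x (conj_by y t) = conj_by (x \<otimes> y) t"
  by (simp add: conj_by_def m_assoc inv_mult_group)

lemma conj_one_left [simp]: "t \<in> carrier G \<Longrightarrow> conj_by \<one> t = t"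
  by (simp add: conj_by_def)

lemma conj_one_right [simp]: "x \<in> carrier G \<Longrightarrow> conj_by x \<one> = \<one>"
  by (simp add: conj_by_def)

lemma conj_inv_conj [simp]:
  "\<lbrakk>x \<in> carrier G; t \<in> carrier G\<rbrakk> \<Longrightarrow> conj_by (inv x) (conj_by x t) = t"
  "\<lbrakk>x \<in> carrier G; t \<in> carrier G\<rbrakk> \<Longrightarrow> conj_by x (conj_by (inv x) t) = t"
  by (simp_all add: conj_conj)

lemma conj_mult: "\<lbrakk>x \<in> carrier G; s \<in> carrier G; t \<in> carrier G\<rbrakk> \<Longrightarrow>
    conj_by x (s \<otimes> t) = conj_by x s \<otimes> conj_by x t"
  by (simp add: conj_by_def m_assoc)

lemma conj_eq_iff: "\<lbrakk>x \<in> carrier G; s \<in> carrier G; t \<in> carrier G\<rbrakk> \<Longrightarrow>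
    conj_by x s = t \<longleftrightarrow> s = conj_by (inv x) t"
  by auto

lemma word_prod_Nil [simp]: "word_prod G [] = \<one>"
  and word_prod_Cons [simp]: "word_prod G (x # xs) = x \<otimes> word_prod G xs"
  by (simp_all add: word_prod_def)

lemma word_prod_closed [simp]: "xs \<in> lists (carrier G) \<Longrightarrow> word_prod G xs \<in> carrier G"
  by (induction xs) auto

lemma word_prod_append:
  "\<lbrakk>xs \<in> lists (carrier G); ys \<in> lists (carrier G)\<rbrakk> \<Longrightarrow>
    word_prod G (xs @ ys) = word_prod G xs \<otimes> word_prod G ys"
  by (induction xs) (auto simp: m_assoc)

lemma generate_eq_word_prod:
  assumes "R \<subseteq> carrier G" and "\<And>r. r \<in> R \<Longrightarrow> r \<otimes> r = \<one>"
  shows "generate G R = word_prod G ` lists R"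
proof
  have sub: "lists R \<subseteq> lists (carrier G)"
    using assms(1) by (rule lists_mono)
  show "generate G R \<subseteq> word_prod G ` lists R"
  proof
    fix x assume "x \<in> generate G R"
    then show "x \<in> word_prod G ` lists R"
    proof induction
      case one
      show ?case by (rule image_eqI[of _ _ "[]"]) auto
    next
      case (incl h)
      then show ?case using assms(1) by (intro image_eqI[of _ _ "[h]"]) auto
    next
      case (inv h)
      then have "inv h = h"
        using assms by (metis inv_equality subsetD)
      with inv show ?case using assms(1) by (intro image_eqI[of _ _ "[h]"]) auto
    next
      case (eng h1 h2)
      then obtain xs ys where "xs \<in> lists R" "ys \<in> lists R" "h1 = word_prod G xs" "h2 = word_prod G ys"
        by auto
      then show ?case
        using sub by (intro image_eqI[of _ _ "xs @ ys"]) (auto simp: word_prod_append subset_iff)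
    qed
  qed
  show "word_prod G ` lists R \<subseteq> generate G R"
  proof clarify
    fix xs assume "\<forall>x\<in>set xs. x \<in> R"
    then show "word_prod G xs \<in> generate G R"
      by (induction xs) (auto intro: generate.intros)
  qed
qed

text \<open>Strong exchange, isolated from the choice of generators because it serves both the Coxeter
  generators and the walls of a thin class: all it needs is a set-valued cocycle \<open>N\<close> with
  \<open>N r = {r}\<close> on the generators.\<close>

lemma strong_exchange:
  assumes "R \<subseteq> carrier G" and "T \<subseteq> carrier G"
    and invol: "\<And>r. r \<in> R \<Longrightarrow> r \<otimes> r = \<one>"
    and conj_T: "\<And>r t. \<lbrakk>r \<in> R; t \<in> T\<rbrakk> \<Longrightarrow> conj_by r t \<in> T"
    and one: "\<And>t. t \<in> T \<Longrightarrow> t \<notin> N \<one>"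
    and cocycle: "\<And>r x t. \<lbrakk>r \<in> R; x \<in> carrier G; t \<in> T\<rbrakk> \<Longrightarrow>
      t \<in> N (r \<otimes> x) \<longleftrightarrow> (t = r) \<noteq> (conj_by r t \<in> N x)"
    and "rs \<in> lists R" "t \<in> T" "t \<in> N (word_prod G rs)"
  shows "\<exists>xs r ys. rs = xs @ r # ys \<and> t \<otimes> word_prod G rs = word_prod G (xs @ ys)"
  using assms(7-9)
proof (induction rs arbitrary: t rule: list.induct)
  case Nil
  then show ?case using one by simp
next
  case (Cons r rs)
  have r: "r \<in> R" "r \<in> carrier G" and rs: "rs \<in> lists R" "word_prod G rs \<in> carrier G"
    using Cons.prems(1) assms(1) by (auto intro!: word_prod_closed)
  have t: "t \<in> carrier G"
    using Cons.prems assms(2) by auto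
  show ?case
  proof (cases "t = r")
    case True
    then have "t \<otimes> word_prod G (r # rs) = word_prod G ([] @ rs)"
      using r rs t invol by (simp flip: m_assoc)
    then show ?thesis by blast
  next
    case False
    then have "conj_by r t \<in> N (word_prod G rs)"
      using cocycle[OF r(1) rs(2) Cons.prems(2)] Cons.prems(3) by simp
    from Cons.IH[OF rs(1) conj_T[OF r(1) Cons.prems(2)] this]
    obtain xs r' ys where *: "rs = xs @ r' # ys"
      "conj_by r t \<otimes> word_prod G rs = word_prod G (xs @ ys)"
      by blast
    have "inv r = r"
      using r invol by (simp add: inv_equality)
    then have "r \<otimes> (conj_by r t \<otimes> word_prod G rs) = t \<otimes> word_prod G (r # rs)"
      using r rs t invol[OF r(1)]
      by (simp add: conj_by_def m_assoc) (simp flip: m_assoc)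
    with * have "t \<otimes> word_prod G (r # rs) = word_prod G ((r # xs) @ ys)"
      by simp
    with *(1) show ?thesis
      by (metis append_Cons)
  qed
qed

end

section \<open>Crossing parity, inversion sets and the sign\<close>

context coxeter_system
begin

lemma gen_closed [simp]: "s \<in> S \<Longrightarrow> s \<in> carrier W"
  using gens_closed by auto

lemma gen_inv [simp]: "s \<in> S \<Longrightarrow> inv s = s"
  by (simp add: gens_invol inv_equality)

lemma gen_cancel [simp]: "\<lbrakk>s \<in> S; x \<in> carrier W\<rbrakk> \<Longrightarrow> s \<otimes> (s \<otimes> x) = x"
  by (metis gen_closed gen_inv inv_cancel_left(1))

lemma gen_cancel_right [simp]: "\<lbrakk>s \<in> S; x \<in> carrier W\<rbrakk> \<Longrightarrow> x \<otimes> s \<otimes> s = x"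
  by (simp add: m_assoc gens_invol)

lemma conj_gen_gen [simp]: "\<lbrakk>s \<in> S; t \<in> carrier W\<rbrakk> \<Longrightarrow> conj_by s (conj_by s t) = t"
  using conj_inv_conj(1)[of s t] by simp

lemma lists_gens_closed: "ws \<in> lists S \<Longrightarrow> ws \<in> lists (carrier W)"
  using gens_closed by auto

lemma word_prod_gens_closed [simp]: "ws \<in> lists S \<Longrightarrow> word_prod W ws \<in> carrier W"
  by (simp add: lists_gens_closed del: in_lists_conv_set)

lemma ex_word:
  assumes "w \<in> carrier W"
  obtains ws where "ws \<in> lists S" "word_prod W ws = w"
  using generate_eq_word_prod[OF gens_closed] gens_invol gens_generate assms by (metis imageE)

text \<open>Whether the gallery from \<open>1\<close> of type \<open>ws\<close> crosses the wall of \<open>t\<close> an odd number of times.\<close>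

primrec crosses :: "'a list \<Rightarrow> 'a \<Rightarrow> bool" where
  "crosses [] t = False"
| "crosses (s # ws) t = ((t = s) \<noteq> crosses ws (conj_by s t))"

text \<open>After the prefix \<open>xs\<close> the gallery stands at \<open>word_prod W xs\<close>;
  translating that chamber back to \<open>1\<close> conjugates the wall of \<open>t\<close> by the
  inverse.\<close>

lemma crosses_append:
  assumes "xs \<in> lists S" "t \<in> carrier W"
  shows "crosses (xs @ ys) t = (crosses xs t \<noteq> crosses ys (conj_by (inv (word_prod W xs)) t))"
  using assms
proof (induction xs arbitrary: t rule: list.induct)
  case (Cons s xs)
  then have s: "s \<in> S" and xs: "xs \<in> lists S" by auto
  show ?case
    using Cons.IH[OF xs, of "conj_by s t"] Cons.prems(2) s word_prod_gens_closed[OF xs]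
    by (simp add: conj_conj inv_mult_group del: in_lists_conv_set) blast
qed simp

text \<open>The step with index \<open>j\<close> of the gallery of type \<open>s t s t ...\<close>,
  counted from \<open>0\<close>, crosses the wall of \<open>(s t)^j s\<close>; the sum counts the
  steps that meet the wall of \<open>x\<close>.\<close>

lemma crosses_alternating:
  assumes s: "s \<in> S" and t: "t \<in> S" and x: "x \<in> carrier W"
  shows "crosses (concat (replicate k [s, t])) x \<longleftrightarrow>
    odd (\<Sum>j<2*k. if (s \<otimes> t) [^] j \<otimes> s = x then 1 else (0::nat))"
  using x
proof (induction k arbitrary: x)
  case (Suc k)
  let ?f = "\<lambda>x j. if (s \<otimes> t) [^] (j::nat) \<otimes> s = x then 1 else (0::nat)"
  have st: "s \<in> carrier W" "t \<in> carrier W" using s t by auto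
  \<comment> \<open>Removing the first two letters conjugates the wall by \<open>t s\<close>, and
    index \<open>j\<close> of the shortened word is index \<open>j + 2\<close> of the whole
    one.\<close>
  have shift: "?f (conj_by t (conj_by s x)) j = ?f x (Suc (Suc j))" for j
  proof -
    have p: "(s \<otimes> t) [^] j \<in> carrier W" using st by simp
    have "(s \<otimes> t) [^] j \<otimes> s = conj_by t (conj_by s x) \<longleftrightarrow>
        conj_by s (conj_by t ((s \<otimes> t) [^] j \<otimes> s)) = x"
      using st Suc.prems p s t
      by (metis conj_closed conj_inv_conj gen_inv m_closed)
    also have "conj_by s (conj_by t ((s \<otimes> t) [^] j \<otimes> s)) = (s \<otimes> t) \<otimes> (s \<otimes> t) [^] j \<otimes> ((s \<otimes> t) \<otimes> s)"
      using st p s t by (simp add: conj_by_def m_assoc)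
    also have "\<dots> = (s \<otimes> t) \<otimes> (s \<otimes> t) [^] j \<otimes> (s \<otimes> t) \<otimes> s"
      using st p by (simp add: m_assoc)
    also have "(s \<otimes> t) \<otimes> (s \<otimes> t) [^] j \<otimes> (s \<otimes> t) = (s \<otimes> t) [^] Suc (Suc j)"
      using st by (metis m_closed nat_pow_Suc nat_pow_Suc2)
    finally show ?thesis by simp
  qed
  have "(\<Sum>j<2 * Suc k. ?f x j) = ?f x 0 + ?f x 1 + (\<Sum>j<2*k. ?f x (Suc (Suc j)))"
    by (simp only: mult_Suc_right add_2_eq_Suc sum.lessThan_Suc_shift One_nat_def add.assoc comp_def)
  also have "(\<Sum>j<2*k. ?f x (Suc (Suc j))) = (\<Sum>j<2*k. ?f (conj_by t (conj_by s x)) j)"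
    using shift by simp
  finally have sum: "(\<Sum>j<2 * Suc k. ?f x j) = ?f x 0 + ?f x 1 + \<dots>" .
  have "(s \<otimes> t \<otimes> s = x) = (conj_by s x = t)"
    using st Suc.prems s conj_eq_iff[of s t x] by (auto simp: conj_by_def conj_eq_iff m_assoc)
  then have "?f x 1 = (if conj_by s x = t then 1 else 0)"
    using st by simp
  have odd3: "odd ((if P then 1 else 0) + (if Q then 1 else 0) + n) = (P \<noteq> (Q \<noteq> odd n))"
    for P Q and n :: nat
    by simp
  have "?f x 0 = (if x = s then 1 else 0)"
    using st by auto
  with \<open>?f x 1 = _\<close> show ?case
    using Suc.IH[of "conj_by t (conj_by s x)"] Suc.prems st odd3 by (simp only: sum) simp
qed simp

text \<open>Since \<open>(s t)^m = 1\<close>, the walls met in the second half of the relator repeat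
  those of the first half, so each is met an even number of times. For infinite order
  \<open>m\<close> is \<open>0\<close> and the word is empty.\<close>

lemma not_crosses_relator:
  assumes "s \<in> S" "t \<in> S" "x \<in> carrier W"
  shows "\<not> crosses (concat (replicate (coxeter_m W s t) [s, t])) x"
proof -
  let ?m = "coxeter_m W s t"
  let ?f = "\<lambda>j. if (s \<otimes> t) [^] (j::nat) \<otimes> s = x then 1 else (0::nat)"
  have "(s \<otimes> t) [^] ?m = \<one>"
    using assms by (simp add: coxeter_m_def)
  then have "?f (j + ?m) = ?f j" for j
    using assms by (simp flip: nat_pow_mult)
  then have "sum ?f {..<?m + ?m} = 2 * sum ?f {..<?m}"
    using sum.atLeastLessThan_concat[of 0 ?m "?m + ?m" ?f, symmetric]
      sum.shift_bounds_nat_ivl[of ?f 0 ?m ?m]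
    by (simp add: lessThan_atLeast0)
  then have "even (sum ?f {..<2 * ?m})"
    by (simp only: mult_2) simp
  then show ?thesis
    unfolding crosses_alternating[OF assms] by simp
qed

lemma word_prod_relator:
  assumes "s \<in> S" "t \<in> S"
  shows "word_prod W (concat (replicate (coxeter_m W s t) [s, t])) = \<one>"
proof -
  have "word_prod W (concat (replicate k [s, t])) = (s \<otimes> t) [^] k" for k
    using assms by (induction k) (simp_all only: replicate_Suc concat.simps append_Cons append_Nil
        word_prod_Cons word_prod_Nil nat_pow_Suc2 nat_pow_0 gen_closed m_closed m_assoc nat_pow_closed replicate_0)
  then show ?thesis
    using assms by (simp add: coxeter_m_def)
qed

text \<open>Both parities survive the insertion of a relator, which has even length, product
  \<open>\<one>\<close> and no odd crossing. Through \<open>presentation\<close> they become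
  functions of the group element: the sign and the inversion set.\<close>

lemma coxeter_equiv_invariants:
  assumes "coxeter_equiv W S xs ys"
  shows "xs \<in> lists S" "ys \<in> lists S"
    and "even (length xs) \<longleftrightarrow> even (length ys)"
    and "t \<in> carrier W \<Longrightarrow> crosses xs t = crosses ys t"
proof -
  have "xs \<in> lists S \<and> ys \<in> lists S \<and> even (length xs) = even (length ys) \<and>
    (\<forall>t\<in>carrier W. crosses xs t = crosses ys t)"
    using assms
  proof induction
    case (relator s t xs ys)
    let ?r = "concat (replicate (coxeter_m W s t) [s, t])"
    have r: "concat (replicate k [s, t]) \<in> lists S" for k
      using relator by (induction k) auto
    have len: "length (concat (replicate k [s, t])) = 2 * k" for k
      by (induction k) auto
    show ?case
      using relator r len word_prod_relator[OF relator(1,2)] not_crosses_relator[OF relator(1,2)]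
      by (simp add: crosses_append conj_conj del: in_lists_conv_set)
  qed auto
  then show "xs \<in> lists S" "ys \<in> lists S" "even (length xs) \<longleftrightarrow> even (length ys)"
    "t \<in> carrier W \<Longrightarrow> crosses xs t = crosses ys t"
    by auto
qed

definition inversions :: "'a \<Rightarrow> 'a set" where
  "inversions w = {t \<in> carrier W. \<exists>ws \<in> lists S. word_prod W ws = w \<and> crosses ws t}"

lemma in_inversions_word_prod:
  "\<lbrakk>ws \<in> lists S; t \<in> carrier W\<rbrakk> \<Longrightarrow> t \<in> inversions (word_prod W ws) \<longleftrightarrow> crosses ws t"
  unfolding inversions_def
  using presentation coxeter_equiv_invariants(4) by blast

lemma inversions_closed: "t \<in> inversions w \<Longrightarrow> t \<in> carrier W"
  by (simp add: inversions_def)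

text \<open>A gallery from \<open>1\<close> to \<open>x y\<close> through \<open>x\<close> is a
  gallery to \<open>x\<close> followed by the \<open>x\<close>-translate of a gallery to
  \<open>y\<close>. Most later facts about inversions are computed from this cocycle
  identity.\<close>

lemma inversions_mult:
  assumes "x \<in> carrier W" "y \<in> carrier W" "t \<in> carrier W"
  shows "t \<in> inversions (x \<otimes> y) \<longleftrightarrow> (t \<in> inversions x) \<noteq> (conj_by (inv x) t \<in> inversions y)"
proof -
  obtain xs ys where *: "xs \<in> lists S" "word_prod W xs = x" "ys \<in> lists S" "word_prod W ys = y"
    using ex_word assms by metis
  then have "word_prod W (xs @ ys) = x \<otimes> y" "xs @ ys \<in> lists S"
    by (auto simp: word_prod_append lists_gens_closed simp del: in_lists_conv_set)
  then show ?thesis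
    using in_inversions_word_prod[of xs t] in_inversions_word_prod[of ys "conj_by (inv x) t"]
      in_inversions_word_prod[of "xs @ ys" t] crosses_append[of xs t ys] * assms
    by (metis conj_closed inv_closed)
qed

lemma inversions_one [simp]: "inversions \<one> = {}"
proof (rule equals0I)
  fix t assume "t \<in> inversions \<one>"
  then show False
    using in_inversions_word_prod[of "[]" t] by (simp add: inversions_closed)
qed

lemma inversions_gen:
  assumes "s \<in> S"
  shows "inversions s = {s}"
proof (rule Set.set_eqI)
  fix t
  show "t \<in> inversions s \<longleftrightarrow> t \<in> {s}"
    using in_inversions_word_prod[of "[s]" t] inversions_closed[of t s] assms by auto
qed

lemma inversions_gen_mult:
  "\<lbrakk>s \<in> S; x \<in> carrier W; t \<in> carrier W\<rbrakk> \<Longrightarrow>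
    t \<in> inversions (s \<otimes> x) \<longleftrightarrow> (t = s) \<noteq> (conj_by s t \<in> inversions x)"
  by (simp add: inversions_mult inversions_gen)

lemma inversions_mult_gen:
  "\<lbrakk>s \<in> S; x \<in> carrier W; t \<in> carrier W\<rbrakk> \<Longrightarrow>
    t \<in> inversions (x \<otimes> s) \<longleftrightarrow> (t \<in> inversions x) \<noteq> (t = conj_by x s)"
  by (auto simp: inversions_mult inversions_gen)

lemma inversions_inv:
  "\<lbrakk>x \<in> carrier W; t \<in> carrier W\<rbrakk> \<Longrightarrow> t \<in> inversions (inv x) \<longleftrightarrow> conj_by x t \<in> inversions x"
  using inversions_mult[of "inv x" x t] by simp

text \<open>In the gallery to \<open>v\<close>, across \<open>s\<close> and back, the crossings of
  this wall on the outward and return parts cancel, which leaves the middle step.\<close>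

lemma conj_gen_in_inversions:
  assumes v: "v \<in> carrier W" and s: "s \<in> S"
  shows "conj_by v s \<in> inversions (conj_by v s)"
proof -
  have "conj_by v s \<in> inversions (conj_by v s) \<longleftrightarrow>
      (conj_by v s \<in> inversions v) \<noteq> (s \<in> inversions (s \<otimes> inv v))"
    using v s by (simp add: conj_by_def m_assoc inversions_mult[of v "s \<otimes> inv v"] inv_mult_group)
  moreover have "conj_by s s = s"
    using s by (simp add: conj_by_def)
  then have "s \<in> inversions (s \<otimes> inv v) \<longleftrightarrow> s \<notin> inversions (inv v)"
    using v s by (simp add: inversions_gen_mult)
  ultimately show ?thesis
    using v s inversions_inv[of v s] by auto
qed

lemma inversions_conj_gen:
  assumes "t \<in> inversions w" "w \<in> carrier W"
  obtains v s where "v \<in> carrier W" "s \<in> S" "t = conj_by v s"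
proof -
  obtain ws where ws: "ws \<in> lists S" "crosses ws t" and t: "t \<in> carrier W"
    using assms by (auto simp: inversions_def)
  have "\<exists>v\<in>carrier W. \<exists>s\<in>S. t = conj_by v s"
    using ws t
  proof (induction ws arbitrary: t rule: list.induct)
    case (Cons s ws)
    show ?case
    proof (cases "t = s")
      case True
      then show ?thesis using Cons.prems by (intro bexI[of _ \<one>] bexI[of _ s]) auto
    next
      case False
      moreover have "s \<in> S" using Cons.prems by auto
      ultimately have "\<exists>v\<in>carrier W. \<exists>s'\<in>S. conj_by s t = conj_by v s'"
        using Cons.prems by (intro Cons.IH) auto
      then obtain v s' where "v \<in> carrier W" "s' \<in> S" "conj_by s t = conj_by v s'"
        by blast
      have "t = conj_by s (conj_by s t)"
        using \<open>s \<in> S\<close> Cons.prems(3) by (rule conj_gen_gen[symmetric])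
      also have "\<dots> = conj_by s (conj_by v s')"
        unfolding \<open>conj_by s t = _\<close> ..
      also have "\<dots> = conj_by (s \<otimes> v) s'"
        using \<open>v \<in> _\<close> \<open>s' \<in> S\<close> \<open>s \<in> S\<close> by (simp add: conj_conj)
      finally have "t = conj_by (s \<otimes> v) s'" .
      with \<open>v \<in> _\<close> \<open>s' \<in> S\<close> \<open>s \<in> S\<close> show ?thesis
        by (intro bexI[of _ "s \<otimes> v"] bexI[of _ s']) simp_all
    qed
  qed simp
  then show ?thesis using that by blast
qed

section \<open>Word length and induction along reduced words\<close>

abbreviation len :: "'a \<Rightarrow> nat" where
  "len \<equiv> word_length W S"

lemma word_length_le: "ws \<in> lists S \<Longrightarrow> len (word_prod W ws) \<le> length ws"
  unfolding word_length_def by (rule Least_le) auto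

lemma reduced_word:
  assumes "w \<in> carrier W"
  obtains ws where "ws \<in> lists S" "word_prod W ws = w" "length ws = len w"
proof -
  obtain ws where "ws \<in> lists S" "word_prod W ws = w"
    using assms by (rule ex_word)
  then have "\<exists>n. \<exists>ws\<in>lists S. length ws = n \<and> word_prod W ws = w"
    by blast
  from LeastI_ex[OF this] show ?thesis
    using that unfolding word_length_def by blast
qed

lemma even_len_word_prod:
  assumes "ws \<in> lists S"
  shows "even (len (word_prod W ws)) \<longleftrightarrow> even (length ws)"
proof -
  obtain vs where "vs \<in> lists S" "word_prod W vs = word_prod W ws" "length vs = len (word_prod W ws)"
    using reduced_word[OF word_prod_gens_closed[OF assms]] by metis
  then show ?thesis
    using presentation[of vs ws] coxeter_equiv_invariants(3) assms by metis
qed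

lemma even_len_mult:
  assumes "x \<in> carrier W" "y \<in> carrier W"
  shows "even (len (x \<otimes> y)) \<longleftrightarrow> (even (len x) \<longleftrightarrow> even (len y))"
proof -
  obtain xs ys where *: "xs \<in> lists S" "word_prod W xs = x" "ys \<in> lists S" "word_prod W ys = y"
    using ex_word assms by metis
  then have "word_prod W (xs @ ys) = x \<otimes> y" "xs @ ys \<in> lists S"
    by (auto simp: word_prod_append lists_gens_closed simp del: in_lists_conv_set)
  then show ?thesis
    using even_len_word_prod[of "xs @ ys"] even_len_word_prod[of xs] even_len_word_prod[of ys] *
    by auto
qed

lemma len_one [simp]: "len \<one> = 0"
  using word_length_le[of "[]"] by simp

lemma len_eq_0: "w \<in> carrier W \<Longrightarrow> len w = 0 \<longleftrightarrow> w = \<one>"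
  by (metis len_one length_0_conv reduced_word word_prod_Nil)

lemma odd_len_gen: "s \<in> S \<Longrightarrow> odd (len s)"
  using even_len_word_prod[of "[s]"] by simp

lemma even_len_inv: "x \<in> carrier W \<Longrightarrow> even (len (inv x)) \<longleftrightarrow> even (len x)"
  using even_len_mult[of x "inv x"] by simp

lemma len_mult_le:
  assumes "x \<in> carrier W" "y \<in> carrier W"
  shows "len (x \<otimes> y) \<le> len x + len y"
proof -
  obtain xs where xs: "xs \<in> lists S" "word_prod W xs = x" "length xs = len x"
    using assms(1) by (rule reduced_word)
  obtain ys where ys: "ys \<in> lists S" "word_prod W ys = y" "length ys = len y"
    using assms(2) by (rule reduced_word)
  show ?thesis
    using word_length_le[of "xs @ ys"] xs ys
    by (simp add: word_prod_append lists_gens_closed del: in_lists_conv_set)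
qed

lemma len_gen: "s \<in> S \<Longrightarrow> len s = 1"
  using word_length_le[of "[s]"] odd_len_gen[of s] by (auto simp: le_Suc_eq)

text \<open>Strong exchange removes one letter from a reduced word for \<open>w\<close>.\<close>

lemma inversion_decreases_len:
  assumes w: "w \<in> carrier W" and t: "t \<in> inversions w"
  shows "len (t \<otimes> w) < len w"
proof -
  obtain ws where ws: "ws \<in> lists S" "word_prod W ws = w" "length ws = len w"
    using w by (rule reduced_word)
  have "\<exists>xs r ys. ws = xs @ r # ys \<and> t \<otimes> word_prod W ws = word_prod W (xs @ ys)"
  proof (rule strong_exchange[where R = S and T = "carrier W" and N = inversions])
    show "\<And>r. r \<in> S \<Longrightarrow> r \<otimes> r = \<one>" by (rule gens_invol)
  qed (use inversions_gen_mult ws t inversions_closed gens_closed in auto)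
  then obtain xs r ys where "ws = xs @ r # ys" "t \<otimes> w = word_prod W (xs @ ys)"
    unfolding ws(2) by blast
  moreover from this ws have "xs @ ys \<in> lists S" by simp
  ultimately have "len (t \<otimes> w) \<le> length (xs @ ys)"
    using word_length_le by metis
  also have "\<dots> < len w"
    using \<open>ws = _\<close> ws(3) by simp
  finally show ?thesis .
qed

text \<open>A reflection \<open>t\<close> inverts its own wall, so by the cocycle identity a wall
  that does not separate \<open>w\<close> from \<open>1\<close> does separate \<open>t w\<close>
  from \<open>1\<close>; the previous bound then applies to \<open>t w\<close>.\<close>

lemma non_inversion_increases_len:
  assumes w: "w \<in> carrier W" and v: "v \<in> carrier W" "s \<in> S" and n: "conj_by v s \<notin> inversions w"
  shows "len w < len (conj_by v s \<otimes> w)"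
proof -
  let ?t = "conj_by v s"
  have t: "?t \<in> carrier W" using v by simp
  have tt: "?t \<otimes> ?t = \<one>"
    using conj_mult[of v s s] v by (simp add: gens_invol)
  then have "inv ?t = ?t" using t by (simp add: inv_equality)
  moreover have "conj_by ?t ?t = ?t"
    using t by (simp add: conj_by_def m_assoc)
  ultimately have "?t \<in> inversions (?t \<otimes> w)"
    using conj_gen_in_inversions[OF v] n t w by (simp add: inversions_mult[of ?t w])
  then have "len (?t \<otimes> (?t \<otimes> w)) < len (?t \<otimes> w)"
    using inversion_decreases_len t w by simp
  then show ?thesis
    using t w tt by (simp flip: m_assoc)
qed

lemma len_gen_mult:
  assumes s: "s \<in> S" and w: "w \<in> carrier W"
  shows "s \<notin> inversions w \<Longrightarrow> len (s \<otimes> w) = len w + 1"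
    and "s \<in> inversions w \<Longrightarrow> len w = len (s \<otimes> w) + 1"
proof -
  have up: "len (s \<otimes> x) = len x + 1" if "s \<notin> inversions x" "x \<in> carrier W" for x
  proof -
    have "len x < len (s \<otimes> x)"
      using non_inversion_increases_len[of x \<one> s] that s by simp
    moreover have "len (s \<otimes> x) \<le> 1 + len x"
      using len_mult_le[of s x] len_gen s that by simp
    ultimately show ?thesis by simp
  qed
  then show "s \<notin> inversions w \<Longrightarrow> len (s \<otimes> w) = len w + 1"
    using w by blast
  assume "s \<in> inversions w"
  then have "s \<notin> inversions (s \<otimes> w)"
    using s w by (simp add: inversions_gen_mult conj_by_def)
  from up[OF this] show "len w = len (s \<otimes> w) + 1"
    using s w by simp
qed

lemma len_gen_mult_iff:
  "\<lbrakk>s \<in> S; w \<in> carrier W\<rbrakk> \<Longrightarrow> len (s \<otimes> w) = len w + 1 \<longleftrightarrow> s \<notin> inversions w"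
  by (cases "s \<in> inversions w") (simp_all add: len_gen_mult)

text \<open>Induction along a reduced word. The condition \<open>s \<notin> inversions w\<close>
  says that \<open>s\<close> lengthens \<open>w\<close>, the situation in which a building forces
  the Weyl distance to multiply.\<close>

lemma left_induct [consumes 1, case_names one mult]:
  assumes "w \<in> carrier W" "P \<one>"
    and "\<And>s w. \<lbrakk>s \<in> S; w \<in> carrier W; s \<notin> inversions w; P w\<rbrakk> \<Longrightarrow> P (s \<otimes> w)"
  shows "P w"
  using assms(1)
proof (induction "len w" arbitrary: w)
  case 0
  then show ?case using assms(2) len_eq_0 by simp
next
  case (Suc n)
  obtain ws where ws: "ws \<in> lists S" "word_prod W ws = w" "length ws = len w"
    using Suc.prems by (rule reduced_word)
  then obtain s vs where vs: "ws = s # vs"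
    using Suc.hyps(2) by (cases ws) auto
  let ?v = "word_prod W vs"
  have s: "s \<in> S" "vs \<in> lists S" "?v \<in> carrier W" and w: "w = s \<otimes> ?v"
    using ws vs by (auto intro!: word_prod_gens_closed)
  have "len ?v \<le> n"
    using word_length_le[OF s(2)] ws vs Suc.hyps(2) by simp
  moreover have "len w \<le> len ?v + 1"
    using len_mult_le[of s ?v] s w len_gen by simp
  ultimately have "len w = len ?v + 1" "n = len ?v"
    using Suc.hyps(2) by auto
  then show ?case
    using Suc.hyps(1)[of ?v] assms(3)[of s ?v] len_gen_mult_iff[of s ?v] s w by simp
qed

lemma right_induct [consumes 1, case_names one mult]:
  assumes "w \<in> carrier W" "P \<one>"
    and step: "\<And>s w. \<lbrakk>s \<in> S; w \<in> carrier W; s \<notin> inversions (inv w); P w\<rbrakk> \<Longrightarrow> P (w \<otimes> s)"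
  shows "P w"
proof -
  have "P (inv (inv w))"
    using inv_closed[OF assms(1)]
  proof (induction rule: left_induct)
    case (mult s x)
    then show ?case using step[of s "inv x"] by (simp add: inv_mult_group)
  qed (use assms in simp)
  then show ?thesis using assms(1) by simp
qed

end

context coxeter_system
begin

lemma ex_left_descent:
  assumes "w \<in> carrier W" "w \<noteq> \<one>"
  obtains s where "s \<in> S" "s \<in> inversions w"
proof -
  have "w = \<one> \<or> (\<exists>s\<in>S. s \<in> inversions w)"
    using assms(1)
  proof (induction rule: left_induct)
    case (mult s w)
    then have "s \<in> inversions (s \<otimes> w)"
      by (simp add: inversions_gen_mult conj_by_def)
    with mult(1) show ?case by blast
  qed simp
  then show ?thesis using that assms(2) by blast
qed

end


section \<open>Weyl distance, panels and thin classes\<close>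

context building
begin

section \<open>Multiplicativity and symmetry of the Weyl distance\<close>

lemma dist_self [simp]: "C \<in> Ch \<Longrightarrow> \<delta> C C = \<one>"
  using WD1 by blast

lemma dist_carrier [simp]: "\<lbrakk>C \<in> Ch; D \<in> Ch\<rbrakk> \<Longrightarrow> \<delta> C D \<in> carrier W"
  by (rule dist_closed)

lemma dist_gen_sym:
  assumes "B \<in> Ch" "C \<in> Ch" "\<delta> B C \<in> S"
  shows "\<delta> C B = \<delta> B C"
proof -
  have "\<delta> C B \<noteq> \<one>"
    using assms WD1 gens_nontriv by metis
  moreover have "\<one> \<in> {\<delta> B C \<otimes> \<delta> C B, \<delta> C B}"
    using WD2[OF assms(1,2,1,3) HOL.refl] assms by simp
  ultimately have "\<delta> B C \<otimes> \<delta> C B = \<one>" by simp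
  then show ?thesis
    using assms inv_equality[of "\<delta> B C" "\<delta> C B"] by (metis dist_carrier gen_inv inv_inv)
qed

lemma dist_gen_mult:
  assumes "B \<in> Ch" "C \<in> Ch" "D \<in> Ch" "\<delta> B C = s" "s \<in> S" "s \<notin> inversions (\<delta> C D)"
  shows "\<delta> B D = s \<otimes> \<delta> C D"
  using assms WD2_length[of B C D s] len_gen_mult_iff[of s "\<delta> C D"] by simp

text \<open>Valid for every factorisation, reduced or not: \<open>WD3\<close> realises the step by
  \<open>s\<close> whether it lengthens or shortens the distance to \<open>E\<close>, and the
  distance from \<open>C\<close> multiplies because \<open>s\<close> lengthens
  \<open>x\<close>.\<close>

lemma ex_between:
  assumes "x \<in> carrier W" "y \<in> carrier W" "C \<in> Ch" "E \<in> Ch" "\<delta> C E = x \<otimes> y"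
  shows "\<exists>F\<in>Ch. \<delta> C F = x \<and> \<delta> F E = y"
  using assms(1,3,5)
proof (induction arbitrary: C rule: left_induct)
  case one
  then show ?case using assms(2,4) by (intro bexI[of _ C]) simp_all
next
  case (mult s x)
  obtain B where B: "B \<in> Ch" "\<delta> B C = s" "\<delta> B E = s \<otimes> \<delta> C E"
    using WD3[OF mult.prems(1) assms(4) mult.hyps(1)] by blast
  then have "\<delta> B E = x \<otimes> y"
    using mult assms by (simp add: m_assoc)
  with mult.IH[OF B(1)] obtain F where F: "F \<in> Ch" "\<delta> B F = x" "\<delta> F E = y"
    by blast
  have "\<delta> C B = s"
    using dist_gen_sym[OF B(1) mult.prems(1)] B(2) mult.hyps(1) by simp
  then have "\<delta> C F = s \<otimes> x"
    using dist_gen_mult[OF mult.prems(1) B(1) F(1)] F(2) mult.hyps by simp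
  with F show ?case by blast
qed

text \<open>The axioms control steps at the first argument. This mirror image has to precede the
  symmetry \<open>dist_inv\<close>, which rests on it, so the induction peels letters off the
  distance from \<open>B\<close> to \<open>C\<close>.\<close>

lemma dist_mult_gen:
  assumes "B \<in> Ch" "C \<in> Ch" "D \<in> Ch" "\<delta> C D = s" "s \<in> S" "s \<notin> inversions (inv (\<delta> B C))"
  shows "\<delta> B D = \<delta> B C \<otimes> s"
proof -
  have "\<forall>B\<in>Ch. \<delta> B C = x \<longrightarrow> s \<notin> inversions (inv x) \<longrightarrow> \<delta> B D = x \<otimes> s"
    if "x \<in> carrier W" for x
    using that
  proof (induction rule: left_induct)
    case one
    then show ?case using assms WD1 by auto
  next
    case (mult r x)
    show ?case
    proof (intro ballI impI)
      fix B assume B: "B \<in> Ch" "\<delta> B C = r \<otimes> x" and n: "s \<notin> inversions (inv (r \<otimes> x))"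
      have cl: "r \<in> carrier W" "s \<in> carrier W" "x \<in> carrier W"
        using mult assms by auto
      have eq: "s \<in> inversions (inv (r \<otimes> x)) \<longleftrightarrow> (s \<in> inversions (inv x)) \<noteq> (s = conj_by (inv x) r)"
        using inversions_mult_gen[of r "inv x" s] mult(1) cl by (simp add: inv_mult_group)
      \<comment> \<open>Equality would mean \<open>r x = x s\<close>; then \<open>s\<close> would be
        an inversion of \<open>inv x\<close>, hence \<open>r\<close> one of \<open>x\<close>,
        whereas \<open>r\<close> lengthens \<open>x\<close>.\<close>
      have ne: "s \<noteq> conj_by (inv x) r"
      proof
        assume s: "s = conj_by (inv x) r"
        then have "s \<in> inversions (inv x)" using n eq by simp
        then have "r \<in> inversions x"
          using s cl by (simp add: inversions_inv)
        with mult show False by simp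
      qed
      then have n': "s \<notin> inversions (inv x)"
        using n eq by simp
      obtain B' where B': "B' \<in> Ch" "\<delta> B B' = r" "\<delta> B' C = x"
        using ex_between[of r x B C] B assms cl by blast
      have "\<delta> B' D = x \<otimes> s"
        using mult.IH B' n' by blast
      moreover have "r \<notin> inversions (x \<otimes> s)"
        using inversions_mult_gen[of s x r] mult ne cl assms by auto
      ultimately show "\<delta> B D = r \<otimes> x \<otimes> s"
        using dist_gen_mult[OF B(1) B'(1) assms(3) B'(2) mult(1)] cl by (simp add: m_assoc)
    qed
  qed
  then show ?thesis using assms by simp
qed

lemma dist_inv:
  assumes "C \<in> Ch" "D \<in> Ch"
  shows "\<delta> D C = inv (\<delta> C D)"
proof -
  have "\<forall>C\<in>Ch. \<delta> C D = x \<longrightarrow> \<delta> D C = inv x" if "x \<in> carrier W" for x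
    using that
  proof (induction rule: left_induct)
    case one
    then show ?case using assms WD1 by auto
  next
    case (mult s x)
    show ?case
    proof (intro ballI impI)
      fix C assume C: "C \<in> Ch" "\<delta> C D = s \<otimes> x"
      obtain B where B: "B \<in> Ch" "\<delta> C B = s" "\<delta> B D = x"
        using ex_between[of s x C D] C assms mult by auto
      have "\<delta> D B = inv x" using mult B by blast
      moreover have "\<delta> B C = s"
        using dist_gen_sym[OF C(1) B(1)] B(2) mult(1) by simp
      ultimately have "\<delta> D C = inv x \<otimes> s"
        using dist_mult_gen[OF assms(2) B(1) C(1) _ mult(1)] mult by simp
      then show "\<delta> D C = inv (s \<otimes> x)"
        using mult by (simp add: inv_mult_group)
    qed
  qed
  then show ?thesis using assms by simp
qed

text \<open>Viewed from \<open>C\<close>, the walls towards \<open>B\<close> are the inversions of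
  \<open>inv x\<close> and those towards \<open>D\<close> the inversions of \<open>y\<close>.
  Disjointness amounts to additivity of length in \<open>x y\<close>, so two minimal galleries
  concatenate to a minimal one.\<close>

lemma dist_mult:
  assumes "B \<in> Ch" "C \<in> Ch" "D \<in> Ch" "\<delta> B C = x" "\<delta> C D = y"
    and "\<And>t. \<lbrakk>t \<in> inversions y; t \<in> inversions (inv x)\<rbrakk> \<Longrightarrow> False"
  shows "\<delta> B D = x \<otimes> y"
proof -
  have y: "y \<in> carrier W" using assms by auto
  have "\<forall>B\<in>Ch. \<delta> B C = x \<longrightarrow> inversions y \<inter> inversions (inv x) = {} \<longrightarrow> \<delta> B D = x \<otimes> y"
    if "x \<in> carrier W" for x
    using that
  proof (induction rule: left_induct)
    case one
    then show ?case using assms WD1 y by auto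
  next
    case (mult s x)
    show ?case
    proof (intro ballI impI)
      fix B assume B: "B \<in> Ch" "\<delta> B C = s \<otimes> x"
        and disj: "inversions y \<inter> inversions (inv (s \<otimes> x)) = {}"
      have cl: "s \<in> carrier W" "x \<in> carrier W" using mult by auto
      obtain B' where B': "B' \<in> Ch" "\<delta> B B' = s" "\<delta> B' C = x"
        using ex_between[of s x B C] B assms cl by blast
      have eq: "t \<in> inversions (inv (s \<otimes> x)) \<longleftrightarrow> (t \<in> inversions (inv x)) \<noteq> (t = conj_by (inv x) s)"
        if "t \<in> carrier W" for t
        using inversions_mult_gen[of s "inv x" t] mult(1) cl that by (simp add: inv_mult_group)
      have s: "conj_by (inv x) s \<notin> inversions (inv x)"
        using mult cl by (simp add: inversions_inv)
      then have "conj_by (inv x) s \<notin> inversions y"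
        using eq[of "conj_by (inv x) s"] cl disj by auto
      then have "s \<notin> inversions (x \<otimes> y)"
        using mult cl y by (simp add: inversions_mult)
      moreover have "\<delta> B' D = x \<otimes> y"
      proof -
        have "t \<notin> inversions (inv x)" if "t \<in> inversions y" for t
          using that eq[of t] inversions_closed[OF that] disj s by auto
        then show ?thesis using mult.IH B' by blast
      qed
      ultimately show "\<delta> B D = s \<otimes> x \<otimes> y"
        using dist_gen_mult[OF B(1) B'(1) assms(3) B'(2) mult(1)] cl y by (simp add: m_assoc)
    qed
  qed
  moreover have "x \<in> carrier W" "inversions y \<inter> inversions (inv x) = {}"
    using assms(1-4,6) by auto
  ultimately show ?thesis using assms(1,4) by blast
qed

lemma ex_at_dist:
  assumes "C \<in> Ch" "w \<in> carrier W"
  shows "\<exists>D\<in>Ch. \<delta> C D = w"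
  using ex_between[of w "inv w" C C] assms by auto

lemma dist_adj:
  assumes "C \<in> Ch" "D \<in> Ch" "D' \<in> Ch" "\<delta> D D' = s" "s \<in> S"
  shows "\<delta> C D' = \<delta> C D \<or> \<delta> C D' = \<delta> C D \<otimes> s"
proof -
  have "\<delta> D' D = s" using dist_gen_sym[of D D'] assms by simp
  then have "\<delta> D' C \<in> {s \<otimes> \<delta> D C, \<delta> D C}"
    using WD2[of D' D C s] assms by simp
  then have "inv (\<delta> D' C) = inv (\<delta> D C) \<or> inv (\<delta> D' C) = inv (\<delta> D C) \<otimes> s"
    using assms by (auto simp: inv_mult_group)
  then show ?thesis
    using dist_inv[of D' C] dist_inv[of D C] assms by simp
qed

lemma ex_adj:
  assumes "C \<in> Ch" "D \<in> Ch" "s \<in> S"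
  shows "\<exists>D'\<in>Ch. \<delta> D D' = s \<and> \<delta> C D' = \<delta> C D \<otimes> s"
proof -
  obtain F where F: "F \<in> Ch" "\<delta> D F = s" "\<delta> F C = s \<otimes> \<delta> D C"
    using ex_between[of s "s \<otimes> \<delta> D C" D C] assms by auto
  then have "\<delta> C F = inv (s \<otimes> \<delta> D C)"
    using dist_inv[of F C] assms by simp
  also have "\<dots> = \<delta> C D \<otimes> s"
    using dist_inv[of D C] assms by (simp add: inv_mult_group)
  finally show ?thesis using F by blast
qed

section \<open>Panels and parallelism\<close>

lemma in_panel_self [simp]: "C \<in> Ch \<Longrightarrow> C \<in> panel s C"
  by (simp add: panel_def)

lemma dist_in_panel:
  assumes "C \<in> Ch" "s \<in> S" "D \<in> panel s C" "E \<in> panel s C" "D \<noteq> E"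
  shows "\<delta> D E = s"
proof (cases "D = C")
  case True
  then show ?thesis using assms WD1 by (auto simp: panel_def)
next
  case False
  then have "\<delta> C D = s" using assms WD1 by (auto simp: panel_def)
  then have "\<delta> D C = s" using dist_gen_sym[of C D] assms by (simp add: panel_def)
  then have "\<delta> D E \<in> {s \<otimes> \<delta> C E, \<delta> C E}"
    using WD2[of D C E s] assms by (simp add: panel_def)
  moreover have "\<delta> D E \<noteq> \<one>" using assms WD1 by (simp add: panel_def)
  moreover have "\<delta> C E = \<one> \<or> \<delta> C E = s" using assms by (simp add: panel_def)
  ultimately show ?thesis using assms gens_invol by auto
qed

lemma panel_eq:
  assumes "C \<in> Ch" "D \<in> Ch" "s \<in> S" "\<delta> C D = s"
  shows "panel s D = panel s C"
proof -
  have sub: "panel s C \<subseteq> panel s D" if *: "C \<in> Ch" "D \<in> Ch" "\<delta> C D = s" for C D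
  proof
    fix E assume "E \<in> panel s C"
    then show "E \<in> panel s D"
      using dist_in_panel[OF *(1) assms(3), of D E] * by (cases "D = E") (auto simp: panel_def)
  qed
  show ?thesis
    using sub[of C D] sub[of D C] assms dist_gen_sym[of C D] by auto
qed

lemma thick_panel_inj_on:
  assumes "thick_panel P" "inj_on f P" "f ` P \<subseteq> Q"
  shows "thick_panel Q"
proof -
  obtain T where "T \<subseteq> P" "card T = 3"
    using assms by (auto simp: thick_panel_def)
  then have "f ` T \<subseteq> Q" "card (f ` T) = 3"
    using assms by (auto simp: card_image inj_on_subset)
  then show ?thesis by (auto simp: thick_panel_def)
qed

text \<open>Projection between parallel panels: the chamber of the second panel at distance exactly
  \<open>\<delta> C D\<close> from a given chamber of the first.\<close>

lemma thick_panel_parallel: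
  assumes C: "C \<in> Ch" and D: "D \<in> Ch" and s: "s \<in> S" and t: "t \<in> S"
    and par: "s \<otimes> \<delta> C D = \<delta> C D \<otimes> t"
    and thick: "thick_panel (panel s C)"
  shows "thick_panel (panel t D)"
proof -
  have *: "thick_panel (panel t D)"
    if C: "C \<in> Ch" and par: "s \<otimes> \<delta> C D = \<delta> C D \<otimes> t" and thick: "thick_panel (panel s C)"
      and n: "s \<notin> inversions (\<delta> C D)" for C
  proof -
    let ?w = "\<delta> C D"
    have "\<exists>E\<in>panel t D. \<delta> B E = ?w" if "B \<in> panel s C" for B
    proof (cases "B = C")
      case True
      then show ?thesis using D by (intro bexI[of _ D]) simp_all
    next
      case False
      have B: "B \<in> Ch" using that by (simp add: panel_def)
      have "\<delta> B C = s"
        using dist_in_panel[of C s B C] C s that False by simp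
      then have BD: "\<delta> B D = ?w \<otimes> t"
        using dist_gen_mult[OF B C D] s n par by simp
      obtain E where E: "E \<in> Ch" "\<delta> D E = t" "\<delta> B E = \<delta> B D \<otimes> t"
        using ex_adj[OF B D t] by blast
      have "\<delta> B E = ?w"
        unfolding E(3) BD using C D t by (intro gen_cancel_right) simp_all
      with E(1,2) show ?thesis
        by (intro bexI[of _ E]) (simp_all add: panel_def)
    qed
    then obtain f where f: "\<And>B. B \<in> panel s C \<Longrightarrow> f B \<in> panel t D \<and> \<delta> B (f B) = ?w"
      by metis
    \<comment> \<open>Two adjacent chambers of the panel cannot both be at distance
      \<open>?w\<close> from a common image: \<open>s\<close> lengthens \<open>?w\<close>, so the
      two distances must differ by the factor \<open>s\<close>.\<close>
    have "inj_on f (panel s C)"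
    proof (rule inj_onI, rule ccontr)
      fix B1 B2 assume B: "B1 \<in> panel s C" "B2 \<in> panel s C" "f B1 = f B2" "B1 \<noteq> B2"
      then have "\<delta> B1 B2 = s"
        using dist_in_panel C s by blast
      moreover have "B1 \<in> Ch" "B2 \<in> Ch" "f B2 \<in> Ch"
        using B f by (auto simp: panel_def)
      moreover have "\<delta> B2 (f B2) = ?w" "\<delta> B1 (f B2) = ?w"
        using f B by metis+
      ultimately have "?w = s \<otimes> ?w"
        using dist_gen_mult[of B1 B2 "f B2" s] s n by simp
      then show False
        using C D s gens_nontriv by (metis dist_carrier gen_closed r_cancel_one')
    qed
    then show ?thesis
      using thick_panel_inj_on[OF thick, of f] f by blast
  qed
  show ?thesis
  proof (cases "s \<in> inversions (\<delta> C D)")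
    case False
    then show ?thesis using * C par thick by blast
  next
    case True
    \<comment> \<open>Pass to a chamber of the same panel that is closer to \<open>D\<close>; the
      panels stay parallel and \<open>s\<close> now lengthens the distance.\<close>
    obtain B where B: "B \<in> Ch" "\<delta> B C = s" "\<delta> B D = s \<otimes> \<delta> C D"
      using WD3 C D s by blast
    have "s \<notin> inversions (s \<otimes> \<delta> C D)"
      using True s C D by (simp add: inversions_gen_mult conj_by_def)
    moreover have "panel s B = panel s C"
      using panel_eq[of B C s] B C s by simp
    moreover have "s \<otimes> \<delta> B D = \<delta> C D"
      unfolding B(3) using s C D by simp
    moreover have "\<delta> B D \<otimes> t = \<delta> C D"
      unfolding B(3) par using t C D by (intro gen_cancel_right) simp_all
    ultimately show ?thesis
      using *[of B] B thick by simp
  qed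
qed

lemma ex_other_in_panel:
  assumes "C \<in> Ch" "s \<in> S"
  obtains D where "D \<in> panel s C" "D \<noteq> C" "\<delta> C D = s"
proof -
  obtain D where D: "D \<in> Ch" "\<delta> C D = s"
    using ex_at_dist[of C s] assms by auto
  then have "D \<noteq> C" using assms gens_nontriv by auto
  with D show ?thesis using that by (simp add: panel_def)
qed

lemma thin_panel:
  assumes "C \<in> Ch" "s \<in> S"
  shows "card (panel s C) = 2 \<longleftrightarrow> \<not> thick_panel (panel s C)"
proof
  assume c: "card (panel s C) = 2"
  then have fin: "finite (panel s C)" by (simp add: card_ge_0_finite)
  show "\<not> thick_panel (panel s C)"
    unfolding thick_panel_def
  proof clarify
    fix T assume "T \<subseteq> panel s C" "card T = 3"
    then show False using card_mono[OF fin \<open>T \<subseteq> _\<close>] c by simp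
  qed
next
  assume n: "\<not> thick_panel (panel s C)"
  obtain D where D: "D \<in> panel s C" "D \<noteq> C"
    using assms by (rule ex_other_in_panel)
  have "X \<in> {C, D}" if "X \<in> panel s C" for X
  proof (rule ccontr)
    assume "X \<notin> {C, D}"
    then have "{C, D, X} \<subseteq> panel s C \<and> card {C, D, X} = 3"
      using D that assms by auto
    then show False using n unfolding thick_panel_def by blast
  qed
  then have "panel s C = {C, D}" using D assms by auto
  then show "card (panel s C) = 2" using D by simp
qed

section \<open>Thin adjacency and thin classes\<close>

lemma thin_adj_iff:
  "(C, D) \<in> thin_adj \<longleftrightarrow>
    C \<in> Ch \<and> D \<in> Ch \<and> \<delta> C D \<in> S \<and> \<not> thick_panel (panel (\<delta> C D) C)"
  using thin_panel by (auto simp: thin_adj_def)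

lemma thin_adj_unique:
  assumes "(C, D) \<in> thin_adj" "D' \<in> Ch" "\<delta> C D' = \<delta> C D"
  shows "D' = D"
proof (rule ccontr)
  assume ne: "D' \<noteq> D"
  have CD: "C \<in> Ch" "D \<in> Ch" "\<delta> C D \<in> S" "\<not> thick_panel (panel (\<delta> C D) C)"
    using assms(1) by (auto simp: thin_adj_iff)
  have "D \<noteq> C" "D' \<noteq> C"
    using assms CD gens_nontriv dist_self[of C] by metis+
  then have "{C, D, D'} \<subseteq> panel (\<delta> C D) C \<and> card {C, D, D'} = 3"
    using CD assms ne by (auto simp: panel_def)
  then show False using CD(4) unfolding thick_panel_def by blast
qed

lemma thin_adj_sym:
  assumes "(C, D) \<in> thin_adj"
  shows "(D, C) \<in> thin_adj"
  using assms dist_gen_sym[of C D] panel_eq[of C D "\<delta> C D"] by (simp add: thin_adj_iff)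

text \<open>\<open>ex_adj\<close> provides some neighbour of \<open>C\<close> at the product
  distance; a panel with two chambers leaves only \<open>D\<close>.\<close>

lemma dist_thin_adj:
  assumes "X \<in> Ch" "(C, D) \<in> thin_adj"
  shows "\<delta> X D = \<delta> X C \<otimes> \<delta> C D"
proof -
  have CD: "C \<in> Ch" "D \<in> Ch" "\<delta> C D \<in> S"
    using assms(2) by (auto simp: thin_adj_iff)
  then obtain D' where "D' \<in> Ch" "\<delta> C D' = \<delta> C D" "\<delta> X D' = \<delta> X C \<otimes> \<delta> C D"
    using ex_adj assms by blast
  then show ?thesis using thin_adj_unique assms by metis
qed

lemma equiv_thin: "equiv Ch thin_equiv"
proof (rule equivI)
  show "thin_equiv \<subseteq> Ch \<times> Ch" "refl_on Ch thin_equiv"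
    by (auto simp: refl_on_def thin_equiv_def)
  have "sym (thin_adj\<^sup>*)"
    using thin_adj_sym by (intro sym_rtrancl symI)
  then show "sym thin_equiv"
    by (auto simp: thin_equiv_def sym_def)
  show "Relation.trans thin_equiv"
    by (auto simp: thin_equiv_def trans_def)
qed

lemma thin_equiv_induct [consumes 1, case_names base step]:
  assumes "(C, D) \<in> thin_equiv" "P C"
    and "\<And>D E. \<lbrakk>(C, D) \<in> thin_equiv; (D, E) \<in> thin_adj; P D\<rbrakk> \<Longrightarrow> P E"
  shows "P D"
proof -
  have C: "C \<in> Ch" and "(C, D) \<in> thin_adj\<^sup>*"
    using assms(1) by (auto simp: thin_equiv_def)
  from this(2) have "P D \<and> (C, D) \<in> thin_equiv"
  proof induction
    case base
    then show ?case using assms(2) C by (simp add: thin_equiv_def)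
  next
    case (step D E)
    moreover from step have "E \<in> Ch" by (simp add: thin_adj_iff)
    ultimately show ?case
      using assms(3)[of D E] by (auto simp: thin_equiv_def intro: rtrancl_into_rtrancl)
  qed
  then show ?thesis ..
qed

lemma dist_thin_equiv:
  assumes "X \<in> Ch" "(C, D) \<in> thin_equiv"
  shows "\<delta> X D = \<delta> X C \<otimes> \<delta> C D"
  using assms(2)
proof (induction rule: thin_equiv_induct)
  case base
  then show ?case using assms by (auto simp: thin_equiv_def)
next
  case (step D E)
  then have "C \<in> Ch" "D \<in> Ch" "E \<in> Ch" by (auto simp: thin_equiv_def thin_adj_iff)
  then show ?case
    using step.IH dist_thin_adj[OF assms(1) step(2)] dist_thin_adj[of C, OF _ step(2)] assms(1)
    by (simp add: m_assoc)
qed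

section \<open>Isometric copies of the Weyl group\<close>

definition isometry :: "('w \<Rightarrow> 'c) \<Rightarrow> bool" where
  "isometry \<alpha> \<longleftrightarrow> \<alpha> \<in> carrier W \<rightarrow> Ch \<and>
     (\<forall>v \<in> carrier W. \<forall>w \<in> carrier W. \<delta> (\<alpha> v) (\<alpha> w) = inv v \<otimes> w)"

lemma isometryD:
  assumes "isometry \<alpha>"
  shows "v \<in> carrier W \<Longrightarrow> \<alpha> v \<in> Ch"
    and "\<lbrakk>v \<in> carrier W; w \<in> carrier W\<rbrakk> \<Longrightarrow> \<delta> (\<alpha> v) (\<alpha> w) = inv v \<otimes> w"
  using assms by (auto simp: isometry_def)

lemma apartment_iff: "apartment A \<longleftrightarrow> (\<exists>\<alpha>. isometry \<alpha> \<and> A = \<alpha> ` carrier W)"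
  by (auto simp: apartment_def isometry_def)

lemma apartment_isometry:
  assumes "apartment A" "C \<in> A"
  obtains \<alpha> where "isometry \<alpha>" "A = \<alpha> ` carrier W" "\<alpha> \<one> = C"
proof -
  obtain \<beta> where \<beta>: "isometry \<beta>" "A = \<beta> ` carrier W"
    using assms by (auto simp: apartment_iff)
  then obtain v where v: "v \<in> carrier W" "C = \<beta> v" using assms by auto
  have "A \<subseteq> (\<lambda>w. \<beta> (v \<otimes> w)) ` carrier W"
  proof
    fix D assume "D \<in> A"
    then obtain w where "w \<in> carrier W" "D = \<beta> w" using \<beta> by auto
    then show "D \<in> (\<lambda>w. \<beta> (v \<otimes> w)) ` carrier W"
      using v by (intro image_eqI[of _ _ "inv v \<otimes> w"]) simp_all
  qed
  moreover have "isometry (\<lambda>w. \<beta> (v \<otimes> w))"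
    using isometryD[OF \<beta>(1)] v by (auto simp: isometry_def inv_mult_group m_assoc)
  ultimately show ?thesis
    using v \<beta>(2) by (intro that[of "\<lambda>w. \<beta> (v \<otimes> w)"]) auto
qed

text \<open>An apartment contains an \<open>s\<close>-neighbour of each of its chambers for every
  \<open>s\<close>, and across a thin panel there is only one.\<close>

lemma thin_class_subset_apartment:
  assumes A: "apartment A" and "C \<in> A" and "(C, D) \<in> thin_equiv"
  shows "D \<in> A"
  using assms(3,2)
proof (induction rule: thin_equiv_induct)
  case (step D E)
  obtain \<alpha> where \<alpha>: "isometry \<alpha>" "A = \<alpha> ` carrier W" "\<alpha> \<one> = D"
    using apartment_isometry[OF A] step by blast
  have x: "\<delta> D E \<in> carrier W" using step(2) by (auto simp: thin_adj_iff)
  then have "\<delta> D (\<alpha> (\<delta> D E)) = \<delta> D E" "\<alpha> (\<delta> D E) \<in> Ch" "\<alpha> (\<delta> D E) \<in> A"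
    using isometryD(2)[OF \<alpha>(1) one_closed x] isometryD(1)[OF \<alpha>(1) x] \<alpha>(2,3) by simp_all
  then show ?case using thin_adj_unique[OF step(2)] by metis
qed

end


section \<open>Apartments and thick walls in spherical buildings\<close>

context building
begin

text \<open>Reflections in thick walls, in the coordinates that place \<open>C\<close> at \<open>1\<close>.\<close>

definition thick_refls :: "'c \<Rightarrow> 'w set" where
  "thick_refls C = {conj_by (\<delta> C D) s | D s. D \<in> Ch \<and> s \<in> S \<and> thick_panel (panel s D)}"

lemma thick_reflsI:
  "\<lbrakk>D \<in> Ch; s \<in> S; thick_panel (panel s D)\<rbrakk> \<Longrightarrow> conj_by (\<delta> C D) s \<in> thick_refls C"
  by (auto simp: thick_refls_def)

lemma thick_refls_closed: "\<lbrakk>C \<in> Ch; t \<in> thick_refls C\<rbrakk> \<Longrightarrow> t \<in> carrier W"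
  by (auto simp: thick_refls_def)

end

section \<open>The longest element, apartments and the thickness of walls\<close>

context spherical_building
begin

text \<open>Finiteness yields an element of maximal length; a reflection missing from its inversions
  would lengthen it further.\<close>

lemma ex_longest:
  obtains w0 where "w0 \<in> carrier W"
    "\<And>v s. \<lbrakk>v \<in> carrier W; s \<in> S\<rbrakk> \<Longrightarrow> conj_by v s \<in> inversions w0"
proof -
  let ?M = "Max (len ` carrier W)"
  have fin: "finite (len ` carrier W)" "len ` carrier W \<noteq> {}"
    using spherical by auto
  then have "?M \<in> len ` carrier W" by (rule Max_in)
  then obtain w0 where w0: "w0 \<in> carrier W" "len w0 = ?M" by auto
  have "conj_by v s \<in> inversions w0" if "v \<in> carrier W" "s \<in> S" for v s
  proof (rule ccontr)
    assume "conj_by v s \<notin> inversions w0"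
    then have "len w0 < len (conj_by v s \<otimes> w0)"
      using non_inversion_increases_len w0 that by blast
    moreover have "len (conj_by v s \<otimes> w0) \<le> ?M"
      using fin w0 that by (intro Max_ge) simp_all
    ultimately show False using w0 by simp
  qed
  with w0 show ?thesis using that by blast
qed

lemma inversions_mult_longest:
  assumes w0: "w0 \<in> carrier W" "\<And>v s. \<lbrakk>v \<in> carrier W; s \<in> S\<rbrakk> \<Longrightarrow> conj_by v s \<in> inversions w0"
    and w: "w \<in> carrier W" and v: "v \<in> carrier W" "s \<in> S"
  shows "conj_by v s \<in> inversions (w \<otimes> w0) \<longleftrightarrow> conj_by v s \<notin> inversions w"
proof -
  have "conj_by (inv w) (conj_by v s) \<in> inversions w0"
    using w0 w v by (simp add: conj_conj)
  then show ?thesis using w0 w v by (simp add: inversions_mult)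
qed

lemma inversions_mult_longest_disjoint:
  assumes w0: "w0 \<in> carrier W" "\<And>v s. \<lbrakk>v \<in> carrier W; s \<in> S\<rbrakk> \<Longrightarrow> conj_by v s \<in> inversions w0"
    and w: "w \<in> carrier W" and t: "t \<in> inversions (w \<otimes> w0)" "t \<in> inversions w"
  shows False
proof -
  obtain v s where "v \<in> carrier W" "s \<in> S" "t = conj_by v s"
    using inversions_conj_gen[OF t(2) w] by blast
  then show False
    using inversions_mult_longest[OF w0 w] t by blast
qed

text \<open>Let \<open>r\<close> be a left descent of the conjugate \<open>inv w0 s w0\<close>. The
  cocycle identity shows that \<open>w0 r (inv w0)\<close> is not an inversion of
  \<open>s w0\<close>, and the only reflection that \<open>s w0\<close> fails to invert is
  \<open>s\<close>. Hence the conjugate equals \<open>r\<close>.\<close>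

lemma longest_conj_gen:
  assumes w0: "w0 \<in> carrier W" "\<And>v s. \<lbrakk>v \<in> carrier W; s \<in> S\<rbrakk> \<Longrightarrow> conj_by v s \<in> inversions w0"
    and s: "s \<in> S"
  shows "conj_by (inv w0) s \<in> S"
proof -
  let ?r = "conj_by (inv w0) s"
  have r: "?r = inv w0 \<otimes> (s \<otimes> w0)"
    using w0 s by (simp add: conj_by_def m_assoc)
  have "?r \<noteq> \<one>"
  proof
    assume "?r = \<one>"
    then have "conj_by w0 ?r = \<one>" using w0 by simp
    then have "s = \<one>" using w0 s by simp
    with s gens_nontriv show False by simp
  qed
  moreover have "?r \<in> carrier W" using w0 s by simp
  ultimately obtain r where r': "r \<in> S" "r \<in> inversions ?r"
    using ex_left_descent[of ?r] by blast
  let ?t = "conj_by w0 r"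
  have rc: "r \<in> carrier W" using r' by simp
  have "r \<in> inversions (inv w0)"
    using w0 r' by (simp add: inversions_inv)
  then have "?t \<notin> inversions (s \<otimes> w0)"
    using r' w0 s rc unfolding r by (simp add: inversions_mult[of "inv w0"])
  moreover have "conj_by s ?t \<in> inversions w0"
    using w0 s r' by (simp add: conj_conj)
  ultimately have "?t = s"
    using w0 s rc by (simp add: inversions_gen_mult)
  then have "?r = r" using w0 rc by (metis conj_inv_conj(1))
  then show ?thesis using r' by simp
qed

text \<open>The apartment is the convex hull of \<open>C\<close> and a chamber \<open>E\<close> opposite to it.\<close>

lemma ex_isometry:
  assumes C: "C \<in> Ch" and D: "D \<in> Ch"
  obtains \<alpha> where "isometry \<alpha>" "\<alpha> \<one> = C" "\<alpha> (\<delta> C D) = D"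
proof -
  obtain w0 where w0: "w0 \<in> carrier W"
    "\<And>v s. \<lbrakk>v \<in> carrier W; s \<in> S\<rbrakk> \<Longrightarrow> conj_by v s \<in> inversions w0"
    by (rule ex_longest) blast
  let ?w = "\<delta> C D"
  have w: "?w \<in> carrier W" using C D by simp
  \<comment> \<open>With this distance \<open>D\<close> lies on a minimal gallery from
    \<open>C\<close> to \<open>E\<close>, and \<open>E\<close> ends up at distance \<open>w0\<close>
    from \<open>C\<close>.\<close>
  obtain E where E: "E \<in> Ch" "\<delta> D E = inv ?w \<otimes> w0"
    using ex_at_dist[of D "inv ?w \<otimes> w0"] D w w0(1) by auto
  have "\<delta> C E = ?w \<otimes> (inv ?w \<otimes> w0)"
    using inversions_mult_longest_disjoint[OF w0, of "inv ?w"] w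
    by (intro dist_mult[OF C D E(1) HOL.refl E(2)]) auto
  then have CE: "\<delta> C E = w0" using w w0(1) by simp
  \<comment> \<open>Chambers at position \<open>v\<close> on minimal galleries from \<open>C\<close>
    to \<open>E\<close>. Existence and uniqueness for every \<open>v\<close> give the coordinate map
    \<open>\<alpha>\<close>.\<close>
  define in_hull where "in_hull v F \<longleftrightarrow> F \<in> Ch \<and> \<delta> C F = v \<and> \<delta> F E = inv v \<otimes> w0" for v F
  have ex: "\<exists>F. in_hull v F" if "v \<in> carrier W" for v
    using ex_between[of v "inv v \<otimes> w0" C E] that w0(1) C E CE by (auto simp: in_hull_def)
  have down: "\<exists>G. in_hull v G \<and> \<delta> G F = s"
    if F: "in_hull (v \<otimes> s) F" and v: "v \<in> carrier W" and s: "s \<in> S" and n: "s \<notin> inversions (inv v)"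
    for v s F
  proof -
    obtain G where G: "G \<in> Ch" "\<delta> C G = v" "\<delta> G F = s"
      using ex_between[of v s C F] F v s C by (auto simp: in_hull_def)
    have FE: "F \<in> Ch" "\<delta> F E = s \<otimes> inv v \<otimes> w0"
      using F v s by (auto simp: in_hull_def inv_mult_group)
    have "s \<in> inversions (s \<otimes> inv v)"
      using n v s by (simp add: inversions_gen_mult conj_by_def)
    then have "s \<notin> inversions (s \<otimes> inv v \<otimes> w0)"
      using inversions_mult_longest[OF w0, of "s \<otimes> inv v" \<one> s] v s by simp
    then have "\<delta> G E = s \<otimes> (s \<otimes> inv v \<otimes> w0)"
      using dist_gen_mult[OF G(1) FE(1) E(1) G(3) s] FE(2) by simp
    then have "\<delta> G E = inv v \<otimes> w0"
      using v s w0(1) by (simp add: m_assoc)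
    with G show ?thesis by (auto simp: in_hull_def)
  qed
  \<comment> \<open>Two candidates share their predecessor, so if distinct they are
    \<open>s\<close>-adjacent; as \<open>s\<close> lengthens the distance to \<open>E\<close>, they
    could not be at the same distance from it.\<close>
  have unique: "\<forall>F F'. in_hull v F \<longrightarrow> in_hull v F' \<longrightarrow> F = F'" if "v \<in> carrier W" for v
    using that
  proof (induction rule: right_induct)
    case one
    then show ?case using C WD1 by (auto simp: in_hull_def)
  next
    case (mult s v)
    show ?case
    proof (intro allI impI, rule ccontr)
      fix F F' assume F: "in_hull (v \<otimes> s) F" "in_hull (v \<otimes> s) F'" and ne: "F \<noteq> F'"
      obtain G where G: "in_hull v G" "\<delta> G F = s"
        using down[OF F(1) mult(2,1,3)] by blast
      obtain G' where G': "in_hull v G'" "\<delta> G' F' = s"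
        using down[OF F(2) mult(2,1,3)] by blast
      have "G' = G" using mult.IH G G' by blast
      have Ch: "F \<in> Ch" "F' \<in> Ch" "G \<in> Ch" using F G by (auto simp: in_hull_def)
      then have "F \<in> panel s G" "F' \<in> panel s G"
        using G G' \<open>G' = G\<close> by (auto simp: panel_def)
      then have FF: "\<delta> F F' = s"
        using dist_in_panel Ch mult(1) ne by blast
      have "s \<in> inversions (s \<otimes> inv v)"
        using mult by (simp add: inversions_gen_mult conj_by_def)
      then have "s \<notin> inversions (s \<otimes> inv v \<otimes> w0)"
        using inversions_mult_longest[OF w0, of "s \<otimes> inv v" \<one> s] mult by simp
      moreover have d: "\<delta> F' E = s \<otimes> inv v \<otimes> w0" "\<delta> F E = s \<otimes> inv v \<otimes> w0"
        using F mult by (auto simp: in_hull_def inv_mult_group)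
      ultimately have "\<delta> F E = s \<otimes> \<delta> F E"
        using dist_gen_mult[OF Ch(1,2) E(1) FF mult(1)] by simp
      then show False
        using Ch(1) E(1) mult(1) gens_nontriv by (metis dist_carrier gen_closed r_cancel_one')
    qed
  qed
  define \<alpha> where "\<alpha> v = (SOME F. in_hull v F)" for v
  have \<alpha>: "in_hull v (\<alpha> v)" if "v \<in> carrier W" for v
    unfolding \<alpha>_def using ex[OF that] by (rule someI_ex)
  have \<alpha>_eq: "\<alpha> v = F" if "in_hull v F" "v \<in> carrier W" for v F
    using unique[OF that(2)] \<alpha>[OF that(2)] that(1) by blast
  have \<alpha>_Ch: "\<alpha> v \<in> Ch" if "v \<in> carrier W" for v
    using \<alpha>[OF that] by (simp add: in_hull_def)
  have up: "\<delta> (\<alpha> v) (\<alpha> (v \<otimes> s)) = s"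
    if v: "v \<in> carrier W" and s: "s \<in> S" and n: "s \<notin> inversions (inv v)" for v s
    using down[OF \<alpha> v s n] \<alpha>_eq v s by auto
  have adj: "\<delta> (\<alpha> v) (\<alpha> (v \<otimes> s)) = s" if v: "v \<in> carrier W" and s: "s \<in> S" for v s
  proof (cases "s \<in> inversions (inv v)")
    case False
    then show ?thesis using up v s by blast
  next
    case True
    have vs: "v \<otimes> s \<in> carrier W" using v s by simp
    have "s \<notin> inversions (inv (v \<otimes> s))"
      using True v s by (simp add: inv_mult_group inversions_gen_mult conj_by_def)
    then have "\<delta> (\<alpha> (v \<otimes> s)) (\<alpha> (v \<otimes> s \<otimes> s)) = s"
      using up[OF vs s] by blast
    then have "\<delta> (\<alpha> (v \<otimes> s)) (\<alpha> v) = s"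
      using v s by simp
    then show ?thesis
      using dist_gen_sym[OF \<alpha>_Ch[OF vs] \<alpha>_Ch[OF v]] s by simp
  qed
  \<comment> \<open>Adjacency within the image suffices, because distances multiply along reduced
    words.\<close>
  have iso: "\<delta> (\<alpha> v) (\<alpha> (v \<otimes> x)) = x" if x: "x \<in> carrier W" and v: "v \<in> carrier W" for x v
    using x
  proof (induction rule: right_induct)
    case one
    then show ?case using v \<alpha>_Ch by simp
  next
    case (mult s x)
    have vx: "v \<otimes> x \<in> carrier W" "v \<otimes> (x \<otimes> s) \<in> carrier W" using v mult by auto
    have "\<delta> (\<alpha> (v \<otimes> x)) (\<alpha> (v \<otimes> (x \<otimes> s))) = s"
      using adj[OF vx(1) mult(1)] v mult by (simp add: m_assoc)
    then show ?case
      using dist_mult_gen[OF \<alpha>_Ch[OF v] \<alpha>_Ch[OF vx(1)] \<alpha>_Ch[OF vx(2)] _ mult(1)] mult by simp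
  qed
  have "isometry \<alpha>"
    unfolding isometry_def
  proof (intro conjI ballI)
    show "\<alpha> \<in> carrier W \<rightarrow> Ch" using \<alpha>_Ch by auto
    fix v w assume "v \<in> carrier W" "w \<in> carrier W"
    then show "\<delta> (\<alpha> v) (\<alpha> w) = inv v \<otimes> w"
      using iso[of "inv v \<otimes> w" v] by simp
  qed
  moreover have "\<alpha> \<one> = C"
    using C CE w0(1) by (intro \<alpha>_eq) (simp_all add: in_hull_def)
  moreover have "\<alpha> ?w = D"
    using D E w by (intro \<alpha>_eq) (simp_all add: in_hull_def)
  ultimately show ?thesis using that by blast
qed

lemma ex_apartment:
  assumes "C \<in> Ch" "D \<in> Ch"
  obtains A where "apartment A" "C \<in> A" "D \<in> A"
proof -
  obtain \<alpha> where \<alpha>: "isometry \<alpha>" "\<alpha> \<one> = C" "\<alpha> (\<delta> C D) = D"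
    using assms by (rule ex_isometry)
  have "C \<in> \<alpha> ` carrier W" "D \<in> \<alpha> ` carrier W"
    using \<alpha>(2,3) assms by (metis one_closed dist_carrier imageI)+
  with \<alpha>(1) show ?thesis using that apartment_iff by blast
qed

text \<open>Two chambers at the same distance \<open>w\<close> from \<open>C\<close> have a common opposite, namely any chamber at
  distance \<open>w w\<^sub>0\<close> from \<open>C\<close>; so the thickness of a panel depends only on the distance.\<close>

lemma thick_panel_same_dist:
  assumes Ch: "C \<in> Ch" "D \<in> Ch" "D' \<in> Ch" and eq: "\<delta> C D = \<delta> C D'" and s: "s \<in> S"
    and thick: "thick_panel (panel s D)"
  shows "thick_panel (panel s D')"
proof -
  obtain w0 where w0: "w0 \<in> carrier W"
    "\<And>v s. \<lbrakk>v \<in> carrier W; s \<in> S\<rbrakk> \<Longrightarrow> conj_by v s \<in> inversions w0"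
    by (rule ex_longest) blast
  let ?w = "\<delta> C D"
  have w: "?w \<in> carrier W" using Ch by simp
  obtain E where E: "E \<in> Ch" "\<delta> C E = ?w \<otimes> w0"
    using ex_at_dist[of C "?w \<otimes> w0"] Ch w w0(1) by auto
  have opp: "\<delta> X E = w0" if X: "X \<in> Ch" "\<delta> C X = ?w" for X
  proof -
    have "\<delta> X C = inv ?w" using dist_inv[OF Ch(1) X(1)] X by simp
    then have "\<delta> X E = inv ?w \<otimes> (?w \<otimes> w0)"
      using inversions_mult_longest_disjoint[OF w0, of ?w] w
      by (intro dist_mult[OF X(1) Ch(1) E(1) _ E(2)]) auto
    then show ?thesis using w w0(1) by simp
  qed
  \<comment> \<open>The panel of this type at \<open>E\<close> is parallel to the
    \<open>s\<close>-panels at both \<open>D\<close> and \<open>D'\<close>, and carries thickness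
    from one to the other.\<close>
  let ?t = "conj_by (inv w0) s"
  have t: "?t \<in> S" by (rule longest_conj_gen[OF w0 s])
  have st: "s \<otimes> w0 = w0 \<otimes> ?t"
    using w0(1) s by (simp add: conj_by_def m_assoc)
  have "thick_panel (panel ?t E)"
    using thick_panel_parallel[OF Ch(2) E(1) s t _ thick] opp[OF Ch(2)] st by simp
  moreover have "\<delta> E D' = inv w0"
    using dist_inv[OF Ch(3) E(1)] opp[OF Ch(3)] eq by simp
  moreover have "?t \<otimes> inv w0 = inv w0 \<otimes> s"
    using w0(1) s by (simp add: conj_by_def m_assoc)
  ultimately show ?thesis
    using thick_panel_parallel[OF E(1) Ch(3) t s] by simp
qed

text \<open>\<open>thick_refls\<close> asks for a single thick panel on a wall; this spreads
  thickness to every panel in such a position. In an apartment through \<open>C\<close> and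
  \<open>E\<close> the panels of one wall are parallel, and \<open>thick_panel_same_dist\<close>
  reaches the chambers outside it.\<close>

lemma thick_panel_iff:
  assumes C: "C \<in> Ch" and D: "D \<in> Ch" and s: "s \<in> S"
  shows "thick_panel (panel s D) \<longleftrightarrow> conj_by (\<delta> C D) s \<in> thick_refls C"
proof
  show "thick_panel (panel s D) \<Longrightarrow> conj_by (\<delta> C D) s \<in> thick_refls C"
    using D s by (rule thick_reflsI)
  assume "conj_by (\<delta> C D) s \<in> thick_refls C"
  then obtain E t where E: "E \<in> Ch" "t \<in> S" "thick_panel (panel t E)"
    and eq: "conj_by (\<delta> C D) s = conj_by (\<delta> C E) t"
    by (auto simp: thick_refls_def)
  obtain \<alpha> where \<alpha>: "isometry \<alpha>" "\<alpha> \<one> = C" "\<alpha> (\<delta> C E) = E"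
    using C E(1) by (rule ex_isometry)
  let ?v = "\<delta> C D" and ?w = "\<delta> C E"
  have cl: "?v \<in> carrier W" "?w \<in> carrier W" using C D E by auto
  have "\<delta> E (\<alpha> ?v) = inv ?w \<otimes> ?v" and dv: "\<delta> C (\<alpha> ?v) = ?v" "\<alpha> ?v \<in> Ch"
    using isometryD(2)[OF \<alpha>(1) cl(2,1)] isometryD(2)[OF \<alpha>(1) one_closed cl(1)]
      isometryD(1)[OF \<alpha>(1) cl(1)] \<alpha>(2,3) cl by simp_all
  moreover have "t = conj_by (inv ?w) (conj_by ?v s)"
    using eq cl E s by simp
  then have "t = inv ?w \<otimes> ?v \<otimes> s \<otimes> inv ?v \<otimes> ?w"
    using cl s by (simp add: conj_by_def m_assoc)
  then have "t \<otimes> (inv ?w \<otimes> ?v) = (inv ?w \<otimes> ?v) \<otimes> s"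
    using cl s by (simp add: m_assoc)
  ultimately have "thick_panel (panel s (\<alpha> ?v))"
    using thick_panel_parallel[OF E(1) dv(2) E(2) s _ E(3)] by simp
  then show "thick_panel (panel s D)"
    using thick_panel_same_dist[OF C dv(2) D dv(1) s] by simp
qed

text \<open>Change of origin from \<open>D\<close> to \<open>C\<close>. A position relative to
  \<open>D\<close> is realised in an apartment through \<open>C\<close> and \<open>D\<close>, where
  positions multiply; by \<open>thick_panel_same_dist\<close> the move does not alter
  thickness.\<close>

lemma thick_refls_conj_dist:
  assumes C: "C \<in> Ch" and D: "D \<in> Ch" and t: "t \<in> carrier W"
  shows "t \<in> thick_refls D \<longleftrightarrow> conj_by (\<delta> C D) t \<in> thick_refls C"
proof -
  have *: "conj_by (\<delta> C D) t \<in> thick_refls C"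
    if C: "C \<in> Ch" and D: "D \<in> Ch" and t: "t \<in> thick_refls D" for C D t
  proof -
    obtain E s where E: "E \<in> Ch" "s \<in> S" "thick_panel (panel s E)" "t = conj_by (\<delta> D E) s"
      using t by (auto simp: thick_refls_def)
    obtain \<alpha> where \<alpha>: "isometry \<alpha>" "\<alpha> \<one> = C" "\<alpha> (\<delta> C D) = D"
      using C D by (rule ex_isometry)
    let ?v = "\<delta> C D" and ?x = "\<delta> D E"
    have cl: "?v \<in> carrier W" "?x \<in> carrier W" "?v \<otimes> ?x \<in> carrier W" using C D E by auto
    have d: "\<delta> D (\<alpha> (?v \<otimes> ?x)) = ?x" "\<delta> C (\<alpha> (?v \<otimes> ?x)) = ?v \<otimes> ?x" "\<alpha> (?v \<otimes> ?x) \<in> Ch"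
      using isometryD(2)[OF \<alpha>(1) cl(1,3)] isometryD(2)[OF \<alpha>(1) one_closed cl(3)]
        isometryD(1)[OF \<alpha>(1) cl(3)] \<alpha>(2,3) cl by simp_all
    have "thick_panel (panel s (\<alpha> (?v \<otimes> ?x)))"
      using thick_panel_same_dist[OF D E(1) d(3) _ E(2,3)] d(1) by simp
    then have "conj_by (?v \<otimes> ?x) s \<in> thick_refls C"
      using thick_reflsI[of "\<alpha> (?v \<otimes> ?x)" s C] d E(2) by simp
    then show ?thesis
      using E(2,4) cl by (simp add: conj_conj)
  qed
  have "conj_by (\<delta> D C) (conj_by (\<delta> C D) t) = t"
    using dist_inv[OF C D] C D t by simp
  then show ?thesis
    using *[OF C D] *[OF D C, of "conj_by (\<delta> C D) t"] by auto
qed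

text \<open>Three chambers \<open>D\<close>, \<open>D\<^sub>1\<close>, \<open>D\<^sub>2\<close> of a thick \<open>s\<close>-panel are pairwise \<open>s\<close>-adjacent, so passing
  \<open>D \<rightarrow> D\<^sub>1 \<rightarrow> D\<^sub>2 \<rightarrow> D\<close> conjugates \<open>thick_refls D\<close> by \<open>s\<close> an odd number of times.\<close>

lemma thick_refls_conj_gen:
  assumes D: "D \<in> Ch" and s: "s \<in> S" and thick: "thick_panel (panel s D)"
    and t: "t \<in> thick_refls D"
  shows "conj_by s t \<in> thick_refls D"
proof -
  obtain T where T: "T \<subseteq> panel s D" "card T = 3"
    using thick by (auto simp: thick_panel_def)
  have fin: "finite T" using T by (simp add: card_ge_0_finite)
  have "card (T - {D}) \<ge> 2"
    using T(2) fin by (simp add: card_Diff_singleton_if)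
  then obtain X where X: "X \<subseteq> T - {D}" "card X = 2"
    using obtain_subset_with_card_n by metis
  then obtain D1 D2 where "X = {D1, D2}" "D1 \<noteq> D2" by (auto simp: card_2_iff)
  then have D12: "D1 \<in> panel s D" "D2 \<in> panel s D" "D1 \<noteq> D" "D2 \<noteq> D" "D1 \<noteq> D2"
    using X T by auto
  have Ch: "D1 \<in> Ch" "D2 \<in> Ch" using D12 by (auto simp: panel_def)
  have tc: "t \<in> carrier W" using thick_refls_closed[OF D t] .
  have d: "\<delta> D1 D = s" "\<delta> D2 D1 = s" "\<delta> D D2 = s"
    using dist_in_panel[OF D s] D12 D by (metis in_panel_self)+
  have "conj_by s t \<in> thick_refls D1"
    using thick_refls_conj_dist[OF Ch(1) D tc] d t by simp
  then have "conj_by s (conj_by s t) \<in> thick_refls D2"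
    using thick_refls_conj_dist[OF Ch(2,1), of "conj_by s t"] d tc s by simp
  then have "t \<in> thick_refls D2" using s tc by simp
  then show ?thesis
    using thick_refls_conj_dist[OF D Ch(2) tc] d by simp
qed

text \<open>With the origin moved to a chamber of a thick panel on the wall of \<open>r\<close>, the
  reflection \<open>r\<close> becomes a generator and \<open>thick_refls_conj_gen\<close>
  applies.\<close>

lemma thick_refls_conj:
  assumes C: "C \<in> Ch" and r: "r \<in> thick_refls C" and t: "t \<in> thick_refls C"
  shows "conj_by r t \<in> thick_refls C"
proof -
  obtain D s where D: "D \<in> Ch" "s \<in> S" "thick_panel (panel s D)" "r = conj_by (\<delta> C D) s"
    using r by (auto simp: thick_refls_def)
  let ?v = "\<delta> C D"
  have cl: "?v \<in> carrier W" "t \<in> carrier W" "s \<in> carrier W"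
    using C D t thick_refls_closed by auto
  have "conj_by (inv ?v) t \<in> thick_refls D"
    using thick_refls_conj_dist[OF C D(1), of "conj_by (inv ?v) t"] t cl by simp
  then have "conj_by s (conj_by (inv ?v) t) \<in> thick_refls D"
    using thick_refls_conj_gen D by blast
  then have "conj_by ?v (conj_by s (conj_by (inv ?v) t)) \<in> thick_refls C"
    using thick_refls_conj_dist[OF C D(1), of "conj_by s (conj_by (inv ?v) t)"] cl by simp
  moreover have "conj_by ?v (conj_by s (conj_by (inv ?v) t)) = conj_by r t"
    using cl D(4) by (simp add: conj_conj conj_by_def[of ?v s] m_assoc)
  ultimately show ?thesis by simp
qed

text \<open>A thin step adds only a thin wall. Conversely the first letter of a reduced gallery is
  an inversion, so its panel is thin, and the remaining inversions, conjugated to the next chamber,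
  again avoid the thick walls.\<close>

lemma thin_equiv_iff:
  assumes C: "C \<in> Ch" and D: "D \<in> Ch"
  shows "(C, D) \<in> thin_equiv \<longleftrightarrow> inversions (\<delta> C D) \<inter> thick_refls C = {}"
proof
  assume "(C, D) \<in> thin_equiv"
  then show "inversions (\<delta> C D) \<inter> thick_refls C = {}"
  proof (induction rule: thin_equiv_induct)
    case base
    then show ?case using C by simp
  next
    case (step D E)
    have DE: "D \<in> Ch" "E \<in> Ch" "\<delta> D E \<in> S" "\<not> thick_panel (panel (\<delta> D E) D)"
      using step(2) by (auto simp: thin_adj_iff)
    have "conj_by (\<delta> C D) (\<delta> D E) \<notin> thick_refls C"
      using thick_panel_iff[OF C DE(1,3)] DE(4) by simp
    moreover have "t \<in> inversions (\<delta> C D) \<or> t = conj_by (\<delta> C D) (\<delta> D E)"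
      if "t \<in> inversions (\<delta> C E)" for t
      using that inversions_mult_gen[OF DE(3) dist_carrier[OF C DE(1)] inversions_closed[OF that]]
        dist_thin_adj[OF C step(2)] by auto
    ultimately show ?case using step.IH by blast
  qed
next
  have "\<forall>C\<in>Ch. \<delta> C D = w \<longrightarrow> inversions w \<inter> thick_refls C = {} \<longrightarrow> (C, D) \<in> thin_equiv"
    if "w \<in> carrier W" for w
    using that
  proof (induction rule: left_induct)
    case one
    then show ?case using D WD1 by (auto simp: thin_equiv_def)
  next
    case (mult s w)
    show ?case
    proof (intro ballI impI)
      fix C assume C: "C \<in> Ch" "\<delta> C D = s \<otimes> w" and disj: "inversions (s \<otimes> w) \<inter> thick_refls C = {}"
      have cl: "s \<in> carrier W" "w \<in> carrier W" using mult by auto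
      obtain B where B: "B \<in> Ch" "\<delta> C B = s" "\<delta> B D = w"
        using ex_between[of s w C D] C D cl by blast
      have "s \<in> inversions (s \<otimes> w)"
        using mult cl by (simp add: inversions_gen_mult conj_by_def)
      then have "s \<notin> thick_refls C" using disj by blast
      then have "\<not> thick_panel (panel s C)"
        using thick_panel_iff[OF C(1) C(1) mult(1)] C(1) cl by simp
      then have CB: "(C, B) \<in> thin_adj"
        using C B mult(1) by (simp add: thin_adj_iff)
      have "t \<notin> thick_refls B" if t: "t \<in> inversions w" for t
      proof
        assume "t \<in> thick_refls B"
        have tc: "t \<in> carrier W" using t by (rule inversions_closed)
        then have "conj_by s t \<in> thick_refls C"
          using thick_refls_conj_dist[OF C(1) B(1) tc] B(2) \<open>t \<in> thick_refls B\<close> by simp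
        moreover have "conj_by s t \<noteq> s"
        proof
          assume "conj_by s t = s"
          then have "t = conj_by s s" using conj_gen_gen[OF mult(1) tc] by simp
          then have "t = s" using mult(1) by (simp add: conj_by_def)
          then show False using t mult(3) by simp
        qed
        then have "conj_by s t \<in> inversions (s \<otimes> w)"
          using t tc mult(1) cl by (simp add: inversions_gen_mult)
        ultimately show False using disj by blast
      qed
      then have "(B, D) \<in> thin_equiv" using mult.IH B by blast
      moreover have "(C, B) \<in> thin_equiv"
        using CB C B by (auto simp: thin_equiv_def)
      ultimately show "(C, D) \<in> thin_equiv"
        using equiv_thin by (meson equivE transD)
    qed
  qed
  then show "inversions (\<delta> C D) \<inter> thick_refls C = {} \<Longrightarrow> (C, D) \<in> thin_equiv"
    using C D dist_carrier by blast
qed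

end


section \<open>The thick frame\<close>

context thick_frame
begin

section \<open>Coordinates and walls in the base apartment\<close>

lemma base_in_Ch [simp]: "C\<^sub>0 \<in> Ch"
  using base_apartment base_chamber isometryD(1) by (auto simp: apartment_iff)

lemma chamber_at_isometry:
  assumes "isometry \<alpha>" "\<alpha> \<one> = C\<^sub>0" "w \<in> carrier W"
  shows "\<delta> C\<^sub>0 (\<alpha> w) = w" and "chamber_at (\<alpha> ` carrier W) w = \<alpha> w"
proof -
  have d: "\<delta> C\<^sub>0 (\<alpha> v) = v" if "v \<in> carrier W" for v
    using isometryD(2)[OF assms(1) one_closed that] assms(2) that by simp
  then show "\<delta> C\<^sub>0 (\<alpha> w) = w" using assms by blast
  show "chamber_at (\<alpha> ` carrier W) w = \<alpha> w"
    unfolding chamber_at_def using d assms(3) by (intro the_equality) auto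
qed

definition coord :: "'w \<Rightarrow> 'c" where
  "coord = (SOME \<alpha>. isometry \<alpha> \<and> A\<^sub>0 = \<alpha> ` carrier W \<and> \<alpha> \<one> = C\<^sub>0)"

lemma coord: "isometry coord" "A\<^sub>0 = coord ` carrier W" "coord \<one> = C\<^sub>0"
proof -
  have "\<exists>\<alpha>. isometry \<alpha> \<and> A\<^sub>0 = \<alpha> ` carrier W \<and> \<alpha> \<one> = C\<^sub>0"
    using apartment_isometry[OF base_apartment base_chamber] by metis
  then have "isometry coord \<and> A\<^sub>0 = coord ` carrier W \<and> coord \<one> = C\<^sub>0"
    unfolding coord_def by (rule someI_ex)
  then show "isometry coord" "A\<^sub>0 = coord ` carrier W" "coord \<one> = C\<^sub>0" by auto
qed

lemma coord_closed [simp]: "w \<in> carrier W \<Longrightarrow> coord w \<in> Ch"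
  using isometryD(1)[OF coord(1)] .

lemma dist_coord: "\<lbrakk>v \<in> carrier W; w \<in> carrier W\<rbrakk> \<Longrightarrow> \<delta> (coord v) (coord w) = inv v \<otimes> w"
  using isometryD(2)[OF coord(1)] .

lemma dist_base_coord [simp]: "w \<in> carrier W \<Longrightarrow> \<delta> C\<^sub>0 (coord w) = w"
  using chamber_at_isometry(1)[OF coord(1,3)] .

lemma coord_eq_iff: "\<lbrakk>v \<in> carrier W; w \<in> carrier W\<rbrakk> \<Longrightarrow> coord v = coord w \<longleftrightarrow> v = w"
  by (auto dest: arg_cong[where f = "\<delta> C\<^sub>0"])

lemma chamber_at_coord: "w \<in> carrier W \<Longrightarrow> chamber_at A\<^sub>0 w = coord w"
  by (rule chamber_at_isometry(2)[OF coord(1,3), folded coord(2)])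

lemma coord_in_base_apartment [simp]: "w \<in> carrier W \<Longrightarrow> coord w \<in> A\<^sub>0"
  using coord(2) by blast

lemma in_base_apartment: "D \<in> A\<^sub>0 \<longleftrightarrow> (\<exists>w\<in>carrier W. D = coord w)"
  using coord(2) by blast

lemma act_coord: "\<lbrakk>v \<in> carrier W; w \<in> carrier W\<rbrakk> \<Longrightarrow> act A\<^sub>0 v (coord w) = coord (v \<otimes> w)"
  by (simp add: act_def chamber_at_coord)

lemma panel_coord:
  assumes "w \<in> carrier W" "s \<in> S"
  shows "panel s (coord w) \<inter> A\<^sub>0 = {coord w, coord (w \<otimes> s)}"
proof -
  have "inv w \<otimes> v = s \<longleftrightarrow> v = w \<otimes> s" "inv w \<otimes> v = \<one> \<longleftrightarrow> v = w" if "v \<in> carrier W" for v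
    using assms that by (auto simp: inv_solve_left')
  then have *: "coord v \<in> panel s (coord w) \<longleftrightarrow> v = w \<or> v = w \<otimes> s" if "v \<in> carrier W" for v
    using assms that by (auto simp: panel_def dist_coord)
  have ws: "w \<otimes> s \<in> carrier W" using assms by simp
  show ?thesis
  proof (intro subset_antisym subsetI)
    fix D assume "D \<in> panel s (coord w) \<inter> A\<^sub>0"
    then show "D \<in> {coord w, coord (w \<otimes> s)}"
      using * in_base_apartment by auto
  next
    fix D assume "D \<in> {coord w, coord (w \<otimes> s)}"
    then show "D \<in> panel s (coord w) \<inter> A\<^sub>0"
      using *[OF assms(1)] *[OF ws] in_base_apartment assms(1) ws by auto
  qed
qed

lemma conj_gen_neq_one:
  assumes "v \<in> carrier W" "s \<in> S"
  shows "conj_by v s \<noteq> \<one>"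
  using conj_gen_in_inversions[OF assms] by auto

lemma reflections_conj: "reflections = {conj_by v s | v s. v \<in> carrier W \<and> s \<in> S}"
  by (simp add: reflections_def conj_by_def)

text \<open>A panel of the apartment meets it in two chambers \<open>w\<close> and
  \<open>w s\<close>. Since \<open>r \<noteq> \<one>\<close> fixes no chamber it must exchange them,
  and \<open>r w = w s\<close> determines \<open>r\<close>.\<close>

lemma wall_base:
  assumes "r \<in> reflections"
  shows "wall A\<^sub>0 r = {panel s (coord w) | s w. s \<in> S \<and> w \<in> carrier W \<and> conj_by w s = r}"
proof
  have r: "r \<in> carrier W" "r \<noteq> \<one>"
    using assms conj_gen_neq_one by (auto simp: reflections_conj)
  show "wall A\<^sub>0 r \<subseteq> {panel s (coord w) | s w. s \<in> S \<and> w \<in> carrier W \<and> conj_by w s = r}"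
  proof
    fix P assume "P \<in> wall A\<^sub>0 r"
    then obtain s C where P: "P = panel s C" "s \<in> S" "C \<in> Ch" "P \<inter> A\<^sub>0 \<noteq> {}"
      and stab: "act A\<^sub>0 r ` (P \<inter> A\<^sub>0) = P \<inter> A\<^sub>0"
      by (auto simp: wall_def panels_def)
    then obtain w where w: "w \<in> carrier W" "coord w \<in> panel s C"
      by (auto simp: in_base_apartment)
    have Pw: "P = panel s (coord w)"
    proof (cases "C = coord w")
      case False
      then have "\<delta> C (coord w) = s"
        using dist_in_panel[OF P(3,2) _ w(2)] P by simp
      then show ?thesis using panel_eq[OF P(3) _ P(2)] w P(1) by simp
    qed (use P in simp)
    have "coord (r \<otimes> w) \<in> act A\<^sub>0 r ` (P \<inter> A\<^sub>0)"
      using panel_coord[OF w(1) P(2)] act_coord[OF r(1) w(1)] Pw by auto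
    then have "coord (r \<otimes> w) \<in> {coord w, coord (w \<otimes> s)}"
      unfolding stab unfolding Pw panel_coord[OF w(1) P(2)] .
    then have "r \<otimes> w = w \<or> r \<otimes> w = w \<otimes> s"
      using r w P by (simp add: coord_eq_iff)
    then have "r \<otimes> w = w \<otimes> s"
      using r w by (simp add: l_cancel_one)
    from this[symmetric] have "conj_by w s = r"
      unfolding conj_by_def using r w by (simp add: m_assoc)
    then show "P \<in> {panel s (coord w) | s w. s \<in> S \<and> w \<in> carrier W \<and> conj_by w s = r}"
      using Pw P w by blast
  qed
  show "{panel s (coord w) | s w. s \<in> S \<and> w \<in> carrier W \<and> conj_by w s = r} \<subseteq> wall A\<^sub>0 r"
  proof clarify
    fix s w assume s: "s \<in> S" and w: "w \<in> carrier W"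
    let ?r = "conj_by w s"
    have "?r \<otimes> w = w \<otimes> s" "?r \<otimes> (w \<otimes> s) = w"
      using s w by (simp_all add: conj_by_def m_assoc gens_invol)
    moreover have "?r \<in> carrier W" "w \<otimes> s \<in> carrier W" using s w by auto
    ultimately have "act A\<^sub>0 ?r ` {coord w, coord (w \<otimes> s)} = {coord w, coord (w \<otimes> s)}"
      using act_coord[of ?r w] act_coord[of ?r "w \<otimes> s"] w by auto
    moreover have "panel s (coord w) \<in> panels"
      using s coord_closed[OF w] unfolding panels_def by blast
    ultimately show "panel s (coord w) \<in> wall A\<^sub>0 ?r"
      using panel_coord[OF w s] by (simp add: wall_def)
  qed
qed

text \<open>One side demands that all panels of the wall in \<open>A\<^sub>0\<close> be thick, the
  other that one panel, possibly outside \<open>A\<^sub>0\<close>, be thick;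
  \<open>thick_panel_iff\<close> closes the gap.\<close>

lemma thick_reflections_eq: "thick_reflections = thick_refls C\<^sub>0"
proof
  show "thick_reflections \<subseteq> thick_refls C\<^sub>0"
  proof
    fix r assume r: "r \<in> thick_reflections"
    then obtain v s where vs: "v \<in> carrier W" "s \<in> S" "r = conj_by v s"
      by (auto simp: thick_reflections_def reflections_conj)
    then have "panel s (coord v) \<in> wall A\<^sub>0 r"
      using r wall_base[of r] unfolding thick_reflections_def by blast
    then have "thick_panel (panel s (coord v))"
      using r by (auto simp: thick_reflections_def)
    then show "r \<in> thick_refls C\<^sub>0"
      using thick_reflsI[of "coord v" s C\<^sub>0] vs by simp
  qed
  show "thick_refls C\<^sub>0 \<subseteq> thick_reflections"
  proof
    fix r assume r: "r \<in> thick_refls C\<^sub>0"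
    then have refl: "r \<in> reflections"
      unfolding thick_refls_def reflections_conj using dist_carrier base_in_Ch by blast
    have "thick_panel P" if P: "P \<in> wall A\<^sub>0 r" for P
    proof -
      obtain s w where "P = panel s (coord w)" "s \<in> S" "w \<in> carrier W" "conj_by w s = r"
        using P[unfolded wall_base[OF refl]] by blast
      then show ?thesis
        using thick_panel_iff[of C\<^sub>0 "coord w" s] r by simp
    qed
    with refl show "r \<in> thick_reflections" by (simp add: thick_reflections_def)
  qed
qed

section \<open>The reflection subgroup and its transversal\<close>

abbreviation T' :: "'w set" where
  "T' \<equiv> thick_refls C\<^sub>0"

definition U :: "'w set" where
  "U = {u \<in> carrier W. inversions u \<inter> T' = {}}"

definition W' :: "'w set" where
  "W' = generate W T'"

lemma carrier_frame_group: "carrier frame_group = W'"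
  by (simp add: frame_group_def W'_def thick_reflections_eq)

lemma T'_closed [simp]: "t \<in> T' \<Longrightarrow> t \<in> carrier W"
  using thick_refls_closed[of C\<^sub>0] by simp

lemma T'_invol: "t \<in> T' \<Longrightarrow> t \<otimes> t = \<one>"
  using conj_mult by (auto simp: thick_refls_def gens_invol simp flip: conj_mult)

lemma T'_inv: "t \<in> T' \<Longrightarrow> inv t = t"
  by (simp add: T'_invol inv_equality)

lemma T'_subset_W': "t \<in> T' \<Longrightarrow> t \<in> W'"
  unfolding W'_def by (rule generate.incl)

lemma subgroup_W': "subgroup W' W"
  unfolding W'_def by (rule generate_is_subgroup) auto

lemma W'_closed [simp]: "g \<in> W' \<Longrightarrow> g \<in> carrier W"
  using subgroup.subset[OF subgroup_W'] by blast

lemma W'_mult [intro]: "\<lbrakk>g \<in> W'; h \<in> W'\<rbrakk> \<Longrightarrow> g \<otimes> h \<in> W'"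
  by (rule subgroup.m_closed[OF subgroup_W'])

lemma W'_inv [intro]: "g \<in> W' \<Longrightarrow> inv g \<in> W'"
  by (rule subgroup.m_inv_closed[OF subgroup_W'])

lemma W'_one [intro]: "\<one> \<in> W'"
  by (rule subgroup.one_closed[OF subgroup_W'])

lemma T'_conj_W': "g \<in> W' \<Longrightarrow> t \<in> T' \<Longrightarrow> conj_by g t \<in> T'"
  unfolding W'_def
proof (induction arbitrary: t rule: generate.induct)
  case (eng g h)
  then have "conj_by g (conj_by h t) \<in> T'" by blast
  moreover have "g \<in> carrier W" "h \<in> carrier W"
    using eng W'_closed by (auto simp: W'_def)
  ultimately show ?case using eng by (simp add: conj_conj)
qed (auto simp: thick_refls_conj T'_inv)

lemma T'_conj_W'_iff:
  assumes "g \<in> W'" "t \<in> carrier W"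
  shows "conj_by g t \<in> T' \<longleftrightarrow> t \<in> T'"
proof
  assume "conj_by g t \<in> T'"
  from T'_conj_W'[OF W'_inv[OF assms(1)] this] show "t \<in> T'"
    using assms by simp
qed (rule T'_conj_W'[OF assms(1)])

lemma U_closed [simp]: "u \<in> U \<Longrightarrow> u \<in> carrier W"
  by (simp add: U_def)

lemma U_inversions: "\<lbrakk>u \<in> U; t \<in> T'\<rbrakk> \<Longrightarrow> t \<notin> inversions u"
  unfolding U_def by blast

lemma one_in_U: "\<one> \<in> U"
  by (simp add: U_def del: U_closed)

lemma mult_gen_in_U_iff:
  assumes u: "u \<in> U" and s: "s \<in> S"
  shows "u \<otimes> s \<in> U \<longleftrightarrow> conj_by u s \<notin> T'"
proof -
  have "t \<in> inversions (u \<otimes> s) \<longleftrightarrow> t = conj_by u s" if "t \<in> T'" for t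
    using inversions_mult_gen[OF s, of u t] U_inversions[OF u that] u that by simp
  then show ?thesis
    using u s by (auto simp: U_def simp del: U_closed)
qed

definition walls_base :: "'w set" where
  "walls_base = {conj_by u s | u s. u \<in> U \<and> s \<in> S \<and> conj_by u s \<in> T'}"

lemma base_class_eq: "base_class = coord ` U"
proof -
  have sub: "base_class \<subseteq> A\<^sub>0"
    using thin_class_subset_apartment[OF base_apartment base_chamber] by (auto simp: base_class_def)
  have "coord w \<in> base_class \<longleftrightarrow> w \<in> U" if "w \<in> carrier W" for w
    using thin_equiv_iff[of C\<^sub>0 "coord w"] that by (simp add: base_class_def U_def del: U_closed)
  then show ?thesis using sub in_base_apartment by (auto simp: subset_iff)
qed

lemma coord_in_base_class: "w \<in> carrier W \<Longrightarrow> coord w \<in> base_class \<longleftrightarrow> w \<in> U"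
  unfolding base_class_eq using coord_eq_iff by auto

lemma frame_gens_eq: "frame_gens = walls_base"
proof
  show "frame_gens \<subseteq> walls_base"
  proof
    fix r assume "r \<in> frame_gens"
    then obtain P where r: "r \<in> reflections" and P: "P \<in> wall A\<^sub>0 r" "P \<inter> base_class \<noteq> {}"
      "\<not> P \<inter> A\<^sub>0 \<subseteq> base_class"
      by (auto simp: frame_gens_def)
    obtain s w where sw: "P = panel s (coord w)" "s \<in> S" "w \<in> carrier W" "conj_by w s = r"
      using P(1)[unfolded wall_base[OF r]] by blast
    have ws: "w \<otimes> s \<in> carrier W" using sw by simp
    have PA: "P \<inter> A\<^sub>0 = {coord w, coord (w \<otimes> s)}"
      using panel_coord sw by simp
    have "base_class \<subseteq> A\<^sub>0" by (auto simp: base_class_eq)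
    then have "P \<inter> A\<^sub>0 \<inter> base_class \<noteq> {}" using P(2) by blast
    then have "w \<in> U \<or> w \<otimes> s \<in> U"
      unfolding PA using coord_in_base_class[OF sw(3)] coord_in_base_class[OF ws] by auto
    moreover have "w \<notin> U \<or> w \<otimes> s \<notin> U"
      using P(3) unfolding PA
      using coord_in_base_class[OF sw(3)] coord_in_base_class[OF ws] by auto
    ultimately consider "w \<in> U" "w \<otimes> s \<notin> U" | "w \<otimes> s \<in> U" "w \<otimes> s \<otimes> s \<notin> U"
      using sw by auto
    then show "r \<in> walls_base"
    proof cases
      case 1
      then show ?thesis
        using sw mult_gen_in_U_iff[of w s] by (auto simp: walls_base_def)
    next
      case 2
      moreover have "conj_by (w \<otimes> s) s = r"
        using sw by (simp add: conj_by_def inv_mult_group m_assoc)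
      ultimately show ?thesis
        using sw mult_gen_in_U_iff[of "w \<otimes> s" s] unfolding walls_base_def by blast
    qed
  qed
  show "walls_base \<subseteq> frame_gens"
  proof
    fix r assume "r \<in> walls_base"
    then obtain u s where us: "u \<in> U" "s \<in> S" "conj_by u s \<in> T'" "r = conj_by u s"
      by (auto simp: walls_base_def)
    let ?P = "panel s (coord u)"
    have refl: "r \<in> reflections"
      using us(2,4) U_closed[OF us(1)] unfolding reflections_conj by blast
    then have "?P \<in> wall A\<^sub>0 r" unfolding wall_base[OF refl] using us U_closed by blast
    moreover have PA: "?P \<inter> A\<^sub>0 = {coord u, coord (u \<otimes> s)}"
      using panel_coord us by simp
    moreover have "coord u \<in> base_class" "coord (u \<otimes> s) \<notin> base_class"
      using coord_in_base_class[of u] coord_in_base_class[of "u \<otimes> s"] mult_gen_in_U_iff us by auto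
    ultimately show "r \<in> frame_gens"
      using refl unfolding frame_gens_def by blast
  qed
qed

lemma walls_base_subset: "r \<in> walls_base \<Longrightarrow> r \<in> T'"
  by (auto simp: walls_base_def)

text \<open>A gallery to \<open>r\<close> runs inside the base class to \<open>u\<close>, crosses
  the wall of \<open>r\<close>, and returns inside the reflected class, so it meets no other thick
  wall. This is the condition under which \<open>strong_exchange\<close> works with
  \<open>walls_base\<close> as generators and \<open>T'\<close> as reflections.\<close>

lemma inversions_walls_base:
  assumes r: "r \<in> walls_base" and t: "t \<in> T'"
  shows "t \<in> inversions r \<longleftrightarrow> t = r"
proof -
  obtain u s where us: "u \<in> U" "s \<in> S" "r = conj_by u s"
    using r by (auto simp: walls_base_def)
  have rT: "r \<in> T'" using r by (rule walls_base_subset)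
  have cl: "u \<in> carrier W" "s \<in> carrier W" "t \<in> carrier W" using us t by auto
  let ?t = "conj_by (inv u) t"
  have tc: "?t \<in> carrier W" using cl by simp
  have "conj_by u (conj_by s ?t) = conj_by r t"
    using cl us(3) by (simp add: conj_conj conj_by_def[of u s] m_assoc)
  moreover have "conj_by r t \<notin> inversions u"
    using thick_refls_conj[OF base_in_Ch rT t] U_inversions us by blast
  ultimately have "conj_by s ?t \<notin> inversions (inv u)"
    using cl by (simp add: inversions_inv)
  then have "?t \<in> inversions (s \<otimes> inv u) \<longleftrightarrow> ?t = s"
    using us cl tc by (simp add: inversions_gen_mult)
  moreover have "r = u \<otimes> (s \<otimes> inv u)"
    using us(3) cl by (simp add: conj_by_def m_assoc)
  then have "t \<in> inversions r \<longleftrightarrow> ?t \<in> inversions (s \<otimes> inv u)"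
    using U_inversions[OF us(1) t] cl by (simp add: inversions_mult[of u])
  moreover have "?t = s \<longleftrightarrow> t = r"
    using us(3) cl by auto
  ultimately show ?thesis by simp
qed

text \<open>Once every \<open>v\<close> is written \<open>g u\<close> with \<open>g\<close>
  generated by the walls of the base class, a thick reflection \<open>v s (inv v)\<close> is the
  \<open>g\<close>-conjugate of one of these walls.\<close>

lemma generate_walls_base: "generate W walls_base = W'"
proof
  show "generate W walls_base \<subseteq> W'"
    unfolding W'_def using walls_base_subset by (intro mono_generate) blast
  then have sub: "g \<in> W'" if "g \<in> generate W walls_base" for g
    using that by blast
  have sg: "subgroup (generate W walls_base) W"
    using walls_base_subset by (intro generate_is_subgroup) auto
  \<comment> \<open>A step that leaves \<open>U\<close> crosses a wall of the base class; its
    reflection joins the left factor and \<open>u\<close> stays unchanged.\<close>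
  have decomp: "\<exists>g\<in>generate W walls_base. \<exists>u\<in>U. w = g \<otimes> u" if "w \<in> carrier W" for w
    using that
  proof (induction rule: right_induct)
    case one
    then show ?case using one_in_U generate.one by force
  next
    case (mult s w)
    then obtain g u where gu: "g \<in> generate W walls_base" "u \<in> U" "w = g \<otimes> u" by blast
    have cl: "g \<in> carrier W" "u \<in> carrier W" "s \<in> carrier W"
      using sub[OF gu(1)] gu(2) mult(1) by auto
    show ?case
    proof (cases "u \<otimes> s \<in> U")
      case True
      with gu cl show ?thesis
        by (intro bexI[of _ g] bexI[of _ "u \<otimes> s"]) (simp_all add: m_assoc)
    next
      case False
      then have "conj_by u s \<in> walls_base"
        using mult_gen_in_U_iff gu mult(1) by (auto simp: walls_base_def)
      then have "g \<otimes> conj_by u s \<in> generate W walls_base"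
        by (intro generate.eng[OF gu(1)] generate.incl)
      moreover have "w \<otimes> s = g \<otimes> conj_by u s \<otimes> u"
        using gu(3) cl by (simp add: conj_by_def m_assoc)
      ultimately show ?thesis using gu(2) by blast
    qed
  qed
  have "T' \<subseteq> generate W walls_base"
  proof
    fix t assume t: "t \<in> T'"
    then obtain v s where vs: "v \<in> carrier W" "s \<in> S" "t = conj_by v s"
      unfolding thick_refls_def using dist_carrier base_in_Ch by blast
    obtain g u where gu: "g \<in> generate W walls_base" "u \<in> U" "v = g \<otimes> u"
      using decomp[OF vs(1)] by blast
    have cl: "g \<in> carrier W" "u \<in> carrier W" "s \<in> carrier W"
      using sub[OF gu(1)] gu(2) vs(2) by auto
    have eq: "t = conj_by g (conj_by u s)"
      using vs(3) gu(3) cl by (simp add: conj_conj)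
    then have "conj_by u s \<in> T'"
      using T'_conj_W'_iff[OF sub[OF gu(1)], of "conj_by u s"] t cl by simp
    then have "conj_by u s \<in> generate W walls_base"
      using gu(2) vs(2) by (intro generate.incl) (auto simp: walls_base_def)
    then show "t \<in> generate W walls_base"
      unfolding eq conj_by_def[of g] using gu(1) sg
      by (intro subgroup.m_closed[OF sg] subgroup.m_inv_closed[OF sg])
  qed
  then show "W' \<subseteq> generate W walls_base"
    unfolding W'_def by (intro generate_subgroup_incl[OF _ sg])
qed

lemma W'_words: "W' = word_prod W ` lists walls_base"
  unfolding generate_walls_base[symmetric]
  using walls_base_subset T'_invol by (intro generate_eq_word_prod) auto

text \<open>If a word \<open>r # qs\<close> in the bounding walls has its product in
  \<open>U\<close>, then \<open>r\<close> does not separate the product from \<open>1\<close>, so it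
  is an inversion of the tail. Strong exchange then represents the same element by a word two
  letters shorter.\<close>

lemma W'_inter_U:
  assumes "g \<in> W'" "g \<in> U"
  shows "g = \<one>"
proof -
  have "word_prod W rs = \<one>" if "rs \<in> lists walls_base" "word_prod W rs \<in> U" for rs
    using that
  proof (induction "length rs" arbitrary: rs rule: less_induct)
    case less
    show ?case
    proof (cases rs)
      case (Cons r qs)
      then have r: "r \<in> walls_base" "r \<in> T'" and qs: "qs \<in> lists walls_base"
        using less.prems walls_base_subset by auto
      have lc: "lists walls_base \<subseteq> lists (carrier W)"
        using walls_base_subset by (intro lists_mono) auto
      then have q: "word_prod W qs \<in> carrier W"
        using qs by (intro word_prod_closed) blast
      have cocycle: "t \<in> inversions (r \<otimes> x) \<longleftrightarrow> (t = r) \<noteq> (conj_by r t \<in> inversions x)"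
        if "r \<in> walls_base" "x \<in> carrier W" "t \<in> T'" for r x t
        using inversions_walls_base[OF that(1,3)] walls_base_subset[OF that(1)] that
        by (simp add: inversions_mult T'_inv)
      have "r \<notin> inversions (r \<otimes> word_prod W qs)"
        using U_inversions[OF less.prems(2) r(2)] Cons by simp
      then have "conj_by r r \<in> inversions (word_prod W qs)"
        using cocycle[OF r(1) q r(2)] by simp
      moreover have "conj_by r r = r"
        using r(2) by (simp add: conj_by_def m_assoc)
      ultimately have "r \<in> inversions (word_prod W qs)" by simp
      have "\<exists>xs p ys. qs = xs @ p # ys \<and> r \<otimes> word_prod W qs = word_prod W (xs @ ys)"
      proof (rule strong_exchange[where R = walls_base and T = T' and N = inversions])
        show "\<And>r x t. \<lbrakk>r \<in> walls_base; x \<in> carrier W; t \<in> T'\<rbrakk> \<Longrightarrow>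
            t \<in> inversions (r \<otimes> x) \<longleftrightarrow> (t = r) \<noteq> (conj_by r t \<in> inversions x)"
          by (rule cocycle)
        show "r \<in> inversions (word_prod W qs)" by fact
        show "\<And>r t. \<lbrakk>r \<in> walls_base; t \<in> T'\<rbrakk> \<Longrightarrow> conj_by r t \<in> T'"
          using walls_base_subset thick_refls_conj by auto
      qed (use walls_base_subset T'_invol r qs in auto)
      then obtain xs p ys where *: "qs = xs @ p # ys" "r \<otimes> word_prod W qs = word_prod W (xs @ ys)"
        by blast
      have "xs @ ys \<in> lists walls_base" using qs *(1) by auto
      moreover have "word_prod W (xs @ ys) \<in> U" using less.prems(2) *(2) Cons by simp
      moreover have "length (xs @ ys) < length rs" using Cons *(1) by simp
      ultimately have "word_prod W (xs @ ys) = \<one>" by (intro less.hyps)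
      then show ?thesis using *(2) Cons by simp
    qed simp
  qed
  then show ?thesis using assms W'_words by auto
qed

text \<open>Conjugation by \<open>g\<close> permutes the thick walls, so the cocycle identity shows
  that \<open>g\<close> inverts none of them and lies in \<open>W' \<inter> U\<close>.\<close>

lemma U_unique:
  assumes "a \<in> U" "b \<in> U" "g \<in> W'" "a = g \<otimes> b"
  shows "a = b"
proof -
  have "t \<notin> inversions g" if t: "t \<in> T'" for t
  proof -
    have "conj_by (inv g) t \<notin> inversions b"
      using T'_conj_W'[OF W'_inv[OF assms(3)] t] U_inversions assms(2) by blast
    moreover have "t \<notin> inversions (g \<otimes> b)"
      using U_inversions[OF assms(1) t] assms(4) by simp
    ultimately show ?thesis
      using assms(2,3) t by (simp add: inversions_mult)
  qed
  then have "g \<in> U" using assms(3) by (auto simp: U_def simp del: U_closed)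
  then show ?thesis using W'_inter_U assms by simp
qed

text \<open>A thick reflection among the inversions of \<open>w\<close> shortens \<open>w\<close>
  and can be absorbed into \<open>W'\<close>.\<close>

lemma decomposition:
  assumes "w \<in> carrier W"
  shows "\<exists>g\<in>W'. \<exists>u\<in>U. w = g \<otimes> u"
  using assms
proof (induction "len w" arbitrary: w rule: less_induct)
  case less
  show ?case
  proof (cases "w \<in> U")
    case True
    then show ?thesis using less.prems W'_one by force
  next
    case False
    then obtain t where t: "t \<in> inversions w" "t \<in> T'"
      using less.prems by (auto simp: U_def simp del: U_closed)
    then have "len (t \<otimes> w) < len w"
      using inversion_decreases_len less.prems by blast
    then obtain g u where gu: "g \<in> W'" "u \<in> U" "t \<otimes> w = g \<otimes> u"
      using less.hyps[of "t \<otimes> w"] less.prems t by auto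
    have "w = t \<otimes> (t \<otimes> w)"
      using T'_invol t less.prems by (simp flip: m_assoc)
    also have "\<dots> = t \<otimes> g \<otimes> u"
      using gu t by (simp add: m_assoc)
    finally show ?thesis
      using gu T'_subset_W'[OF t(2)] by blast
  qed
qed

section \<open>Positions of chambers modulo the reflection subgroup\<close>

lemma dist_base_adj:
  assumes "F \<in> Ch" "E \<in> Ch" "\<delta> F E = s" "s \<in> S"
  shows "\<delta> C\<^sub>0 E = \<delta> C\<^sub>0 F \<otimes> s \<or> conj_by (\<delta> C\<^sub>0 F) s \<in> T' \<and> \<delta> C\<^sub>0 E = \<delta> C\<^sub>0 F"
proof (cases "thick_panel (panel s F)")
  case True
  then show ?thesis
    using thick_panel_iff[of C\<^sub>0 F s] dist_adj[of C\<^sub>0 F E s] assms by auto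
next
  case False
  then have "(F, E) \<in> thin_adj"
    using assms by (simp add: thin_adj_iff)
  then show ?thesis
    using dist_thin_adj[of C\<^sub>0 F E] assms by simp
qed

text \<open>A step across a thick panel may leave the distance from \<open>C\<^sub>0\<close>
  unchanged instead of multiplying it by \<open>s\<close>. The two outcomes differ by the thick
  reflection \<open>conj_by (\<delta> C\<^sub>0 F) s\<close> on the left, so the accumulated defect
  stays in \<open>W'\<close>.\<close>

lemma dist_base_mod_W':
  assumes D: "D \<in> Ch" and E: "E \<in> Ch"
  shows "\<exists>g\<in>W'. \<delta> C\<^sub>0 E = g \<otimes> \<delta> C\<^sub>0 D \<otimes> \<delta> D E"
proof -
  have "\<forall>E\<in>Ch. \<delta> D E = x \<longrightarrow> (\<exists>g\<in>W'. \<delta> C\<^sub>0 E = g \<otimes> \<delta> C\<^sub>0 D \<otimes> x)"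
    if "x \<in> carrier W" for x
    using that
  proof (induction rule: right_induct)
    case one
    then show ?case using D WD1 W'_one by force
  next
    case (mult s x)
    show ?case
    proof (intro ballI impI)
      fix E assume E: "E \<in> Ch" "\<delta> D E = x \<otimes> s"
      obtain F where F: "F \<in> Ch" "\<delta> D F = x" "\<delta> F E = s"
        using ex_between[of x s D E] E D mult by auto
      then obtain g where g: "g \<in> W'" "\<delta> C\<^sub>0 F = g \<otimes> \<delta> C\<^sub>0 D \<otimes> x"
        using mult.IH by blast
      have cl: "\<delta> C\<^sub>0 D \<in> carrier W" "\<delta> C\<^sub>0 F \<in> carrier W" "s \<in> carrier W"
        using D F mult by auto
      show "\<exists>g\<in>W'. \<delta> C\<^sub>0 E = g \<otimes> \<delta> C\<^sub>0 D \<otimes> (x \<otimes> s)"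
        using dist_base_adj[OF F(1) E(1) F(3) mult(1)]
      proof
        assume "\<delta> C\<^sub>0 E = \<delta> C\<^sub>0 F \<otimes> s"
        then show ?thesis
          using g mult cl by (intro bexI[of _ g]) (simp_all add: m_assoc)
      next
        let ?r = "conj_by (\<delta> C\<^sub>0 F) s"
        assume *: "?r \<in> T' \<and> \<delta> C\<^sub>0 E = \<delta> C\<^sub>0 F"
        have "\<delta> C\<^sub>0 F = ?r \<otimes> \<delta> C\<^sub>0 F \<otimes> s"
          using cl mult(1) by (simp add: conj_by_def m_assoc gens_invol)
        also have "\<dots> = (?r \<otimes> g) \<otimes> \<delta> C\<^sub>0 D \<otimes> (x \<otimes> s)"
          using cl g mult by (simp add: g(2) m_assoc)
        finally show ?thesis
          using * g(1) T'_subset_W' by auto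
      qed
    qed
  qed
  then show ?thesis using D E by simp
qed

lemma dist_in_W':
  assumes "D \<in> Ch" "E \<in> Ch" "\<delta> C\<^sub>0 D \<in> W'" "\<delta> C\<^sub>0 E \<in> W'"
  shows "\<delta> D E \<in> W'"
proof -
  obtain g where g: "g \<in> W'" "\<delta> C\<^sub>0 E = g \<otimes> \<delta> C\<^sub>0 D \<otimes> \<delta> D E"
    using dist_base_mod_W' assms by blast
  then have "\<delta> D E = inv (g \<otimes> \<delta> C\<^sub>0 D) \<otimes> \<delta> C\<^sub>0 E"
    using assms by (simp add: inv_solve_left)
  also have "\<dots> \<in> W'" using g(1) assms by blast
  finally show ?thesis .
qed

lemma thick_refls_W':
  assumes "P \<in> Ch" "\<delta> C\<^sub>0 P \<in> W'"
  shows "thick_refls P = T'"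
proof (rule Set.set_eqI)
  fix t
  show "t \<in> thick_refls P \<longleftrightarrow> t \<in> T'"
    using thick_refls_conj_dist[of C\<^sub>0 P t] T'_conj_W'_iff[OF assms(2), of t] assms
      thick_refls_closed[OF assms(1), of t] T'_closed[of t] by auto
qed

lemma thin_equiv_iff_U:
  assumes "P \<in> Ch" "D \<in> Ch" "\<delta> C\<^sub>0 P \<in> W'"
  shows "(P, D) \<in> thin_equiv \<longleftrightarrow> \<delta> P D \<in> U"
  using thin_equiv_iff[OF assms(1,2)] thick_refls_W' assms by (simp add: U_def del: U_closed)

text \<open>With \<open>\<delta> C\<^sub>0 D = g u\<close>, take a chamber at position
  \<open>g\<close> and at distance \<open>u\<close> from \<open>D\<close>. From a position in
  \<open>W'\<close> the thick reflections are again \<open>T'\<close>, so \<open>u \<in> U\<close>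
  makes it thin-equivalent to \<open>D\<close>.\<close>

lemma ex_rep:
  assumes "D \<in> Ch"
  shows "\<exists>P. (D, P) \<in> thin_equiv \<and> \<delta> C\<^sub>0 P \<in> W'"
proof -
  obtain g u where gu: "g \<in> W'" "u \<in> U" "\<delta> C\<^sub>0 D = g \<otimes> u"
    using decomposition assms dist_carrier base_in_Ch by blast
  then obtain P where P: "P \<in> Ch" "\<delta> C\<^sub>0 P = g" "\<delta> P D = u"
    using ex_between[of g u C\<^sub>0 D] assms by auto
  then have "(P, D) \<in> thin_equiv"
    using thin_equiv_iff_U gu assms by simp
  then have "(D, P) \<in> thin_equiv" using equiv_thin by (meson equivE symD)
  then show ?thesis using P gu by blast
qed

lemma rep_unique:
  assumes "(P, Q) \<in> thin_equiv" "\<delta> C\<^sub>0 P \<in> W'" "\<delta> C\<^sub>0 Q \<in> W'"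
  shows "P = Q"
proof -
  have Ch: "P \<in> Ch" "Q \<in> Ch" using assms(1) by (simp_all add: thin_equiv_def)
  have "\<delta> P Q \<in> W'" "\<delta> P Q \<in> U"
    using dist_in_W'[OF Ch assms(2,3)] thin_equiv_iff_U[OF Ch assms(2)] assms(1) by simp_all
  then have "\<delta> P Q = \<one>" by (rule W'_inter_U)
  then show ?thesis using WD1 Ch by blast
qed

section \<open>Canonical chambers of thin classes\<close>

lemma thin_classesE:
  assumes "C' \<in> thin_classes" "D \<in> C'"
  shows "D \<in> Ch" "C' = thin_equiv `` {D}"
proof -
  obtain X where X: "C' = thin_equiv `` {X}"
    using assms(1) unfolding thin_classes_def by (rule quotientE)
  then have XD: "(X, D) \<in> thin_equiv" using assms(2) by blast
  then show "D \<in> Ch" by (simp add: thin_equiv_def)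
  show "C' = thin_equiv `` {D}"
    unfolding X by (rule equiv_class_eq[OF equiv_thin XD])
qed

definition rep :: "'c set \<Rightarrow> 'c" where
  "rep C' = frame_chamber C' \<one>"

lemma frame_dist_rep: "frame_dist C' D' = \<delta> (rep C') (rep D')"
  by (simp add: frame_dist_def rep_def)

text \<open>This frees the description of \<open>C'[1]\<close> from the choice of apartment. An
  apartment contains the whole thin class of each of its chambers, so any apartment through
  \<open>C\<^sub>0\<close> and \<open>D\<close> qualifies, and in it \<open>w\<close> moves
  \<open>C\<^sub>0\<close> to position \<open>w\<close>.\<close>

lemma in_frame_chamber_iff:
  assumes C': "C' \<in> thin_classes" and D: "D \<in> C'"
  shows "(\<exists>A. apartment A \<and> base_class \<subseteq> A \<and> C' \<subseteq> A \<and>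
       (\<exists>w \<in> carrier frame_group. D = act A w (chamber_at A\<^sub>0 \<one>))) \<longleftrightarrow> \<delta> C\<^sub>0 D \<in> W'"
proof
  note DC = thin_classesE[OF C' D]
  have act: "act A w (chamber_at A\<^sub>0 \<one>) = E"
    if A: "apartment A" "C\<^sub>0 \<in> A" and w: "w \<in> carrier W" and E: "E \<in> A" "\<delta> C\<^sub>0 E = w" for A w E
  proof -
    obtain \<alpha> where \<alpha>: "isometry \<alpha>" "A = \<alpha> ` carrier W" "\<alpha> \<one> = C\<^sub>0"
      using A by (rule apartment_isometry)
    have "act A w C\<^sub>0 = \<alpha> w"
      using chamber_at_isometry(2)[OF \<alpha>(1,3) w] \<alpha>(2) w by (simp add: act_def)
    moreover obtain v where "v \<in> carrier W" "E = \<alpha> v" using E \<alpha>(2) by auto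
    ultimately show ?thesis
      using chamber_at_isometry(1)[OF \<alpha>(1,3)] E(2) chamber_at_coord[OF one_closed] coord(3) by auto
  qed
  have base: "C\<^sub>0 \<in> base_class" by (auto simp: base_class_def thin_equiv_def)
  {
    assume "\<exists>A. apartment A \<and> base_class \<subseteq> A \<and> C' \<subseteq> A \<and>
       (\<exists>w \<in> carrier frame_group. D = act A w (chamber_at A\<^sub>0 \<one>))"
    then obtain A w where A: "apartment A" "base_class \<subseteq> A" "C' \<subseteq> A"
      and w: "w \<in> W'" "D = act A w (chamber_at A\<^sub>0 \<one>)"
      unfolding carrier_frame_group by blast
    have C0A: "C\<^sub>0 \<in> A" using A base by blast
    obtain \<alpha> where \<alpha>: "isometry \<alpha>" "A = \<alpha> ` carrier W" "\<alpha> \<one> = C\<^sub>0"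
      using A(1) C0A by (rule apartment_isometry)
    have "D = \<alpha> w"
      using act[OF A(1) C0A, of w "\<alpha> w"] w chamber_at_isometry(1)[OF \<alpha>(1,3)] \<alpha>(2) by simp
    then show "\<delta> C\<^sub>0 D \<in> W'"
      using chamber_at_isometry(1)[OF \<alpha>(1,3)] w by simp
  }
  assume w: "\<delta> C\<^sub>0 D \<in> W'"
  obtain A where A: "apartment A" "C\<^sub>0 \<in> A" "D \<in> A"
    using ex_apartment[OF base_in_Ch DC(1)] by blast
  have "base_class \<subseteq> A" "C' \<subseteq> A"
    using thin_class_subset_apartment[OF A(1)] A(2,3) DC(2) by (auto simp: base_class_def)
  moreover have "D = act A (\<delta> C\<^sub>0 D) (chamber_at A\<^sub>0 \<one>)"
    using act[OF A(1,2) _ A(3) HOL.refl] DC(1) by simp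
  ultimately show "\<exists>A. apartment A \<and> base_class \<subseteq> A \<and> C' \<subseteq> A \<and>
       (\<exists>w \<in> carrier frame_group. D = act A w (chamber_at A\<^sub>0 \<one>))"
    unfolding carrier_frame_group using A(1) w by blast
qed

lemma rep_eqI:
  assumes C': "C' \<in> thin_classes" and P: "P \<in> C'" "\<delta> C\<^sub>0 P \<in> W'"
  shows "rep C' = P"
  unfolding rep_def frame_chamber_def
proof (rule the_equality)
  show "P \<in> C' \<and> (\<exists>A. apartment A \<and> base_class \<subseteq> A \<and> C' \<subseteq> A \<and>
       (\<exists>w \<in> carrier frame_group. P = act A w (chamber_at A\<^sub>0 \<one>)))"
    using P in_frame_chamber_iff[OF C' P(1)] by blast
next
  fix D assume D: "D \<in> C' \<and> (\<exists>A. apartment A \<and> base_class \<subseteq> A \<and> C' \<subseteq> A \<and>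
       (\<exists>w \<in> carrier frame_group. D = act A w (chamber_at A\<^sub>0 \<one>)))"
  then have "\<delta> C\<^sub>0 D \<in> W'" using in_frame_chamber_iff[OF C'] by blast
  moreover have "(D, P) \<in> thin_equiv" using thin_classesE(2)[OF C', of D] P D by auto
  ultimately show "D = P" using rep_unique P by blast
qed

lemma rep:
  assumes C': "C' \<in> thin_classes"
  shows "rep C' \<in> C'" "rep C' \<in> Ch" "\<delta> C\<^sub>0 (rep C') \<in> W'"
proof -
  obtain D where D: "D \<in> C'"
    using C' equiv_thin unfolding thin_classes_def by (metis equals0I in_quotient_imp_non_empty)
  obtain P where P: "(D, P) \<in> thin_equiv" "\<delta> C\<^sub>0 P \<in> W'"
    using ex_rep thin_classesE(1)[OF C' D] by blast
  then have "P \<in> C'" using thin_classesE(2)[OF C' D] by blast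
  then have "rep C' = P" using rep_eqI C' P by blast
  then show "rep C' \<in> C'" "rep C' \<in> Ch" "\<delta> C\<^sub>0 (rep C') \<in> W'"
    using P \<open>P \<in> C'\<close> thin_classesE(1)[OF C'] by auto
qed

lemma rep_thin_equiv:
  assumes "C' \<in> thin_classes" "D \<in> C'"
  shows "(rep C', D) \<in> thin_equiv"
  using thin_classesE(2)[OF assms(1) rep(1)[OF assms(1)]] assms(2) by auto

lemma thin_class_in: "D \<in> Ch \<Longrightarrow> thin_equiv `` {D} \<in> thin_classes" "D \<in> Ch \<Longrightarrow> D \<in> thin_equiv `` {D}"
  by (simp_all add: thin_classes_def quotientI, simp add: thin_equiv_def)

lemma frame_dist_in_W':
  "\<lbrakk>C' \<in> thin_classes; D' \<in> thin_classes\<rbrakk> \<Longrightarrow> frame_dist C' D' \<in> W'"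
  unfolding frame_dist_rep using dist_in_W' rep by blast

end


section \<open>Automorphisms of the thick frame\<close>

lemma iso_ord:
  assumes "group G" "group H" "h \<in> iso G H" "x \<in> carrier G"
  shows "group.ord H (h x) = group.ord G x"
proof -
  interpret G: group G by fact
  interpret H: group H by fact
  have hom: "h \<in> hom G H" and inj: "inj_on h (carrier G)"
    using assms(3) by (auto simp: iso_def bij_betw_def)
  have "h x [^]\<^bsub>H\<^esub> (n::nat) = \<one>\<^bsub>H\<^esub> \<longleftrightarrow> x [^]\<^bsub>G\<^esub> n = \<one>\<^bsub>G\<^esub>" for n
  proof -
    have "h x [^]\<^bsub>H\<^esub> n = h (x [^]\<^bsub>G\<^esub> n)"
      by (rule hom_nat_pow[OF hom assms(4,1,2), symmetric])
    moreover have "h \<one>\<^bsub>G\<^esub> = \<one>\<^bsub>H\<^esub>"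
      by (rule hom_one[OF hom assms(1,2)])
    moreover have "h (x [^]\<^bsub>G\<^esub> n) = h \<one>\<^bsub>G\<^esub> \<longleftrightarrow> x [^]\<^bsub>G\<^esub> n = \<one>\<^bsub>G\<^esub>"
      using assms(4) by (intro inj_on_eq_iff[OF inj]) simp_all
    ultimately show ?thesis by simp
  qed
  then show ?thesis by (simp add: G.ord_def H.ord_def)
qed

locale frame_automorphism = thick_frame W S Ch \<delta> A\<^sub>0 C\<^sub>0
  for W :: "('w, 'm) monoid_scheme" (structure) and S :: "'w set"
    and Ch :: "'c set" and \<delta> :: "'c \<Rightarrow> 'c \<Rightarrow> 'w" and A\<^sub>0 C\<^sub>0 +
  fixes \<theta> :: "'c \<Rightarrow> 'c" and \<sigma> :: "'w \<Rightarrow> 'w"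
  assumes bij: "bij_betw \<theta> Ch Ch"
    and comp: "companion W S Ch \<delta> \<theta> \<sigma>"
begin

section \<open>Action on distances, thick walls and thin classes\<close>

lemma \<theta>_closed [simp]: "C \<in> Ch \<Longrightarrow> \<theta> C \<in> Ch"
  using bij by (rule bij_betwE[rule_format])

lemma \<theta>_surj: "E \<in> Ch \<Longrightarrow> \<exists>D\<in>Ch. E = \<theta> D"
  using bij unfolding bij_betw_def by blast

lemma \<sigma>_hom: "\<sigma> \<in> hom W W"
  using comp by (simp add: companion_def iso_def)

lemma \<sigma>_bij: "bij_betw \<sigma> (carrier W) (carrier W)"
  using comp by (simp add: companion_def iso_def)

lemma \<sigma>_closed [simp]: "x \<in> carrier W \<Longrightarrow> \<sigma> x \<in> carrier W"
  using \<sigma>_bij by (rule bij_betwE[rule_format])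

lemma \<sigma>_mult [simp]: "\<lbrakk>x \<in> carrier W; y \<in> carrier W\<rbrakk> \<Longrightarrow> \<sigma> (x \<otimes> y) = \<sigma> x \<otimes> \<sigma> y"
  by (rule hom_mult[OF \<sigma>_hom])

lemma \<sigma>_one [simp]: "\<sigma> \<one> = \<one>"
  by (rule hom_one[OF \<sigma>_hom group_axioms group_axioms])

lemma \<sigma>_inv [simp]:
  assumes "x \<in> carrier W"
  shows "\<sigma> (inv x) = inv (\<sigma> x)"
proof -
  have "\<sigma> (inv x) \<otimes> \<sigma> x = \<one>"
    using \<sigma>_mult[of "inv x" x] assms by simp
  then show ?thesis
    using assms by (simp add: inv_equality)
qed

lemma \<sigma>_conj: "\<lbrakk>x \<in> carrier W; t \<in> carrier W\<rbrakk> \<Longrightarrow> \<sigma> (conj_by x t) = conj_by (\<sigma> x) (\<sigma> t)"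
  by (simp add: conj_by_def)

lemma \<sigma>_eq_iff: "\<lbrakk>x \<in> carrier W; y \<in> carrier W\<rbrakk> \<Longrightarrow> \<sigma> x = \<sigma> y \<longleftrightarrow> x = y"
  using \<sigma>_bij by (auto simp: bij_betw_def inj_on_def)

lemma \<sigma>_surj: "y \<in> carrier W \<Longrightarrow> \<exists>x\<in>carrier W. y = \<sigma> x"
  using \<sigma>_bij unfolding bij_betw_def by blast

lemma \<sigma>_bij_gens: "bij_betw \<sigma> S S"
  using comp by (simp add: companion_def coxeter_graph_aut_def)

lemma \<sigma>_gen [simp]: "s \<in> S \<Longrightarrow> \<sigma> s \<in> S"
  using \<sigma>_bij_gens by (rule bij_betwE[rule_format])

lemma \<sigma>_gen_surj: "s \<in> S \<Longrightarrow> \<exists>r\<in>S. s = \<sigma> r"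
  using \<sigma>_bij_gens unfolding bij_betw_def by blast

lemma dist_\<theta>_gen: "\<lbrakk>C \<in> Ch; D \<in> Ch; s \<in> S; \<delta> C D = s\<rbrakk> \<Longrightarrow> \<delta> (\<theta> C) (\<theta> D) = \<sigma> s"
  using comp by (simp add: companion_def)

text \<open>\<open>\<sigma>\<close> permutes \<open>S\<close> and respects conjugation, hence
  respects the recursion that computes inversions.\<close>

lemma inversions_\<sigma>:
  assumes "w \<in> carrier W" "t \<in> carrier W"
  shows "\<sigma> t \<in> inversions (\<sigma> w) \<longleftrightarrow> t \<in> inversions w"
  using assms
proof (induction w arbitrary: t rule: left_induct)
  case (mult s w)
  have "\<sigma> t \<in> inversions (\<sigma> (s \<otimes> w)) \<longleftrightarrow> (\<sigma> t = \<sigma> s) \<noteq> (conj_by (\<sigma> s) (\<sigma> t) \<in> inversions (\<sigma> w))"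
    using mult(1,2,5) by (simp add: inversions_gen_mult)
  also have "conj_by (\<sigma> s) (\<sigma> t) = \<sigma> (conj_by s t)"
    using mult(1,5) by (simp add: \<sigma>_conj)
  also have "(\<sigma> t = \<sigma> s) = (t = s)"
    using mult(1,5) by (simp add: \<sigma>_eq_iff)
  also have "\<sigma> (conj_by s t) \<in> inversions (\<sigma> w) \<longleftrightarrow> conj_by s t \<in> inversions w"
    using mult(1,5) by (intro mult.IH) simp
  finally show ?case
    using mult(1,2,5) by (simp add: inversions_gen_mult)
qed simp

lemma even_len_\<sigma>: "w \<in> carrier W \<Longrightarrow> even (len (\<sigma> w)) \<longleftrightarrow> even (len w)"
proof (induction rule: left_induct)
  case (mult s w)
  then show ?case
    using even_len_mult[of s w] even_len_mult[of "\<sigma> s" "\<sigma> w"] odd_len_gen[of s] odd_len_gen[of "\<sigma> s"]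
    by simp
qed simp

text \<open>\<open>companion\<close> speaks only of adjacent chambers. A reduced gallery is mapped
  to a reduced one because \<open>\<sigma>\<close> preserves inversions, so distances multiply in
  the image as well.\<close>

lemma dist_\<theta>:
  assumes "C \<in> Ch" "D \<in> Ch"
  shows "\<delta> (\<theta> C) (\<theta> D) = \<sigma> (\<delta> C D)"
proof -
  have "\<forall>C\<in>Ch. \<delta> C D = x \<longrightarrow> \<delta> (\<theta> C) (\<theta> D) = \<sigma> x" if "x \<in> carrier W" for x
    using that
  proof (induction rule: left_induct)
    case one
    then show ?case using assms(2) WD1 by auto
  next
    case (mult s x)
    show ?case
    proof (intro ballI impI)
      fix C assume C: "C \<in> Ch" "\<delta> C D = s \<otimes> x"
      obtain B where B: "B \<in> Ch" "\<delta> C B = s" "\<delta> B D = x"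
        using ex_between[of s x C D] C assms(2) mult by auto
      have "\<delta> (\<theta> B) (\<theta> D) = \<sigma> x" using mult.IH B by blast
      moreover have "\<sigma> s \<notin> inversions (\<sigma> x)"
        using inversions_\<sigma>[of x s] mult by simp
      ultimately have "\<delta> (\<theta> C) (\<theta> D) = \<sigma> s \<otimes> \<sigma> x"
        using dist_gen_mult[of "\<theta> C" "\<theta> B" "\<theta> D" "\<sigma> s"] dist_\<theta>_gen[OF C(1) B(1) mult(1) B(2)]
          C B(1) assms(2) mult(1) by simp
      then show "\<delta> (\<theta> C) (\<theta> D) = \<sigma> (s \<otimes> x)" using mult(1,2) by simp
    qed
  qed
  then show ?thesis using assms by simp
qed

lemma image_panel:
  assumes "C \<in> Ch" "s \<in> S"
  shows "\<theta> ` panel s C = panel (\<sigma> s) (\<theta> C)"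
proof -
  have *: "\<theta> D \<in> panel (\<sigma> s) (\<theta> C) \<longleftrightarrow> D \<in> panel s C" if "D \<in> Ch" for D
    using dist_\<theta>[OF assms(1) that] \<sigma>_eq_iff[of "\<delta> C D" s] \<sigma>_eq_iff[of "\<delta> C D" \<one>] assms that
    by (simp add: panel_def)
  show ?thesis
  proof (intro subset_antisym subsetI)
    fix E assume "E \<in> \<theta> ` panel s C"
    then obtain D where "D \<in> panel s C" "E = \<theta> D" by blast
    moreover from this have "D \<in> Ch" by (simp add: panel_def)
    ultimately show "E \<in> panel (\<sigma> s) (\<theta> C)" using * by simp
  next
    fix E assume E: "E \<in> panel (\<sigma> s) (\<theta> C)"
    then have "E \<in> Ch" by (simp add: panel_def)
    then obtain D where "D \<in> Ch" "E = \<theta> D" using \<theta>_surj by blast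
    then show "E \<in> \<theta> ` panel s C" using * E by blast
  qed
qed

lemma thick_panel_\<theta>:
  assumes "C \<in> Ch" "s \<in> S"
  shows "thick_panel (panel (\<sigma> s) (\<theta> C)) \<longleftrightarrow> thick_panel (panel s C)"
proof -
  have "panel s C \<subseteq> Ch" by (auto simp: panel_def)
  then have inj: "inj_on \<theta> (panel s C)"
    using bij unfolding bij_betw_def by (metis inj_on_subset)
  have "thick_panel (panel s C)" if "thick_panel (\<theta> ` panel s C)"
    using thick_panel_inj_on[OF that inj_on_inv_into[OF subset_refl]]
      inv_into_image_cancel[OF inj subset_refl] by simp
  then show ?thesis
    using thick_panel_inj_on[OF _ inj] unfolding image_panel[OF assms, symmetric] by blast
qed

lemma thick_refls_\<theta>:
  assumes C: "C \<in> Ch" and t: "t \<in> carrier W"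
  shows "\<sigma> t \<in> thick_refls (\<theta> C) \<longleftrightarrow> t \<in> thick_refls C"
proof
  assume "t \<in> thick_refls C"
  then obtain D s where D: "D \<in> Ch" "s \<in> S" "thick_panel (panel s D)" "t = conj_by (\<delta> C D) s"
    by (auto simp: thick_refls_def)
  then have "\<sigma> t = conj_by (\<delta> (\<theta> C) (\<theta> D)) (\<sigma> s)"
    using C by (simp add: \<sigma>_conj dist_\<theta>)
  then show "\<sigma> t \<in> thick_refls (\<theta> C)"
    using thick_reflsI[of "\<theta> D" "\<sigma> s" "\<theta> C"] D thick_panel_\<theta> by simp
next
  assume "\<sigma> t \<in> thick_refls (\<theta> C)"
  then obtain E r where E: "E \<in> Ch" "r \<in> S" "thick_panel (panel r E)" "\<sigma> t = conj_by (\<delta> (\<theta> C) E) r"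
    by (auto simp: thick_refls_def)
  obtain D s where D: "D \<in> Ch" "E = \<theta> D" "s \<in> S" "r = \<sigma> s"
    using \<theta>_surj[OF E(1)] \<sigma>_gen_surj[OF E(2)] by blast
  then have "\<sigma> t = \<sigma> (conj_by (\<delta> C D) s)"
    using E(4) C by (simp add: \<sigma>_conj dist_\<theta>)
  then have "t = conj_by (\<delta> C D) s"
    using t C D by (simp add: \<sigma>_eq_iff)
  then show "t \<in> thick_refls C"
    using thick_reflsI[of D s C] D E(3) thick_panel_\<theta> by simp
qed

lemma thin_equiv_\<theta>:
  assumes "C \<in> Ch" "D \<in> Ch"
  shows "(\<theta> C, \<theta> D) \<in> thin_equiv \<longleftrightarrow> (C, D) \<in> thin_equiv"
proof -
  have "inversions (\<sigma> (\<delta> C D)) \<inter> thick_refls (\<theta> C) = \<sigma> ` (inversions (\<delta> C D) \<inter> thick_refls C)"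
  proof (intro subset_antisym subsetI)
    fix x assume x: "x \<in> inversions (\<sigma> (\<delta> C D)) \<inter> thick_refls (\<theta> C)"
    then have "x \<in> carrier W" using inversions_closed by blast
    then obtain t where "t \<in> carrier W" "x = \<sigma> t" using \<sigma>_surj by blast
    then show "x \<in> \<sigma> ` (inversions (\<delta> C D) \<inter> thick_refls C)"
      using x inversions_\<sigma>[of "\<delta> C D" t] thick_refls_\<theta>[of C t] assms by simp
  next
    fix x assume "x \<in> \<sigma> ` (inversions (\<delta> C D) \<inter> thick_refls C)"
    then obtain t where t: "t \<in> inversions (\<delta> C D)" "t \<in> thick_refls C" "x = \<sigma> t" by blast
    moreover from t(1) have "t \<in> carrier W" by (rule inversions_closed)
    ultimately show "x \<in> inversions (\<sigma> (\<delta> C D)) \<inter> thick_refls (\<theta> C)"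
      using inversions_\<sigma>[of "\<delta> C D" t] thick_refls_\<theta>[of C t] assms by simp
  qed
  then show ?thesis
    using thin_equiv_iff[OF assms] thin_equiv_iff[of "\<theta> C" "\<theta> D"] dist_\<theta>[OF assms] assms by simp
qed

lemma image_thin_class:
  assumes "D \<in> Ch"
  shows "\<theta> ` (thin_equiv `` {D}) = thin_equiv `` {\<theta> D}"
proof (intro subset_antisym subsetI)
  fix E assume "E \<in> \<theta> ` (thin_equiv `` {D})"
  then obtain F where F: "(D, F) \<in> thin_equiv" "E = \<theta> F" by blast
  then have "F \<in> Ch" by (simp add: thin_equiv_def)
  then show "E \<in> thin_equiv `` {\<theta> D}" using thin_equiv_\<theta>[OF assms] F by simp
next
  fix E assume E: "E \<in> thin_equiv `` {\<theta> D}"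
  then have "E \<in> Ch" by (simp add: thin_equiv_def)
  then obtain F where "F \<in> Ch" "E = \<theta> F" using \<theta>_surj by blast
  then show "E \<in> \<theta> ` (thin_equiv `` {D})" using thin_equiv_\<theta>[OF assms] E by auto
qed

lemma image_thin_classes:
  assumes "C' \<in> thin_classes"
  shows "\<theta> ` C' \<in> thin_classes"
proof -
  have "C' = thin_equiv `` {rep C'}"
    using thin_classesE(2)[OF assms] rep(1)[OF assms] by blast
  then have "\<theta> ` C' = thin_equiv `` {\<theta> (rep C')}"
    using image_thin_class[OF rep(2)[OF assms]] by simp
  then show ?thesis using thin_class_in(1) rep(2)[OF assms] by simp
qed

text \<open>The element \<open>u \<in> U\<close> with \<open>\<theta>(C'[1]) = (\<theta>' C')[u]\<close>.\<close>

definition twist :: "'c set \<Rightarrow> 'w" where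
  "twist C' = \<delta> (rep (\<theta> ` C')) (\<theta> (rep C'))"

lemma rep_\<theta>_thin_equiv:
  assumes "C' \<in> thin_classes"
  shows "(rep (\<theta> ` C'), \<theta> (rep C')) \<in> thin_equiv"
  using rep_thin_equiv[OF image_thin_classes] rep(1) assms by blast

lemma twist_in_U:
  assumes "C' \<in> thin_classes"
  shows "twist C' \<in> U"
  using thin_equiv_iff_U[of "rep (\<theta> ` C')" "\<theta> (rep C')"] rep_\<theta>_thin_equiv[OF assms]
    rep[OF image_thin_classes[OF assms]] rep(2)[OF assms]
  by (simp add: twist_def)

lemma twist_conj_T':
  assumes C': "C' \<in> thin_classes" and t: "t \<in> carrier W"
  shows "conj_by (twist C') (\<sigma> t) \<in> T' \<longleftrightarrow> t \<in> T'"
proof -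
  let ?P = "rep C'" and ?Q = "rep (\<theta> ` C')"
  have P: "?P \<in> Ch" "thick_refls ?P = T'" and Q: "?Q \<in> Ch" "thick_refls ?Q = T'"
    using thick_refls_W' rep[OF C'] rep[OF image_thin_classes[OF C']] by auto
  have "\<sigma> t \<in> thick_refls (\<theta> ?P) \<longleftrightarrow> conj_by (twist C') (\<sigma> t) \<in> thick_refls ?Q"
    unfolding twist_def using P Q t by (intro thick_refls_conj_dist) simp_all
  then show ?thesis
    using thick_refls_\<theta>[OF P(1) t] P Q by simp
qed

lemma twist_conj_W':
  assumes C': "C' \<in> thin_classes" and g: "g \<in> W'"
  shows "conj_by (twist C') (\<sigma> g) \<in> W'"
proof -
  have a: "twist C' \<in> carrier W" using twist_in_U[OF C'] by simp
  have T: "conj_by (twist C') (\<sigma> t) \<in> W'" if "t \<in> T'" for t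
    using twist_conj_T'[OF C', of t] that T'_subset_W' by simp
  show ?thesis
    using g unfolding W'_def
  proof (induction rule: generate.induct)
    case one
    show ?case using a W'_one by (simp add: W'_def)
  next
    case (incl t)
    then show ?case using T by (simp add: W'_def)
  next
    case (inv t)
    then show ?case using T by (simp add: W'_def T'_inv)
  next
    case (eng g h)
    then have "g \<in> carrier W" "h \<in> carrier W"
      using W'_closed by (simp_all add: W'_def)
    then show ?case
      using eng a generate.eng by (simp add: conj_mult)
  qed
qed

text \<open>Thin steps contribute their full type at either end of a gallery, so the distance
  factors as it would inside an apartment.\<close>

lemma dist_thin_equiv_both:
  assumes "(C, D) \<in> thin_equiv" "(E, F) \<in> thin_equiv"
  shows "\<delta> C F = \<delta> C D \<otimes> \<delta> D E \<otimes> \<delta> E F"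
proof -
  have Ch: "C \<in> Ch" "D \<in> Ch" "E \<in> Ch" "F \<in> Ch"
    using assms by (simp_all add: thin_equiv_def)
  have "(D, C) \<in> thin_equiv" using assms(1) equiv_thin by (meson equivE symD)
  then have "\<delta> E C = \<delta> E D \<otimes> \<delta> D C" using dist_thin_equiv Ch by blast
  then have "inv (\<delta> E C) = inv (\<delta> D C) \<otimes> inv (\<delta> E D)"
    using Ch by (simp add: inv_mult_group)
  then have "\<delta> C E = \<delta> C D \<otimes> \<delta> D E"
    using dist_inv[of E C] dist_inv[of D C] dist_inv[of E D] Ch by simp
  then show ?thesis using dist_thin_equiv[OF Ch(1) assms(2)] by simp
qed

lemma frame_dist_\<theta>_twist:
  assumes C': "C' \<in> thin_classes" and D': "D' \<in> thin_classes"
  shows "frame_dist (\<theta> ` C') (\<theta> ` D') = twist C' \<otimes> \<sigma> (frame_dist C' D') \<otimes> inv (twist D')"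
proof -
  let ?P = "rep C'" and ?Q = "rep D'" and ?P' = "rep (\<theta> ` C')" and ?Q' = "rep (\<theta> ` D')"
  have Ch: "?P \<in> Ch" "?Q \<in> Ch" "?P' \<in> Ch" "?Q' \<in> Ch"
    using rep(2) C' D' image_thin_classes by auto
  have "(\<theta> ?Q, ?Q') \<in> thin_equiv"
    using rep_\<theta>_thin_equiv[OF D'] equiv_thin by (meson equivE symD)
  then have "\<delta> ?P' ?Q' = twist C' \<otimes> \<delta> (\<theta> ?P) (\<theta> ?Q) \<otimes> \<delta> (\<theta> ?Q) ?Q'"
    unfolding twist_def by (rule dist_thin_equiv_both[OF rep_\<theta>_thin_equiv[OF C']])
  moreover have "\<delta> (\<theta> ?Q) ?Q' = inv (twist D')"
    unfolding twist_def using dist_inv[OF Ch(4) \<theta>_closed[OF Ch(2)]] .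
  ultimately show ?thesis
    using dist_\<theta>[OF Ch(1,2)] by (simp add: frame_dist_rep)
qed

lemma twist_constant:
  assumes C': "C' \<in> thin_classes" and D': "D' \<in> thin_classes"
  shows "twist C' = twist D'"
proof -
  let ?x = "frame_dist C' D'" and ?a = "twist C'" and ?b = "twist D'"
  let ?h = "conj_by ?a (\<sigma> ?x)" and ?y = "frame_dist (\<theta> ` C') (\<theta> ` D')"
  have x: "?x \<in> W'" "?y \<in> W'"
    using frame_dist_in_W' C' D' image_thin_classes by blast+
  have h: "?h \<in> W'" using twist_conj_W'[OF C' x(1)] .
  have ab: "?a \<in> U" "?b \<in> U" using twist_in_U C' D' by auto
  have cl: "?a \<in> carrier W" "?b \<in> carrier W" "\<sigma> ?x \<in> carrier W" using ab x by auto
  \<comment> \<open>The first factor is in \<open>W'\<close> because \<open>\<sigma>\<close>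
    followed by conjugation with the twist preserves \<open>W'\<close>; the second is the frame
    distance of the images. So \<open>?a\<close> and \<open>?b\<close> differ by an element of
    \<open>W'\<close>.\<close>
  have "?a = inv (?a \<otimes> \<sigma> ?x \<otimes> inv ?a) \<otimes> (?a \<otimes> \<sigma> ?x \<otimes> inv ?b) \<otimes> ?b"
    using cl by (simp add: inv_mult_group m_assoc)
  then have "?a = inv ?h \<otimes> ?y \<otimes> ?b"
    using frame_dist_\<theta>_twist[OF C' D'] by (simp add: conj_by_def)
  moreover have "inv ?h \<otimes> ?y \<in> W'" using h x by blast
  ultimately show ?thesis using U_unique ab by blast
qed

lemma base_class_thin: "base_class \<in> thin_classes"
  using thin_class_in(1)[OF base_in_Ch] by (simp add: base_class_def)

lemma rep_base_class: "rep base_class = C\<^sub>0"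
  using rep_eqI[OF base_class_thin] thin_class_in(2)[OF base_in_Ch] W'_one
  by (simp add: base_class_def)

section \<open>The companion of the induced automorphism\<close>

definition a :: 'w where
  "a = twist base_class"

lemma twist_eq_a: "C' \<in> thin_classes \<Longrightarrow> twist C' = a"
  unfolding a_def by (rule twist_constant[OF _ base_class_thin])

lemma a_in_U: "a \<in> U"
  unfolding a_def by (rule twist_in_U[OF base_class_thin])

lemma a_closed [simp]: "a \<in> carrier W"
  using a_in_U by simp

definition \<sigma>' :: "'w \<Rightarrow> 'w" where
  "\<sigma>' x = conj_by a (\<sigma> x)"

lemma \<sigma>'_T'_iff: "t \<in> carrier W \<Longrightarrow> \<sigma>' t \<in> T' \<longleftrightarrow> t \<in> T'"
  unfolding \<sigma>'_def a_def by (rule twist_conj_T'[OF base_class_thin])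

lemma \<sigma>'_W': "g \<in> W' \<Longrightarrow> \<sigma>' g \<in> W'"
  unfolding \<sigma>'_def a_def by (rule twist_conj_W'[OF base_class_thin])

lemma \<sigma>'_mult: "\<lbrakk>x \<in> carrier W; y \<in> carrier W\<rbrakk> \<Longrightarrow> \<sigma>' (x \<otimes> y) = \<sigma>' x \<otimes> \<sigma>' y"
  by (simp add: \<sigma>'_def conj_mult)

lemma \<sigma>'_eq_iff: "\<lbrakk>x \<in> carrier W; y \<in> carrier W\<rbrakk> \<Longrightarrow> \<sigma>' x = \<sigma>' y \<longleftrightarrow> x = y"
  by (simp add: \<sigma>'_def conj_eq_iff \<sigma>_eq_iff)

lemma frame_dist_\<theta>:
  assumes C': "C' \<in> thin_classes" and D': "D' \<in> thin_classes"
  shows "frame_dist (\<theta> ` C') (\<theta> ` D') = \<sigma>' (frame_dist C' D')"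
  using frame_dist_\<theta>_twist[OF assms] by (simp add: twist_eq_a[OF C'] twist_eq_a[OF D'] \<sigma>'_def conj_by_def)

text \<open>A thick inversion of \<open>a \<sigma>(u)\<close> would come from
  \<open>\<sigma>(u)\<close>, as \<open>a\<close> has none, and pull back along
  \<open>\<sigma>'\<close> to a thick inversion of \<open>u\<close>. This is what lets
  \<open>\<sigma>'\<close> carry walls of the base class to walls of the base class.\<close>

lemma a_\<sigma>_U:
  assumes u: "u \<in> U"
  shows "a \<otimes> \<sigma> u \<in> U"
proof -
  have "t \<notin> inversions (a \<otimes> \<sigma> u)" if t: "t \<in> T'" for t
  proof
    assume "t \<in> inversions (a \<otimes> \<sigma> u)"
    then have n: "conj_by (inv a) t \<in> inversions (\<sigma> u)"
      using U_inversions[OF a_in_U t] t u by (simp add: inversions_mult)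
    have "conj_by (inv a) t \<in> carrier W" using t by simp
    then obtain x where x: "x \<in> carrier W" "conj_by (inv a) t = \<sigma> x"
      using \<sigma>_surj by blast
    have "t = conj_by a (conj_by (inv a) t)" using t by simp
    then have "t = \<sigma>' x" unfolding x(2) by (simp add: \<sigma>'_def)
    then have "x \<in> T'" using \<sigma>'_T'_iff x(1) t by simp
    moreover have "x \<in> inversions u"
      using n x inversions_\<sigma>[of u x] u by simp
    ultimately show False using U_inversions u by blast
  qed
  then show ?thesis using u by (auto simp: U_def simp del: U_closed)
qed

lemma \<sigma>'_walls_base:
  assumes "r \<in> walls_base"
  shows "\<sigma>' r \<in> walls_base"
proof -
  obtain u s where us: "u \<in> U" "s \<in> S" "conj_by u s \<in> T'" "r = conj_by u s"
    using assms by (auto simp: walls_base_def)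
  then have "\<sigma>' r = conj_by (a \<otimes> \<sigma> u) (\<sigma> s)"
    by (simp add: \<sigma>'_def \<sigma>_conj conj_conj)
  moreover have "\<sigma>' r \<in> T'"
    using \<sigma>'_T'_iff us by simp
  ultimately show ?thesis
    using a_\<sigma>_U[OF us(1)] \<sigma>_gen[OF us(2)] unfolding walls_base_def by auto
qed

lemma finite_W': "finite W'"
  using spherical subgroup.subset[OF subgroup_W'] by (rule rev_finite_subset)

lemma inj_\<sigma>': "inj_on \<sigma>' (carrier W)"
  by (rule inj_onI) (simp add: \<sigma>'_eq_iff)

text \<open>Finiteness turns stability and injectivity into bijectivity; applied to
  \<open>W'\<close> and to \<open>walls_base\<close>.\<close>

lemma \<sigma>'_bij:
  assumes "M \<subseteq> W'" "\<And>x. x \<in> M \<Longrightarrow> \<sigma>' x \<in> M"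
  shows "bij_betw \<sigma>' M M"
proof -
  have inj: "inj_on \<sigma>' M"
    using inj_on_subset[OF inj_\<sigma>'] subgroup.subset[OF subgroup_W'] assms(1) by blast
  have "finite M" using finite_subset[OF assms(1) finite_W'] .
  moreover have "\<sigma>' ` M \<subseteq> M" using assms(2) by blast
  ultimately have "\<sigma>' ` M = M" using endo_inj_surj inj by blast
  with inj show ?thesis by (simp add: bij_betw_def)
qed

lemma group_frame_group: "group frame_group"
  using subgroup_imp_group[OF subgroup_W'] carrier_frame_group
  by (simp add: frame_group_def)

lemma mult_frame_group [simp]: "x \<otimes>\<^bsub>frame_group\<^esub> y = x \<otimes> y"
  by (simp add: frame_group_def)

lemma one_frame_group [simp]: "\<one>\<^bsub>frame_group\<^esub> = \<one>"
  by (simp add: frame_group_def)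

lemma inv_frame_group:
  assumes "x \<in> W'"
  shows "inv\<^bsub>frame_group\<^esub> x = inv x"
  using m_inv_consistent[OF subgroup_W' assms] carrier_frame_group by (simp add: frame_group_def)

lemma walls_base_subset_W': "walls_base \<subseteq> W'"
  using walls_base_subset T'_subset_W' by blast

lemma companion_frame:
  "companion frame_group frame_gens thin_classes frame_dist (\<lambda>C'. \<theta> ` C') \<sigma>'"
proof -
  have iso: "\<sigma>' \<in> iso frame_group frame_group"
    using \<sigma>'_bij[OF subset_refl \<sigma>'_W'] \<sigma>'_W' \<sigma>'_mult
    by (auto simp: iso_def hom_def carrier_frame_group)
  have "coxeter_m frame_group (\<sigma>' s) (\<sigma>' t) = coxeter_m frame_group s t"
    if "s \<in> walls_base" "t \<in> walls_base" for s t
  proof -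
    have st: "s \<in> W'" "t \<in> W'" using that walls_base_subset_W' by auto
    then have "\<sigma>' s \<otimes> \<sigma>' t = \<sigma>' (s \<otimes> t)" by (simp add: \<sigma>'_mult)
    moreover have "s \<otimes> t \<in> carrier frame_group" using st carrier_frame_group by blast
    ultimately show ?thesis
      using iso_ord[OF group_frame_group group_frame_group iso] by (simp add: coxeter_m_def)
  qed
  moreover have "bij_betw \<sigma>' walls_base walls_base"
    by (rule \<sigma>'_bij[OF walls_base_subset_W' \<sigma>'_walls_base])
  ultimately have "coxeter_graph_aut frame_group frame_gens \<sigma>'"
    by (simp add: coxeter_graph_aut_def frame_gens_eq)
  moreover have "frame_dist C' D' = s \<longleftrightarrow> frame_dist (\<theta> ` C') (\<theta> ` D') = \<sigma>' s"
    if "C' \<in> thin_classes" "D' \<in> thin_classes" "s \<in> walls_base" for C' D' s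
  proof -
    have "frame_dist C' D' \<in> carrier W" "s \<in> carrier W"
      using frame_dist_in_W' that walls_base_subset_W' W'_closed by blast+
    then show ?thesis
      using frame_dist_\<theta> that by (simp add: \<sigma>'_eq_iff)
  qed
  ultimately show ?thesis
    using iso by (simp add: companion_def frame_gens_eq)
qed

lemma frame_dist_base:
  assumes "g \<in> W'"
  shows "frame_dist base_class (thin_equiv `` {coord g}) = g"
proof -
  have g: "coord g \<in> Ch" "g \<in> carrier W" using assms by auto
  have "rep (thin_equiv `` {coord g}) = coord g"
    using rep_eqI[OF thin_class_in[OF g(1)]] assms by simp
  then show ?thesis using g by (simp add: frame_dist_rep rep_base_class)
qed

text \<open>\<open>uniclass\<close> may hand over any companion. Each wall \<open>r\<close> of the
  base class is the frame distance from \<open>base_class\<close> to the class of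
  \<open>coord r\<close>, which fixes the companion on generators and so on
  \<open>W'\<close>.\<close>

lemma companion_frame_unique:
  assumes \<tau>: "companion frame_group frame_gens thin_classes frame_dist (\<lambda>C'. \<theta> ` C') \<tau>"
    and g: "g \<in> W'"
  shows "\<tau> g = \<sigma>' g"
proof -
  have hom: "\<tau> \<in> hom frame_group frame_group"
    using \<tau> by (simp add: companion_def iso_def)
  have \<tau>_mult: "\<tau> (x \<otimes> y) = \<tau> x \<otimes> \<tau> y" if "x \<in> W'" "y \<in> W'" for x y
    using hom_mult[OF hom, of x y] that by (simp add: carrier_frame_group)
  have \<tau>_one: "\<tau> \<one> = \<one>"
    using hom_one[OF hom group_frame_group group_frame_group] by simp
  have gen: "\<tau> r = \<sigma>' r" if r: "r \<in> walls_base" for r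
  proof -
    have rW: "r \<in> W'" using r walls_base_subset_W' by blast
    let ?D = "thin_equiv `` {coord r}"
    have D: "?D \<in> thin_classes" using thin_class_in(1) rW by simp
    have d: "frame_dist base_class ?D = r" by (rule frame_dist_base[OF rW])
    then have "frame_dist (\<theta> ` base_class) (\<theta> ` ?D) = \<tau> r"
      using \<tau> r base_class_thin D unfolding companion_def frame_gens_eq by blast
    then show ?thesis
      using frame_dist_\<theta>[OF base_class_thin D] d by simp
  qed
  have "\<tau> (word_prod W rs) = \<sigma>' (word_prod W rs)" if "rs \<in> lists walls_base" for rs
    using that
  proof (induction rs rule: list.induct)
    case Nil
    then show ?case by (simp add: \<tau>_one \<sigma>'_def)
  next
    case (Cons r rs)
    then have r: "r \<in> walls_base" "r \<in> W'" and rs: "rs \<in> lists walls_base" "word_prod W rs \<in> W'"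
      using walls_base_subset_W' W'_words by auto
    then show ?case
      using Cons.IH[OF rs(1)] gen[OF r(1)] by (simp add: \<tau>_mult \<sigma>'_mult)
  qed
  then show ?thesis using g W'_words by auto
qed

section \<open>Comparison of the two displacements\<close>

lemma dist_rep_\<theta>:
  assumes C': "C' \<in> thin_classes"
  shows "\<delta> (rep C') (\<theta> (rep C')) = frame_dist C' (\<theta> ` C') \<otimes> a"
proof -
  have "\<delta> (rep C') (\<theta> (rep C')) =
      \<delta> (rep C') (rep (\<theta> ` C')) \<otimes> \<delta> (rep (\<theta> ` C')) (\<theta> (rep C'))"
    by (rule dist_thin_equiv[OF rep(2)[OF C'] rep_\<theta>_thin_equiv[OF C']])
  then show ?thesis
    using twist_eq_a[OF C'] by (simp add: frame_dist_rep twist_def)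
qed

text \<open>A wall crossing may a priori change \<open>\<delta> D (\<theta> D) = f\<close> to \<open>s f\<close> or \<open>f \<sigma>(s)\<close>, but
  these have the wrong sign if all displacements lie in one \<open>\<sigma>\<close>-class; what remains is
  \<open>f\<close> itself or \<open>s f \<sigma>(s)\<close>, and for thin panels only the latter.\<close>

lemma disp_conj_W':
  assumes parity: "\<And>C D. \<lbrakk>C \<in> Ch; D \<in> Ch\<rbrakk> \<Longrightarrow> even (len (\<delta> C (\<theta> C))) \<longleftrightarrow> even (len (\<delta> D (\<theta> D)))"
    and D: "D \<in> Ch"
  shows "\<exists>g\<in>W'. \<exists>v. v = g \<otimes> \<delta> C\<^sub>0 D \<and> \<delta> D (\<theta> D) = inv v \<otimes> \<delta> C\<^sub>0 (\<theta> C\<^sub>0) \<otimes> \<sigma> v"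
proof -
  define y where "y = \<delta> C\<^sub>0 (\<theta> C\<^sub>0)"
  have y: "y \<in> carrier W" by (simp add: y_def)
  have "\<forall>D\<in>Ch. \<delta> C\<^sub>0 D = x \<longrightarrow>
      (\<exists>g\<in>W'. \<delta> D (\<theta> D) = inv (g \<otimes> x) \<otimes> y \<otimes> \<sigma> (g \<otimes> x))" if "x \<in> carrier W" for x
    using that
  proof (induction rule: right_induct)
    case one
    show ?case
    proof (intro ballI impI)
      fix D assume "D \<in> Ch" "\<delta> C\<^sub>0 D = \<one>"
      then have "D = C\<^sub>0" using WD1 by auto
      then show "\<exists>g\<in>W'. \<delta> D (\<theta> D) = inv (g \<otimes> \<one>) \<otimes> y \<otimes> \<sigma> (g \<otimes> \<one>)"
        using y W'_one by (intro bexI[of _ \<one>]) (simp_all flip: y_def)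
    qed
  next
    case (mult s x)
    show ?case
    proof (intro ballI impI)
      fix D assume D: "D \<in> Ch" "\<delta> C\<^sub>0 D = x \<otimes> s"
      have s: "s \<in> S" "s \<in> carrier W" and x: "x \<in> carrier W" using mult by auto
      obtain F where F: "F \<in> Ch" "\<delta> C\<^sub>0 F = x" "\<delta> F D = s"
        using ex_between[of x s C\<^sub>0 D] D s x by auto
      then obtain g where g: "g \<in> W'" "\<delta> F (\<theta> F) = inv (g \<otimes> x) \<otimes> y \<otimes> \<sigma> (g \<otimes> x)"
        using mult.IH by blast
      let ?f = "\<delta> F (\<theta> F)"
      have f: "?f \<in> carrier W" using F by simp
      have DF: "\<delta> D F = s" using dist_gen_sym[of F D] F D s by simp
      have \<sigma>s: "\<delta> (\<theta> F) (\<theta> D) = \<sigma> s" "\<sigma> s \<in> S"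
        using dist_\<theta>[of F D] F D s by auto
      show "\<exists>g\<in>W'. \<delta> D (\<theta> D) = inv (g \<otimes> (x \<otimes> s)) \<otimes> y \<otimes> \<sigma> (g \<otimes> (x \<otimes> s))"
      proof (cases "\<delta> D (\<theta> D) = s \<otimes> ?f \<otimes> \<sigma> s")
        case True
        then have "\<delta> D (\<theta> D) = inv (g \<otimes> (x \<otimes> s)) \<otimes> y \<otimes> \<sigma> (g \<otimes> (x \<otimes> s))"
          unfolding g(2) using g(1) x s y by (simp add: inv_mult_group m_assoc)
        with g(1) show ?thesis by blast
      next
        case False
        have "\<delta> D (\<theta> F) = s \<otimes> ?f \<or> \<delta> D (\<theta> F) = ?f"
          using WD2[of D F "\<theta> F" s] D F s DF by simp
        moreover have "\<delta> D (\<theta> D) = \<delta> D (\<theta> F) \<or> \<delta> D (\<theta> D) = \<delta> D (\<theta> F) \<otimes> \<sigma> s"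
          using dist_adj[of D "\<theta> F" "\<theta> D" "\<sigma> s"] D F \<sigma>s by simp
        moreover have "\<delta> D (\<theta> D) \<noteq> s \<otimes> ?f" "\<delta> D (\<theta> D) \<noteq> ?f \<otimes> \<sigma> s"
          using parity[OF D(1) F(1)] even_len_mult[of s ?f] even_len_mult[of ?f "\<sigma> s"]
            odd_len_gen[OF s(1)] odd_len_gen[OF \<sigma>s(2)] f s by auto
        ultimately have eq: "\<delta> D (\<theta> D) = ?f" using False by auto
        have "thick_panel (panel s F)"
        proof (rule ccontr)
          assume "\<not> thick_panel (panel s F)"
          then have FD: "(F, D) \<in> thin_adj" using F D s by (simp add: thin_adj_iff)
          then have "(D, F) \<in> thin_equiv"
            using thin_adj_sym F D by (auto simp: thin_equiv_def)
          moreover have "(F, D) \<in> thin_equiv"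
            using FD F D by (auto simp: thin_equiv_def)
          then have "(\<theta> F, \<theta> D) \<in> thin_equiv"
            using thin_equiv_\<theta> F D by simp
          ultimately have "\<delta> D (\<theta> D) = \<delta> D F \<otimes> \<delta> F (\<theta> F) \<otimes> \<delta> (\<theta> F) (\<theta> D)"
            by (rule dist_thin_equiv_both)
          then show False using False DF \<sigma>s by simp
        qed
        then have r: "conj_by x s \<in> T'"
          using thick_panel_iff[of C\<^sub>0 F s] F s by simp
        \<comment> \<open>The displacement is unchanged, so the old conjugator \<open>g x\<close>
          must serve again. Relative to the new position it reads
          \<open>(g x s (inv x)) (x s)\<close>, and the extra factor \<open>x s (inv x)\<close> is a
          thick reflection.\<close>
        have "g \<otimes> conj_by x s \<in> W'" using g(1) T'_subset_W'[OF r] by blast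
        moreover have "g \<otimes> conj_by x s \<otimes> (x \<otimes> s) = g \<otimes> x"
          using g(1) x s by (simp add: conj_by_def m_assoc gens_invol)
        ultimately show ?thesis using eq g(2) by metis
      qed
    qed
  qed
  then show ?thesis using D by (auto simp flip: y_def)
qed

lemma uniclass_imp_frame:
  assumes w: "w \<in> carrier W" and disp: "disp Ch \<delta> \<theta> \<subseteq> twisted_class W \<sigma> w"
  shows "uniclass frame_group frame_gens thin_classes frame_dist (\<lambda>C'. \<theta> ` C')"
proof -
  \<comment> \<open>\<open>\<sigma>\<close> preserves the sign, so the contributions of
    \<open>inv v\<close> and \<open>\<sigma> v\<close> cancel.\<close>
  have parity: "even (len (\<delta> D (\<theta> D))) \<longleftrightarrow> even (len w)" if "D \<in> Ch" for D
  proof -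
    have "\<delta> D (\<theta> D) \<in> twisted_class W \<sigma> w" using that disp by (auto simp: disp_def)
    then obtain v where "v \<in> carrier W" "\<delta> D (\<theta> D) = inv v \<otimes> w \<otimes> \<sigma> v"
      by (auto simp: twisted_class_def)
    then show ?thesis
      using w by (auto simp: even_len_mult even_len_inv even_len_\<sigma>)
  qed
  let ?y = "\<delta> C\<^sub>0 (\<theta> C\<^sub>0)"
  let ?w = "frame_dist base_class (\<theta> ` base_class)"
  have w': "?w \<in> W'" using frame_dist_in_W' base_class_thin image_thin_classes by blast
  have y: "?y = ?w \<otimes> a" using dist_rep_\<theta>[OF base_class_thin] by (simp add: rep_base_class)
  have "frame_dist C' (\<theta> ` C') \<in> twisted_class frame_group \<sigma>' ?w" if C': "C' \<in> thin_classes" for C'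
  proof -
    obtain g where g: "g \<in> W'" "\<delta> (rep C') (\<theta> (rep C')) =
        inv (g \<otimes> \<delta> C\<^sub>0 (rep C')) \<otimes> ?y \<otimes> \<sigma> (g \<otimes> \<delta> C\<^sub>0 (rep C'))"
      using disp_conj_W'[OF _ rep(2)[OF C']] parity by blast
    let ?v = "g \<otimes> \<delta> C\<^sub>0 (rep C')"
    \<comment> \<open>The position of \<open>rep C'\<close> lies in \<open>W'\<close>, so the coset
      \<open>W' \<delta> C\<^sub>0 (rep C')\<close> containing the conjugator is \<open>W'\<close>
      itself.\<close>
    have v: "?v \<in> W'" using g(1) rep(3)[OF C'] by blast
    have fd: "frame_dist C' (\<theta> ` C') \<in> carrier W"
      using frame_dist_in_W'[OF C' image_thin_classes[OF C']] by simp
    have vc: "?v \<in> carrier W" using v by simp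
    have "frame_dist C' (\<theta> ` C') = frame_dist C' (\<theta> ` C') \<otimes> a \<otimes> inv a"
      using fd by (simp add: m_assoc)
    also have "\<dots> = inv ?v \<otimes> (?w \<otimes> a) \<otimes> \<sigma> ?v \<otimes> inv a"
      using dist_rep_\<theta>[OF C'] g(2) y by simp
    also have "\<dots> = inv ?v \<otimes> ?w \<otimes> \<sigma>' ?v"
      using w' vc \<sigma>_closed[OF vc] by (simp add: \<sigma>'_def conj_by_def m_assoc del: \<sigma>_mult)
    also have "\<dots> = inv\<^bsub>frame_group\<^esub> ?v \<otimes>\<^bsub>frame_group\<^esub> ?w \<otimes>\<^bsub>frame_group\<^esub> \<sigma>' ?v"
      using v by (simp add: inv_frame_group)
    finally show ?thesis
      using v unfolding twisted_class_def carrier_frame_group by blast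
  qed
  then have "disp thin_classes frame_dist (\<lambda>C'. \<theta> ` C') \<subseteq> twisted_class frame_group \<sigma>' ?w"
    by (auto simp: disp_def)
  then show ?thesis
    unfolding uniclass_def using companion_frame w' carrier_frame_group by blast
qed

lemma frame_imp_uniclass:
  assumes "uniclass frame_group frame_gens thin_classes frame_dist (\<lambda>C'. \<theta> ` C')"
  shows "uniclass W S Ch \<delta> \<theta>"
proof -
  obtain \<tau> w where \<tau>: "companion frame_group frame_gens thin_classes frame_dist (\<lambda>C'. \<theta> ` C') \<tau>"
    and w: "w \<in> W'" and disp: "disp thin_classes frame_dist (\<lambda>C'. \<theta> ` C') \<subseteq> twisted_class frame_group \<tau> w"
    using assms unfolding uniclass_def carrier_frame_group by blast
  \<comment> \<open>At a representative the displacement is the frame displacement times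
    \<open>a\<close>; this dictates the class representative \<open>w a\<close>.\<close>
  have "\<delta> D (\<theta> D) \<in> twisted_class W \<sigma> (w \<otimes> a)" if D: "D \<in> Ch" for D
  proof -
    let ?C = "thin_equiv `` {D}"
    have C: "?C \<in> thin_classes" and DC: "D \<in> ?C" using thin_class_in D by auto
    let ?P = "rep ?C" and ?x = "frame_dist ?C (\<theta> ` ?C)"
    have P: "?P \<in> Ch" using rep(2)[OF C] .
    have "?x \<in> twisted_class frame_group \<tau> w"
      using disp C by (auto simp: disp_def)
    then obtain v where v: "v \<in> W'" "?x = inv v \<otimes> w \<otimes> \<sigma>' v"
      by (auto simp: twisted_class_def carrier_frame_group inv_frame_group companion_frame_unique[OF \<tau>])
    let ?u = "\<delta> ?P D"
    have PD: "(?P, D) \<in> thin_equiv" using rep_thin_equiv[OF C DC] .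
    then have "(D, ?P) \<in> thin_equiv" using equiv_thin by (meson equivE symD)
    moreover have "(\<theta> ?P, \<theta> D) \<in> thin_equiv" using PD thin_equiv_\<theta>[OF P D] by simp
    ultimately have "\<delta> D (\<theta> D) = \<delta> D ?P \<otimes> \<delta> ?P (\<theta> ?P) \<otimes> \<delta> (\<theta> ?P) (\<theta> D)"
      by (rule dist_thin_equiv_both)
    also have "\<dots> = inv ?u \<otimes> (?x \<otimes> a) \<otimes> \<sigma> ?u"
      using dist_inv[OF P D] dist_rep_\<theta>[OF C] dist_\<theta>[OF P D] by simp
    \<comment> \<open>Here \<open>\<sigma>'(v) a = a \<sigma>(v)\<close>, so the conjugator
      \<open>v\<close> of the frame combines with \<open>?u\<close> into the conjugator
      \<open>v ?u\<close>.\<close>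
    also have "\<dots> = inv (v \<otimes> ?u) \<otimes> (w \<otimes> a) \<otimes> \<sigma> (v \<otimes> ?u)"
    proof -
      have *: "inv u \<otimes> (inv v \<otimes> w \<otimes> \<sigma>' v \<otimes> a) \<otimes> \<sigma> u = inv (v \<otimes> u) \<otimes> (w \<otimes> a) \<otimes> \<sigma> (v \<otimes> u)"
        if "u \<in> carrier W" "v \<in> carrier W" "w \<in> carrier W" for u v w
        using that by (simp add: \<sigma>'_def conj_by_def m_assoc inv_mult_group)
      show ?thesis
        unfolding v(2) by (rule *) (use v(1) w P D in simp_all)
    qed
    finally have "\<delta> D (\<theta> D) = inv (v \<otimes> ?u) \<otimes> (w \<otimes> a) \<otimes> \<sigma> (v \<otimes> ?u)" .
    moreover have "v \<otimes> ?u \<in> carrier W" using v(1) P D by simp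
    ultimately show ?thesis unfolding twisted_class_def by blast
  qed
  then have "disp Ch \<delta> \<theta> \<subseteq> twisted_class W \<sigma> (w \<otimes> a)"
    by (auto simp: disp_def)
  then show ?thesis
    unfolding uniclass_def using comp w by (meson W'_closed a_closed m_closed)
qed

end

theorem theorem2p20:
  fixes W :: "('w, 'm) monoid_scheme" and S :: "'w set"
    and Ch :: "'c set" and \<delta> :: "'c \<Rightarrow> 'c \<Rightarrow> 'w"
    and A\<^sub>0 :: "'c set" and C\<^sub>0 :: 'c and \<theta> :: "'c \<Rightarrow> 'c"
  assumes "spherical_building W S Ch \<delta>"
    and "irreducible_type W S"
    and "\<not> building.thick W S Ch \<delta>"
    and "thick_frame W S Ch \<delta> A\<^sub>0 C\<^sub>0"
    and "building_automorphism W S Ch \<delta> \<theta>"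
  shows "uniclass W S Ch \<delta> \<theta> \<longleftrightarrow>
    uniclass (thick_frame.frame_group W S Ch \<delta> A\<^sub>0 C\<^sub>0) (thick_frame.frame_gens W S Ch \<delta> A\<^sub>0 C\<^sub>0)
      (building.thin_classes W S Ch \<delta>) (thick_frame.frame_dist W S Ch \<delta> A\<^sub>0 C\<^sub>0) (\<lambda>C'. \<theta> ` C')"
proof -
  \<comment> \<open>Any companion can be fixed in the locale: one implication takes the one supplied
    by \<open>uniclass\<close>, the other the one supplied by
    \<open>building_automorphism\<close>.\<close>
  have aut: "frame_automorphism W S Ch \<delta> A\<^sub>0 C\<^sub>0 \<theta> \<sigma>" if "companion W S Ch \<delta> \<theta> \<sigma>" for \<sigma>
    using assms(4,5) that
    by (simp add: frame_automorphism_def frame_automorphism_axioms_def building_automorphism_def)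
  show ?thesis
  proof
    assume "uniclass W S Ch \<delta> \<theta>"
    then obtain \<sigma> w where "companion W S Ch \<delta> \<theta> \<sigma>" "w \<in> carrier W"
      "disp Ch \<delta> \<theta> \<subseteq> twisted_class W \<sigma> w"
      by (auto simp: uniclass_def)
    then show "uniclass (thick_frame.frame_group W S Ch \<delta> A\<^sub>0 C\<^sub>0)
      (thick_frame.frame_gens W S Ch \<delta> A\<^sub>0 C\<^sub>0) (building.thin_classes W S Ch \<delta>)
      (thick_frame.frame_dist W S Ch \<delta> A\<^sub>0 C\<^sub>0) (\<lambda>C'. \<theta> ` C')"
      using frame_automorphism.uniclass_imp_frame[OF aut] by blast
  next
    obtain \<sigma> where "companion W S Ch \<delta> \<theta> \<sigma>"
      using assms(5) by (auto simp: building_automorphism_def)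
    moreover assume "uniclass (thick_frame.frame_group W S Ch \<delta> A\<^sub>0 C\<^sub>0)
      (thick_frame.frame_gens W S Ch \<delta> A\<^sub>0 C\<^sub>0) (building.thin_classes W S Ch \<delta>)
      (thick_frame.frame_dist W S Ch \<delta> A\<^sub>0 C\<^sub>0) (\<lambda>C'. \<theta> ` C')"
    ultimately show "uniclass W S Ch \<delta> \<theta>"
      using frame_automorphism.frame_imp_uniclass[OF aut] by blast
  qed
qed

end
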